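(* Let $K/k$, $k=\mathbb{F}_q(T)$, be a cyclic extension of degree $p^n$ whose ramified prime divisors are $P_1,\ldots,P_r\in R_T^+$ (distinct) and possibly $\mathfrak{p}_\infty$. Then $K=k(\vec y)$ for a Witt vector $\vec y=(y_1,\dots,y_n)$ of length $n$ satisfying \[ \vec y^{\,p}\ominus\vec y=\vec\beta=\vec\delta_1\oplus\cdots\oplus\vec\delta_r\oplus\vec\mu, \] where $\vec\beta=(\beta_1,\dots,\beta_n)\in W_n(k)$ with $\beta_1\notin\wp(k)$; $\vec\delta_i=(\delta_{i1},\dots,\delta_{in})$ with $\delta_{ij}=\frac{Q_{ij}}{P_i^{e_{ij}}}$, $e_{ij}\ge 0$, $Q_{ij}\in R_T$, and whenever $e_{ij}>0$ one has $p\nmid e_{ij}$, $\gcd(Q_{ij},P_i)=1$ and $\deg Q_{ij}<\deg(P_i^{e_{ij}})$; and $\vec\mu=(\mu_1,\dots,\mu_n)$ with $\mu_j=f_j(T)\in R_T$ and $p\nmid\deg f_j$ whenever $f_j\notin\mathbb{F}_q$.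
   Context: $q$ is a power of the prime $p$, $k=\mathbb{F}_q(T)$, $R_T=\mathbb{F}_q[T]$, $R_T^+$ the set of monic irreducible polynomials of $R_T$, $\mathfrak{p}_\infty$ the pole divisor of $T$ in $k$; all fields lie in a fixed algebraic closure of $k$. For a field $L$ of characteristic $p$, $W_n(L)$ is the ring of Witt vectors of length $n$ over $L$, with Witt addition $\oplus$ and subtraction $\ominus$: these are the operations on $n$-tuples transported from componentwise operations on ghost components $a^{(m)}=a_1^{p^{m-1}}+pa_2^{p^{m-2}}+\cdots+p^{m-1}a_m$ ($1\le m\le n$), i.e. given by the resulting universal integral polynomials reduced mod $p$. For $\vec y=(y_1,\dots,y_n)$, $\vec y^{\,p}=(y_1^p,\dots,y_n^p)$, and $k(\vec y)=k(y_1,\dots,y_n)$. $\wp(k)=\{a^p-a:a\in k\}$. *)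

theory Defs
  imports "HOL-Computational_Algebra.Computational_Algebra" "HOL-Library.Poly_Mapping"
begin

text \<open>Multivariate integer polynomials in variables indexed by nat.
  Variable 2i stands for X_(i+1), variable 2i+1 for Y_(i+1) (0-based index i).\<close>

type_synonym ipoly = "(nat \<Rightarrow>\<^sub>0 nat) \<Rightarrow>\<^sub>0 int"

definition ivar :: "nat \<Rightarrow> ipoly" where
  "ivar v = Poly_Mapping.single (Poly_Mapping.single v 1) 1"

definition ghost_poly :: "nat \<Rightarrow> (nat \<Rightarrow> ipoly) \<Rightarrow> nat \<Rightarrow> ipoly" where
  "ghost_poly p V m = (\<Sum>i\<le>m. of_nat (p ^ i) * (V i) ^ (p ^ (m - i)))"

definition ipoly_div :: "ipoly \<Rightarrow> nat \<Rightarrow> ipoly" where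
  "ipoly_div P d = Poly_Mapping.map (\<lambda>c. c div int d) P"

text \<open>The list [S_0, ..., S_(m-1)] of universal polynomials transporting the
  componentwise operation c on ghost components (c = (+) gives Witt addition,
  c = (-) gives Witt subtraction).  The division is exact over the integers.\<close>

primrec witt_poly_list :: "nat \<Rightarrow> (ipoly \<Rightarrow> ipoly \<Rightarrow> ipoly) \<Rightarrow> nat \<Rightarrow> ipoly list" where
  "witt_poly_list p c 0 = []"
| "witt_poly_list p c (Suc m) = witt_poly_list p c m @
     [ipoly_div (c (ghost_poly p (\<lambda>i. ivar (2 * i)) m) (ghost_poly p (\<lambda>i. ivar (2 * i + 1)) m)
                 - (\<Sum>i<m. of_nat (p ^ i) * (witt_poly_list p c m ! i) ^ (p ^ (m - i))))
                (p ^ m)]"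

definition witt_poly :: "nat \<Rightarrow> (ipoly \<Rightarrow> ipoly \<Rightarrow> ipoly) \<Rightarrow> nat \<Rightarrow> ipoly" where
  "witt_poly p c m = witt_poly_list p c (Suc m) ! m"

definition eval_ipoly :: "(nat \<Rightarrow> 'b::comm_ring_1) \<Rightarrow> ipoly \<Rightarrow> 'b" where
  "eval_ipoly a P = (\<Sum>mon\<in>Poly_Mapping.keys P.
      of_int (Poly_Mapping.lookup P mon) *
      (\<Prod>v\<in>Poly_Mapping.keys mon. a v ^ Poly_Mapping.lookup mon v))"

text \<open>Witt vectors of length n over a ring of characteristic p are represented
  as functions nat => 'b; component j (0-based) is the (j+1)-st entry, only
  components j < n matter, results are 0 beyond n.\<close>

definition witt_op :: "nat \<Rightarrow> (ipoly \<Rightarrow> ipoly \<Rightarrow> ipoly) \<Rightarrow> nat \<Rightarrow>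
    (nat \<Rightarrow> 'b::comm_ring_1) \<Rightarrow> (nat \<Rightarrow> 'b) \<Rightarrow> (nat \<Rightarrow> 'b)" where
  "witt_op p c n x y = (\<lambda>m. if m < n then
      eval_ipoly (\<lambda>v. if even v then x (v div 2) else y (v div 2)) (witt_poly p c m) else 0)"

definition witt_add :: "nat \<Rightarrow> nat \<Rightarrow> (nat \<Rightarrow> 'b::comm_ring_1) \<Rightarrow> (nat \<Rightarrow> 'b) \<Rightarrow> (nat \<Rightarrow> 'b)" where
  "witt_add p n = witt_op p (+) n"

definition witt_sub :: "nat \<Rightarrow> nat \<Rightarrow> (nat \<Rightarrow> 'b::comm_ring_1) \<Rightarrow> (nat \<Rightarrow> 'b) \<Rightarrow> (nat \<Rightarrow> 'b)" where
  "witt_sub p n = witt_op p (-) n"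

definition field_hom :: "('a::field \<Rightarrow> 'b::field) \<Rightarrow> bool" where
  "field_hom f \<longleftrightarrow> f 1 = 1 \<and> (\<forall>x y. f (x + y) = f x + f y) \<and> (\<forall>x y. f (x * y) = f x * f y)"

definition is_subfield :: "'b::field set \<Rightarrow> bool" where
  "is_subfield F \<longleftrightarrow> 0 \<in> F \<and> 1 \<in> F \<and> (\<forall>x\<in>F. \<forall>y\<in>F. x + y \<in> F \<and> x * y \<in> F)
      \<and> (\<forall>x\<in>F. - x \<in> F \<and> inverse x \<in> F)"

definition gen_field :: "'b::field set \<Rightarrow> 'b set" where
  "gen_field A = \<Inter>{F. is_subfield F \<and> A \<subseteq> F}"

definition galois_group :: "('k::field \<Rightarrow> 'K::field) \<Rightarrow> ('K \<Rightarrow> 'K) set" where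
  "galois_group emb = {\<sigma>. bij \<sigma> \<and> field_hom \<sigma> \<and> (\<forall>x. \<sigma> (emb x) = emb x)}"

text \<open>K/k is a cyclic (Galois) extension of degree d: the automorphism group is
  finite of order d, cyclic, and its fixed field is exactly k (Artin).\<close>
definition cyclic_galois_of_degree :: "('k::field \<Rightarrow> 'K::field) \<Rightarrow> nat \<Rightarrow> bool" where
  "cyclic_galois_of_degree emb d \<longleftrightarrow>
     finite (galois_group emb) \<and> card (galois_group emb) = d \<and>
     (\<exists>\<sigma>\<in>galois_group emb. \<forall>\<tau>\<in>galois_group emb. \<exists>m. \<tau> = \<sigma> ^^ m) \<and>
     {x. \<forall>\<sigma>\<in>galois_group emb. \<sigma> x = x} = range emb"

definition discrete_valuation :: "('K::field \<Rightarrow> int) \<Rightarrow> bool" where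
  "discrete_valuation v \<longleftrightarrow>
     (\<forall>x y. x \<noteq> 0 \<longrightarrow> y \<noteq> 0 \<longrightarrow> v (x * y) = v x + v y) \<and>
     (\<forall>x y. x \<noteq> 0 \<longrightarrow> y \<noteq> 0 \<longrightarrow> x + y \<noteq> 0 \<longrightarrow> v (x + y) \<ge> min (v x) (v y)) \<and>
     (\<exists>x. x \<noteq> 0 \<and> v x = 1)"

definition monic_irred :: "'a::field_gcd poly \<Rightarrow> bool" where
  "monic_irred P \<longleftrightarrow> lead_coeff P = 1 \<and> irreducible P"

definition lies_over :: "('a::field_gcd poly fract \<Rightarrow> 'K::field) \<Rightarrow> ('K \<Rightarrow> int) \<Rightarrow> 'a poly \<Rightarrow> nat \<Rightarrow> bool" where
  "lies_over emb v P e \<longleftrightarrow> (\<forall>a b. a \<noteq> 0 \<longrightarrow> b \<noteq> 0 \<longrightarrow>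
      v (emb (Fract a b)) = int e * (int (multiplicity P a) - int (multiplicity P b)))"

definition ramified_at :: "('a::field_gcd poly fract \<Rightarrow> 'K::field) \<Rightarrow> 'a poly \<Rightarrow> bool" where
  "ramified_at emb P \<longleftrightarrow> (\<exists>v e. discrete_valuation v \<and> lies_over emb v P e \<and> e > 1)"

definition artin_schreier_image :: "nat \<Rightarrow> 'b::field set" where
  "artin_schreier_image p = {a ^ p - a | a. True}"

end

theory Submission
  imports Defs
begin

text \<open>
  Let \<open>\<sigma>\<close> generate the Galois group. Since \<open>W\<^sub>n(K)\<close> contains an element of trace one and
  \<open>p ^ n\<close> kills \<open>W\<^sub>n(K)\<close>, additive Hilbert 90 gives \<open>y\<close> with \<open>\<sigma> y = y \<oplus> 1\<close>. Then \<open>y\<^sup>p \<ominus> y\<close> is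
  fixed by \<open>\<sigma>\<close>, and because \<open>p ^ (n - 1)\<close> times the unit vector is not zero, some entry of \<open>y\<close> has
  \<open>p ^ n\<close> distinct conjugates and so generates \<open>K\<close>. Replacing \<open>y\<close> by \<open>y \<oplus> x\<close> with
  \<open>x \<in> W\<^sub>n(k)\<close> preserves these properties; as \<open>\<bbbF>\<^sub>q\<close> and the residue fields are perfect, partial
  fractions and a choice of \<open>x\<close> bring the entries into normal form one after another. If an
  unramified prime \<open>P\<close> survived in an entry, with the lower ones integral at \<open>P\<close>, then a valuation of
  \<open>K\<close> over \<open>P\<close> would satisfy \<open>p * v (y\<^sub>j) = - e\<close> with \<open>p\<close> not dividing \<open>e\<close>. Extensions of the
  \<open>P\<close>-adic valuation exist: a subring of \<open>K\<close> maximal without \<open>1 / P\<close> is a valuation ring, and its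
  value group is discrete because \<open>K\<close> has bounded degree over \<open>k\<close>.
\<close>

section \<open>Integer polynomials and their evaluation\<close>

text \<open>The Witt polynomials are given only through division by \<open>p ^ m\<close>, and in
  characteristic \<open>p\<close> the ghost components no longer determine a vector; so identities
  are proved for integer polynomials and then specialised. What allows work entry by entry is a
  linearity: entry \<open>m\<close> of a Witt sum is \<open>x m + y m\<close> plus a universal
  polynomial in the lower entries. Hence a change of one entry moves the same entry of the result by
  the same amount and leaves the lower ones alone. The element of trace one, the normal form and the
  pole argument all rest on this. Being unramified at \<open>P\<close> only bounds the index of
  those valuations of \<open>K\<close> that lie over \<open>P\<close>. It excludes a pole only once
  such a valuation is known to exist, which is why an extension theorem is needed at all.\<close>

definition rhom :: "('a::comm_ring_1 \<Rightarrow> 'b::comm_ring_1) \<Rightarrow> bool" where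
  "rhom h \<longleftrightarrow> h 1 = 1 \<and> (\<forall>x y. h (x + y) = h x + h y) \<and> (\<forall>x y. h (x * y) = h x * h y)"

lemma rhom_one: "rhom h \<Longrightarrow> h 1 = 1"
  and rhom_add: "rhom h \<Longrightarrow> h (x + y) = h x + h y"
  and rhom_mult: "rhom h \<Longrightarrow> h (x * y) = h x * h y"
  by (simp_all add: rhom_def)

lemma rhom_zero: "rhom h \<Longrightarrow> h 0 = 0"
  using rhom_add[of h 0 0] by simp

lemma rhom_uminus: "rhom h \<Longrightarrow> h (- x) = - h x"
  using rhom_add[of h x "- x"] by (simp add: rhom_zero eq_neg_iff_add_eq_0 add.commute)

lemma rhom_diff: "rhom h \<Longrightarrow> h (x - y) = h x - h y"
  using rhom_add[of h x "- y"] by (simp add: rhom_uminus)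

lemma rhom_power: "rhom h \<Longrightarrow> h (x ^ n) = h x ^ n"
  by (induction n) (simp_all add: rhom_one rhom_mult)

lemma rhom_sum: "rhom h \<Longrightarrow> h (sum f S) = (\<Sum>x\<in>S. h (f x))"
  by (induction S rule: infinite_finite_induct) (simp_all add: rhom_zero rhom_add)

lemma rhom_prod: "rhom h \<Longrightarrow> h (prod f S) = (\<Prod>x\<in>S. h (f x))"
  by (induction S rule: infinite_finite_induct) (simp_all add: rhom_one rhom_mult)

lemma rhom_of_nat: "rhom h \<Longrightarrow> h (of_nat n) = of_nat n"
  by (induction n) (simp_all add: rhom_zero rhom_one rhom_add)

lemma rhom_of_int: "rhom h \<Longrightarrow> h (of_int n) = of_int n"
  by (cases n rule: int_cases2) (simp_all add: rhom_of_nat rhom_uminus)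

lemma rhom_compose: "rhom g \<Longrightarrow> rhom h \<Longrightarrow> rhom (\<lambda>x. g (h x))"
  by (simp add: rhom_def)

lemma rhom_of_int_fun: "rhom of_int"
  by (simp add: rhom_def)

lemmas rhom_simps = rhom_one rhom_zero rhom_add rhom_mult rhom_uminus rhom_diff rhom_power
  rhom_sum rhom_prod rhom_of_nat rhom_of_int

lemma poly_mapping_expand:
  "P = (\<Sum>m\<in>Poly_Mapping.keys P. Poly_Mapping.single m (Poly_Mapping.lookup P m))"
proof (rule poly_mapping_eqI)
  fix k
  have "(\<Sum>m\<in>Poly_Mapping.keys P. (Poly_Mapping.lookup P m when m = k)) =
        (\<Sum>m\<in>Poly_Mapping.keys P. (if m = k then Poly_Mapping.lookup P m else 0))"
    by (intro sum.cong) (auto simp: when_def)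
  also have "\<dots> = Poly_Mapping.lookup P k"
    by (simp add: sum.delta' in_keys_iff)
  finally show "Poly_Mapping.lookup P k = Poly_Mapping.lookup (\<Sum>m\<in>Poly_Mapping.keys P.
      Poly_Mapping.single m (Poly_Mapping.lookup P m)) k"
    by (simp add: lookup_sum lookup_single)
qed

lemma poly_mapping_single_add_induct [case_names single add]:
  fixes P :: "'a \<Rightarrow>\<^sub>0 'b::comm_monoid_add"
  assumes "\<And>m c. Q (Poly_Mapping.single m c)" and "\<And>f g. Q f \<Longrightarrow> Q g \<Longrightarrow> Q (f + g)"
  shows "Q P"
proof -
  have "Q (\<Sum>m\<in>S. Poly_Mapping.single m (Poly_Mapping.lookup P m))" for S
    by (induction S rule: infinite_finite_induct) (use assms(1)[of undefined 0] in \<open>auto intro: assms\<close>)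
  from this[of "Poly_Mapping.keys P"] show ?thesis
    by (simp flip: poly_mapping_expand)
qed

definition mon_eval :: "(nat \<Rightarrow> 'b::comm_ring_1) \<Rightarrow> (nat \<Rightarrow>\<^sub>0 nat) \<Rightarrow> 'b" where
  "mon_eval a m = (\<Prod>v\<in>Poly_Mapping.keys m. a v ^ Poly_Mapping.lookup m v)"

lemma mon_eval_superset:
  assumes "finite S" "Poly_Mapping.keys m \<subseteq> S"
  shows "mon_eval a m = (\<Prod>v\<in>S. a v ^ Poly_Mapping.lookup m v)"
  unfolding mon_eval_def using assms
  by (intro prod.mono_neutral_left) (auto simp: in_keys_iff)

lemma mon_eval_add: "mon_eval a (m + m') = mon_eval a m * mon_eval a m'"
proof -
  let ?S = "Poly_Mapping.keys m \<union> Poly_Mapping.keys m'"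
  have "mon_eval a (m + m') = (\<Prod>v\<in>?S. a v ^ Poly_Mapping.lookup (m + m') v)"
    using keys_add[of m m'] by (intro mon_eval_superset) auto
  moreover have "mon_eval a m = (\<Prod>v\<in>?S. a v ^ Poly_Mapping.lookup m v)"
    "mon_eval a m' = (\<Prod>v\<in>?S. a v ^ Poly_Mapping.lookup m' v)"
    by (intro mon_eval_superset; auto)+
  ultimately show ?thesis
    by (simp add: lookup_add power_add prod.distrib)
qed

lemma eval_ipoly_superset:
  assumes "finite S" "Poly_Mapping.keys P \<subseteq> S"
  shows "eval_ipoly a P = (\<Sum>m\<in>S. of_int (Poly_Mapping.lookup P m) * mon_eval a m)"
  unfolding eval_ipoly_def mon_eval_def using assms
  by (intro sum.mono_neutral_left) (auto simp: in_keys_iff)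

lemma eval_ipoly_single:
  "eval_ipoly a (Poly_Mapping.single m c) = of_int c * mon_eval a m"
  by (subst eval_ipoly_superset[of "{m}"]) (auto simp: lookup_single)

lemma eval_ipoly_add: "eval_ipoly a (P + Q) = eval_ipoly a P + eval_ipoly a Q"
proof -
  let ?S = "Poly_Mapping.keys P \<union> Poly_Mapping.keys Q"
  have "eval_ipoly a (P + Q) = (\<Sum>m\<in>?S. of_int (Poly_Mapping.lookup (P + Q) m) * mon_eval a m)"
    using keys_add[of P Q] by (intro eval_ipoly_superset) auto
  moreover have "eval_ipoly a P = (\<Sum>m\<in>?S. of_int (Poly_Mapping.lookup P m) * mon_eval a m)"
    "eval_ipoly a Q = (\<Sum>m\<in>?S. of_int (Poly_Mapping.lookup Q m) * mon_eval a m)"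
    by (intro eval_ipoly_superset; auto)+
  ultimately show ?thesis
    by (simp add: lookup_add sum.distrib algebra_simps)
qed

lemma eval_ipoly_mult: "eval_ipoly a (P * Q) = eval_ipoly a P * eval_ipoly a Q"
proof (induction P rule: poly_mapping_single_add_induct)
  case (single m c)
  show ?case
    by (induction Q rule: poly_mapping_single_add_induct)
      (simp_all add: mult_single eval_ipoly_single mon_eval_add distrib_left distrib_right eval_ipoly_add mult_ac)
next
  case (add f g)
  then show ?case by (simp add: distrib_right eval_ipoly_add)
qed

lemma rhom_eval_ipoly: "rhom (eval_ipoly a)"
proof -
  have "eval_ipoly a (Poly_Mapping.single 0 1) = 1"
    by (simp only: eval_ipoly_single) (simp add: mon_eval_def)
  then show ?thesis
    by (simp add: rhom_def eval_ipoly_add eval_ipoly_mult)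
qed

lemma eval_ipoly_ivar: "eval_ipoly a (ivar v) = a v"
  by (simp add: ivar_def eval_ipoly_single mon_eval_def)

lemma rhom_eval_ipoly_commute: "rhom h \<Longrightarrow> h (eval_ipoly a P) = eval_ipoly (\<lambda>v. h (a v)) P"
  by (simp add: eval_ipoly_def rhom_simps)

text \<open>Integer constants and variables generate \<open>ipoly\<close> as a ring. Both the
  Frobenius congruence and the closure of subrings under evaluation are checked on these
  generators.\<close>

lemma ipoly_induct [case_names const var add mult]:
  fixes P :: ipoly
  assumes const: "\<And>c. Q (of_int c)" and var: "\<And>v. Q (ivar v)"
    and add: "\<And>f g. Q f \<Longrightarrow> Q g \<Longrightarrow> Q (f + g)" and mult: "\<And>f g. Q f \<Longrightarrow> Q g \<Longrightarrow> Q (f * g)"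
  shows "Q P"
proof (induction P rule: poly_mapping_single_add_induct)
  case (single m c)
  have "Q (Poly_Mapping.single m 1)"
  proof (induction m rule: poly_mapping_single_add_induct)
    case (single v k)
    show ?case
    proof (induction k)
      case 0
      then show ?case using const[of 1] by simp
    next
      case (Suc k)
      have "Poly_Mapping.single (Poly_Mapping.single v (Suc k)) (1::int) =
            ivar v * Poly_Mapping.single (Poly_Mapping.single v k) 1"
        by (simp add: ivar_def mult_single flip: single_add)
      then show ?case using Suc var mult by simp
    qed
  next
    case (add m m')
    have "Poly_Mapping.single (m + m') (1::int) = Poly_Mapping.single m 1 * Poly_Mapping.single m' 1"
      by (simp add: mult_single)
    then show ?case using add mult by simp
  qed
  moreover have "Poly_Mapping.single m c = of_int c * Poly_Mapping.single m 1"
  proof -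
    have "(of_int c :: ipoly) = Poly_Mapping.single 0 c"
      using single_of_int[of c, where 'a = "nat \<Rightarrow>\<^sub>0 nat" and 'b = int] by simp
    then show ?thesis by (simp add: mult_single)
  qed
  ultimately show ?case using const mult by simp
next
  case (add f g)
  then show ?case using assms by blast
qed

text \<open>\<open>ipoly_div\<close> rounds coefficientwise, so it is a genuine division only on
  multiples of \<open>d\<close>. Once integrality is known, this turns the definition of
  \<open>witt_poly\<close> into an equation.\<close>

lemma ipoly_div_exact:
  assumes "d > 0"
  shows "ipoly_div (of_nat d * P) d = P"
proof (rule poly_mapping_eqI)
  fix k
  have "(of_nat d :: ipoly) = Poly_Mapping.single 0 (int d)"
    by simp
  then have "of_nat d * P = Poly_Mapping.map ((*) (int d)) P"
    by (simp only: mult_map_scale_conv_mult)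
  moreover have "Poly_Mapping.lookup (Poly_Mapping.map ((*) (int d)) P) k = int d * Poly_Mapping.lookup P k"
    by (simp add: map.rep_eq when_def)
  ultimately show "Poly_Mapping.lookup (ipoly_div (of_nat d * P) d) k = Poly_Mapping.lookup P k"
    using assms by (simp add: ipoly_div_def map.rep_eq when_def)
qed

section \<open>Congruences modulo powers of a prime\<close>

lemma prime_dvd_freshman:
  fixes x y :: "'a::comm_ring_1"
  assumes "prime p"
  shows "of_nat p dvd (x + y) ^ p - (x ^ p + y ^ p)"
proof -
  have p0: "p > 0" using assms prime_gt_0_nat by blast
  have "(x + y) ^ p = (\<Sum>k\<le>p. of_nat (p choose k) * x ^ k * y ^ (p - k))"
    by (rule binomial_ring)
  also have "{..p} = insert 0 (insert p {0<..<p})" using p0 by auto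
  also have "(\<Sum>k\<in>insert 0 (insert p {0<..<p}). of_nat (p choose k) * x ^ k * y ^ (p - k)) =
      y ^ p + (x ^ p + (\<Sum>k\<in>{0<..<p}. of_nat (p choose k) * x ^ k * y ^ (p - k)))"
    using p0 by (subst sum.insert) auto
  finally have "(x + y) ^ p - (x ^ p + y ^ p) = (\<Sum>k\<in>{0<..<p}. of_nat (p choose k) * x ^ k * y ^ (p - k))"
    by simp
  moreover have "of_nat p dvd (of_nat (p choose k) * x ^ k * y ^ (p - k) :: 'a)" if "k \<in> {0<..<p}" for k
  proof -
    have "p dvd (p choose k)" using that assms by (intro dvd_choose_prime) auto
    then have "(of_nat p :: 'a) dvd of_nat (p choose k)" by (auto simp: dvd_def)
    then show ?thesis by (simp add: dvd_mult2)
  qed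
  ultimately show ?thesis by (auto intro: dvd_sum)
qed

lemma power_add_prime_char:
  fixes x y :: "'a::comm_ring_1"
  assumes "prime p" "of_nat p = (0::'a)"
  shows "(x + y) ^ p = x ^ p + y ^ p"
  using prime_dvd_freshman[OF assms(1), of x y] assms(2) by simp

lemma rhom_frobenius:
  assumes "prime p" "of_nat p = (0::'a::comm_ring_1)"
  shows "rhom (\<lambda>x::'a. x ^ p)"
  using power_add_prime_char[OF assms] by (simp add: rhom_def power_mult_distrib)

text \<open>In \<open>a ^ p - b ^ p = (a - b) * (\<Sum>i<p. ...)\<close> each of the
  \<open>p\<close> summands is congruent to \<open>b ^ (p - 1)\<close> modulo \<open>p\<close>, so
  the sum contributes one more factor \<open>p\<close>. The hypothesis \<open>j > 0\<close> supplies
  \<open>a\<close> congruent to \<open>b\<close> modulo \<open>p\<close>.\<close>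

lemma dvd_power_prime_diff:
  fixes a b :: "'a::comm_ring_1"
  assumes "j > 0" "of_nat (p ^ j) dvd a - b"
  shows "of_nat (p ^ Suc j) dvd a ^ p - b ^ p"
proof -
  have "(of_nat p :: 'a) dvd of_nat (p ^ j)" using assms(1) by simp
  then have pd: "of_nat p dvd a - b" using assms(2) dvd_trans by blast
  have 1: "of_nat p dvd b ^ (p - Suc i) * a ^ i - b ^ (p - 1)" if "i < p" for i
  proof -
    have "b ^ (p - 1) = b ^ (p - Suc i) * b ^ i" using that by (simp flip: power_add)
    then have "b ^ (p - Suc i) * a ^ i - b ^ (p - 1) = b ^ (p - Suc i) * (a ^ i - b ^ i)"
      by (simp add: algebra_simps)
    moreover have "of_nat p dvd a ^ i - b ^ i"
      using pd dvd_trans power_diff_sumr2[of a i b] by (metis dvd_triv_left)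
    ultimately show ?thesis by (metis dvd_mult)
  qed
  have "of_nat p dvd (\<Sum>i<p. b ^ (p - Suc i) * a ^ i - b ^ (p - 1)) + of_nat p * b ^ (p - 1)"
    using 1 by (intro dvd_add dvd_sum) auto
  then have "of_nat p dvd (\<Sum>i<p. b ^ (p - Suc i) * a ^ i)"
    by (simp add: sum_subtractf)
  then have "of_nat (p ^ j) * of_nat p dvd (a - b) * (\<Sum>i<p. b ^ (p - Suc i) * a ^ i)"
    using assms(2) by (intro mult_dvd_mono)
  moreover have "(of_nat (p ^ j) * of_nat p :: 'a) = of_nat (p ^ Suc j)"
    by (simp add: mult.commute)
  ultimately show ?thesis by (metis power_diff_sumr2)
qed

lemma dvd_power_prime_power_diff:
  fixes a b :: "'a::comm_ring_1"
  assumes "of_nat p dvd a - b"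
  shows "of_nat (p ^ Suc k) dvd a ^ (p ^ k) - b ^ (p ^ k)"
proof (induction k)
  case 0
  then show ?case using assms by simp
next
  case (Suc k)
  have "of_nat (p ^ Suc (Suc k)) dvd (a ^ (p ^ k)) ^ p - (b ^ (p ^ k)) ^ p"
    by (rule dvd_power_prime_diff) (use Suc in auto)
  then show ?case by (simp add: power_mult[symmetric] mult.commute)
qed

lemma prime_dvd_power_diff_self_int:
  fixes c :: int
  assumes "prime p"
  shows "int p dvd c ^ p - c"
proof -
  \<comment> \<open>Needed for the downward half of the integer induction; for \<open>p = 2\<close>
    the difference is \<open>2\<close> rather than \<open>0\<close>.\<close>
  have neg1: "int p dvd (-1) ^ p - (-1)"
  proof (cases "p = 2")
    case False
    then have "odd p" using assms by (metis prime_odd_nat prime_ge_2_nat le_neq_implies_less)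
    then show ?thesis by simp
  qed auto
  have step: "int p dvd (c + d) ^ p - (c + d)" if "int p dvd c ^ p - c" "int p dvd d ^ p - d" for c d
  proof -
    have "int p dvd ((c + d) ^ p - (c ^ p + d ^ p)) + (c ^ p - c) + (d ^ p - d)"
      using prime_dvd_freshman[OF assms, of c d] that by (intro dvd_add) auto
    then show ?thesis by (simp add: algebra_simps)
  qed
  show ?thesis
  proof (induction c rule: int_induct[where k = 0])
    case base
    then show ?case using assms prime_gt_0_nat[of p] by (simp add: power_0_left)
  next
    case (step1 i)
    then show ?case using step[of i 1] by simp
  next
    case (step2 i)
    then show ?case using step[of i "-1"] neg1 by simp
  qed
qed

text \<open>The endomorphism of the integer polynomial ring that replaces every variable by its
  \<open>p\<close>-th power: a lift of Frobenius to characteristic zero, as required by Dwork's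
  criterion.\<close>

definition frob_lift :: "nat \<Rightarrow> ipoly \<Rightarrow> ipoly" where
  "frob_lift p = eval_ipoly (\<lambda>v. ivar v ^ p)"

lemma rhom_frob_lift: "rhom (frob_lift p)"
  by (simp add: frob_lift_def rhom_eval_ipoly)

lemma frob_lift_cong:
  assumes "prime p"
  shows "of_nat p dvd f ^ p - frob_lift p f"
proof (induction f rule: ipoly_induct)
  case (const c)
  have "(of_int (int p) :: ipoly) dvd of_int (c ^ p - c)"
    using prime_dvd_power_diff_self_int[OF assms, of c] by (metis dvdE dvdI of_int_mult)
  then show ?case by (simp add: rhom_of_int[OF rhom_frob_lift])
next
  case (var v)
  then show ?case by (simp add: frob_lift_def eval_ipoly_ivar)
next
  case (add f g)
  have "of_nat p dvd ((f + g) ^ p - (f ^ p + g ^ p)) + (f ^ p - frob_lift p f) + (g ^ p - frob_lift p g)"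
    using prime_dvd_freshman[OF assms, of f g] add by (intro dvd_add) auto
  then show ?case by (simp add: rhom_add[OF rhom_frob_lift] algebra_simps)
next
  case (mult f g)
  have "(f * g) ^ p - frob_lift p (f * g) =
      (f ^ p - frob_lift p f) * g ^ p + frob_lift p f * (g ^ p - frob_lift p g)"
    by (simp add: rhom_mult[OF rhom_frob_lift] power_mult_distrib algebra_simps)
  then show ?case using mult by simp
qed

section \<open>Witt vectors\<close>

text \<open>Indices start at 0, so \<open>ghost p x m\<close> is the ghost component of number
  \<open>m + 1\<close>. Unlike \<open>ghost_poly\<close> it makes sense in every commutative ring
  and therefore commutes with evaluation.\<close>

definition ghost :: "nat \<Rightarrow> (nat \<Rightarrow> 'b::comm_ring_1) \<Rightarrow> nat \<Rightarrow> 'b" where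
  "ghost p x m = (\<Sum>i\<le>m. of_nat (p ^ i) * x i ^ (p ^ (m - i)))"

text \<open>The parameter \<open>s\<close> treats addition (\<open>s = 1\<close>) and subtraction (\<open>s = -1\<close>) at once.
  Vectors are not truncated here, so that they form a group on a whole function type.\<close>

definition lin_op :: "int \<Rightarrow> ipoly \<Rightarrow> ipoly \<Rightarrow> ipoly" where
  "lin_op s = (\<lambda>a b. a + of_int s * b)"

definition wop :: "nat \<Rightarrow> int \<Rightarrow> (nat \<Rightarrow> 'b::comm_ring_1) \<Rightarrow> (nat \<Rightarrow> 'b) \<Rightarrow> nat \<Rightarrow> 'b" where
  "wop p s x y m =
     eval_ipoly (\<lambda>v. if even v then x (v div 2) else y (v div 2)) (witt_poly p (lin_op s) m)"

lemma witt_add_eq_wop: "witt_add p n x y = (\<lambda>m. if m < n then wop p 1 x y m else 0)"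
proof -
  have "lin_op 1 = (+)" by (auto simp: lin_op_def)
  then show ?thesis by (simp only: witt_add_def witt_op_def wop_def)
qed

lemma witt_sub_eq_wop: "witt_sub p n x y = (\<lambda>m. if m < n then wop p (- 1) x y m else 0)"
proof -
  have "lin_op (- 1) = (-)" by (auto simp: lin_op_def fun_eq_iff)
  then show ?thesis by (simp only: witt_sub_def witt_op_def wop_def)
qed

lemma length_witt_poly_list [simp]: "length (witt_poly_list p c m) = m"
  by (induction m) auto

lemma witt_poly_list_nth: "i < m \<Longrightarrow> witt_poly_list p c m ! i = witt_poly p c i"
proof (induction m)
  case (Suc m)
  show ?case
  proof (cases "i = m")
    case True
    then show ?thesis by (simp only: witt_poly_def)
  next
    case False
    then show ?thesis using Suc by (simp add: nth_append)
  qed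
qed auto

lemma witt_poly_rec:
  "witt_poly p c m = ipoly_div (c (ghost p (\<lambda>i. ivar (2 * i)) m) (ghost p (\<lambda>i. ivar (2 * i + 1)) m)
      - (\<Sum>i<m. of_nat (p ^ i) * witt_poly p c i ^ (p ^ (m - i)))) (p ^ m)"
proof -
  have "(\<Sum>i<m. of_nat (p ^ i) * (witt_poly_list p c m ! i) ^ (p ^ (m - i))) =
        (\<Sum>i<m. of_nat (p ^ i) * witt_poly p c i ^ (p ^ (m - i)))"
    by (intro sum.cong) (auto simp: witt_poly_list_nth)
  then show ?thesis
    by (subst witt_poly_def) (simp add: nth_append ghost_poly_def ghost_def)
qed

lemma ghost_Suc: "ghost p x m = (\<Sum>i<m. of_nat (p ^ i) * x i ^ (p ^ (m - i))) + of_nat (p ^ m) * x m"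
  by (simp add: ghost_def lessThan_Suc_atMost[symmetric])

lemma rhom_ghost: "rhom h \<Longrightarrow> h (ghost p x m) = ghost p (\<lambda>i. h (x i)) m"
  unfolding ghost_def by (simp add: rhom_simps)

text \<open>Raising the variables to the power \<open>p\<close> turns the exponents
  \<open>p ^ (m - i)\<close> into \<open>p ^ (Suc m - i)\<close>; only the new top term is missing.
  The map \<open>g\<close> selects the even or the odd variables.\<close>

lemma frob_lift_ghost:
  "frob_lift p (ghost p (\<lambda>i. ivar (g i)) m) + of_nat (p ^ Suc m) * ivar (g (Suc m)) =
    ghost p (\<lambda>i. ivar (g i)) (Suc m)"
proof -
  have "frob_lift p (ghost p (\<lambda>i. ivar (g i)) m) = (\<Sum>i\<le>m. of_nat (p ^ i) * (ivar (g i) ^ p) ^ (p ^ (m - i)))"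
    unfolding rhom_ghost[OF rhom_frob_lift] by (simp add: ghost_def frob_lift_def eval_ipoly_ivar)
  also have "\<dots> = (\<Sum>i<Suc m. of_nat (p ^ i) * ivar (g i) ^ (p ^ (Suc m - i)))"
    by (intro sum.cong) (auto simp: Suc_diff_le simp flip: power_mult)
  finally show ?thesis by (simp only: ghost_Suc[of p _ "Suc m"])
qed

text \<open>Integrality of the Witt polynomials: by Dwork's criterion it suffices that the ghost component
  \<open>w m\<close> is congruent to the Frobenius lift of \<open>w (m - 1)\<close> modulo \<open>p ^ m\<close>.\<close>

lemma ghost_witt_poly:
  assumes "prime p"
  shows "ghost p (witt_poly p (lin_op s)) m =
    ghost p (\<lambda>i. ivar (2 * i)) m + of_int s * ghost p (\<lambda>i. ivar (2 * i + 1)) m"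
proof (induction m)
  case 0
  show ?case
    using ipoly_div_exact[of 1] witt_poly_rec[of p "lin_op s" 0]
    by (simp add: ghost_def lin_op_def)
next
  case (Suc m)
  let ?S = "witt_poly p (lin_op s)"
  let ?X = "\<lambda>i. ivar (2 * i)" and ?Y = "\<lambda>i. ivar (2 * i + 1)"
  let ?w = "\<lambda>m. ghost p ?X m + of_int s * ghost p ?Y m"
  let ?F = "frob_lift p" and ?R = "\<Sum>i\<le>m. of_nat (p ^ i) * ?S i ^ (p ^ (Suc m - i))"
  note F = rhom_simps[OF rhom_frob_lift]
  have w: "?w (Suc m) = ?F (?w m) + of_nat (p ^ Suc m) * (?X (Suc m) + of_int s * ?Y (Suc m))"
    unfolding frob_lift_ghost[of p "\<lambda>i. 2 * i" m, symmetric]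
      frob_lift_ghost[of p "\<lambda>i. 2 * i + 1" m, symmetric]
    by (simp only: F) (simp add: algebra_simps)
  have Fw: "?F (?w m) = (\<Sum>i\<le>m. of_nat (p ^ i) * ?F (?S i) ^ (p ^ (m - i)))"
    unfolding Suc[symmetric] rhom_ghost[OF rhom_frob_lift] by (simp only: ghost_def)
  have d: "of_nat (p ^ Suc m) dvd
      (\<Sum>i\<le>m. of_nat (p ^ i) * ?F (?S i) ^ (p ^ (m - i))) - ?R"
    unfolding sum_subtractf[symmetric]
  proof (rule dvd_sum)
    fix i assume "i \<in> {..m}"
    then have im: "i \<le> m" by simp
    \<comment> \<open>A congruence modulo \<open>p\<close> improves to one modulo
      \<open>p ^ (m - i + 1)\<close> after raising to the power \<open>p ^ (m - i)\<close>; the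
      coefficient \<open>p ^ i\<close> supplies the remaining factors.\<close>
    have "of_nat (p ^ Suc (m - i)) dvd ?F (?S i) ^ (p ^ (m - i)) - (?S i ^ p) ^ (p ^ (m - i))"
      using frob_lift_cong[OF assms, of "?S i"]
      by (intro dvd_power_prime_power_diff) (metis dvd_minus_iff minus_diff_eq)
    then have *: "of_nat (p ^ i) * of_nat (p ^ Suc (m - i)) dvd
        of_nat (p ^ i) * (?F (?S i) ^ (p ^ (m - i)) - (?S i ^ p) ^ (p ^ (m - i)))"
      by (rule mult_dvd_mono[OF dvd_refl])
    have 1: "of_nat (p ^ i) * of_nat (p ^ Suc (m - i)) = (of_nat (p ^ Suc m) :: ipoly)"
      using im by (simp flip: of_nat_mult of_nat_power power_add power_Suc add: Suc_diff_le)
    have 2: "(?S i ^ p) ^ (p ^ (m - i)) = ?S i ^ (p ^ (Suc m - i))"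
      using im by (simp flip: power_mult add: Suc_diff_le)
    show "of_nat (p ^ Suc m) dvd of_nat (p ^ i) * ?F (?S i) ^ (p ^ (m - i)) -
        of_nat (p ^ i) * ?S i ^ (p ^ (Suc m - i))"
      using * unfolding 1 2 right_diff_distrib .
  qed
  have "of_nat (p ^ Suc m) dvd ?w (Suc m) - ?R"
    using dvd_add[OF d dvd_triv_left, of "?X (Suc m) + of_int s * ?Y (Suc m)"]
    unfolding w Fw by (simp only: diff_add_eq)
  then obtain U where U: "?w (Suc m) - ?R = of_nat (p ^ Suc m) * U" by blast
  have "?S (Suc m) = ipoly_div (?w (Suc m) - ?R) (p ^ Suc m)"
    using witt_poly_rec[of p "lin_op s" "Suc m"] by (simp only: lin_op_def lessThan_Suc_atMost)
  also have "\<dots> = U"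
    unfolding U by (rule ipoly_div_exact) (use assms prime_gt_0_nat in auto)
  finally have "ghost p ?S (Suc m) = ?R + of_nat (p ^ Suc m) * U"
    by (simp only: ghost_Suc[of p ?S] lessThan_Suc_atMost)
  then show ?case using U by (simp add: algebra_simps)
qed

lemma ghost_wop:
  assumes "prime p"
  shows "ghost p (wop p s x y) m = ghost p x m + of_int s * ghost p y m"
proof -
  let ?a = "\<lambda>v. if even v then x (v div 2) else y (v div 2)"
  note h = rhom_eval_ipoly[of ?a]
  have "ghost p (wop p s x y) m = eval_ipoly ?a (ghost p (witt_poly p (lin_op s)) m)"
    unfolding rhom_ghost[OF h] wop_def ..
  then show ?thesis
    unfolding ghost_witt_poly[OF assms] by (simp add: rhom_simps[OF h] rhom_ghost[OF h] eval_ipoly_ivar)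
qed

lemma rhom_wop: "rhom h \<Longrightarrow> h (wop p s x y m) = wop p s (\<lambda>i. h (x i)) (\<lambda>i. h (y i)) m"
  by (simp add: wop_def rhom_eval_ipoly_commute if_distrib cong: if_cong)

text \<open>Entry \<open>i\<close> occurs in component \<open>i\<close> only as
  \<open>p ^ i * x i\<close>, next to terms in earlier entries. Cancelling \<open>p ^ i\<close> is
  where characteristic zero enters.\<close>

lemma ghost_eq_imp_eq:
  fixes x y :: "nat \<Rightarrow> 'a::{idom,ring_char_0}"
  assumes "p > 0" "\<And>i. i < m \<Longrightarrow> ghost p x i = ghost p y i"
  shows "i < m \<Longrightarrow> x i = y i"
proof (induction i rule: less_induct)
  case (less i)
  have "(\<Sum>j<i. of_nat (p ^ j) * x j ^ (p ^ (i - j))) = (\<Sum>j<i. of_nat (p ^ j) * y j ^ (p ^ (i - j)))"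
    using less by (intro sum.cong) auto
  with assms(2)[OF less.prems] have "of_nat (p ^ i) * x i = of_nat (p ^ i) * y i"
    by (simp only: ghost_Suc) simp
  moreover have "(of_nat (p ^ i) :: 'a) \<noteq> 0" using assms(1) by simp
  ultimately show ?case by (simp only: mult_cancel_left) simp
qed

lemma ghost_inject:
  fixes x y :: "nat \<Rightarrow> 'a::{idom,ring_char_0}"
  assumes "p > 0" "ghost p x = ghost p y"
  shows "x = y"
  using ghost_eq_imp_eq[OF assms(1), of _ x y] assms(2) by (metis ext lessI)

text \<open>Every triple of Witt vectors is the image of a triple over the torsion-free ring of integer
  polynomials, where identities can be checked on ghost components.\<close>

lemma generic_witt_vectors:
  fixes x y z :: "nat \<Rightarrow> 'b::comm_ring_1"
  obtains h :: "ipoly \<Rightarrow> 'b" and X Y Z where "rhom h"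
    "x = (\<lambda>i. h (X i))" "y = (\<lambda>i. h (Y i))" "z = (\<lambda>i. h (Z i))"
proof -
  \<comment> \<open>The residue of a variable index modulo 3 decides which of the three vectors it
    serves.\<close>
  define a where "a v = (if v mod 3 = 0 then x (v div 3) else if v mod 3 = 1 then y (v div 3)
    else z (v div 3))" for v :: nat
  have "a (3 * i) = x i" "a (3 * i + 1) = y i" "a (3 * i + 2) = z i" for i
  proof -
    have "(3 * i + 1) mod 3 = 1" "(3 * i + 2) mod 3 = 2" "(3 * i + 1) div 3 = i" "(3 * i + 2) div 3 = i"
      by presburger+
    then show "a (3 * i) = x i" "a (3 * i + 1) = y i" "a (3 * i + 2) = z i"
      by (simp_all only: a_def) auto
  qed
  then have "x = (\<lambda>i. eval_ipoly a (ivar (3 * i)))" "y = (\<lambda>i. eval_ipoly a (ivar (3 * i + 1)))"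
    "z = (\<lambda>i. eval_ipoly a (ivar (3 * i + 2)))"
    by (simp_all add: eval_ipoly_ivar)
  then show ?thesis by (rule that[OF rhom_eval_ipoly])
qed

section \<open>The group laws for Witt vectors\<close>

lemma wop_assoc:
  assumes "prime p"
  shows "wop p 1 (wop p 1 x y) z = wop p 1 x (wop p 1 y z)"
proof -
  obtain h and X Y Z :: "nat \<Rightarrow> ipoly" where h: "rhom h" "x = (\<lambda>i. h (X i))" "y = (\<lambda>i. h (Y i))" "z = (\<lambda>i. h (Z i))"
    by (rule generic_witt_vectors[of x y z])
  have "wop p 1 (wop p 1 X Y) Z = wop p 1 X (wop p 1 Y Z)"
    using prime_gt_0_nat[OF assms] by (rule ghost_inject) (auto simp: ghost_wop[OF assms])
  then have "h (wop p 1 (wop p 1 X Y) Z i) = h (wop p 1 X (wop p 1 Y Z) i)" for i by simp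
  then show ?thesis
    unfolding h(2-4) by (simp add: fun_eq_iff rhom_wop[OF h(1)])
qed

lemma wop_commute:
  assumes "prime p"
  shows "wop p 1 x y = wop p 1 y x"
proof -
  obtain h and X Y Z :: "nat \<Rightarrow> ipoly" where h: "rhom h" "x = (\<lambda>i. h (X i))" "y = (\<lambda>i. h (Y i))" "x = (\<lambda>i. h (Z i))"
    by (rule generic_witt_vectors[of x y x])
  have "wop p 1 X Y = wop p 1 Y X"
    using prime_gt_0_nat[OF assms] by (rule ghost_inject) (auto simp: ghost_wop[OF assms])
  then show ?thesis
    unfolding h(2,3) by (simp add: fun_eq_iff flip: rhom_wop[OF h(1)])
qed

lemma ghost_zero: "p > 0 \<Longrightarrow> ghost p (\<lambda>_. 0) m = 0"
  by (simp add: ghost_def power_0_left)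

lemma wop_zero_left:
  assumes "prime p"
  shows "wop p 1 (\<lambda>_. 0) x = x"
proof -
  note p0 = prime_gt_0_nat[OF assms]
  obtain h and X Y Z :: "nat \<Rightarrow> ipoly" where h: "rhom h" "x = (\<lambda>i. h (X i))" "x = (\<lambda>i. h (Y i))" "x = (\<lambda>i. h (Z i))"
    by (rule generic_witt_vectors[of x x x])
  have "wop p 1 (\<lambda>_. 0) X = X"
    using p0 by (rule ghost_inject) (auto simp: ghost_wop[OF assms] ghost_zero[OF p0])
  then have "h (wop p 1 (\<lambda>_. 0) X i) = h (X i)" for i by simp
  then show ?thesis
    unfolding h(2) by (simp add: fun_eq_iff rhom_wop[OF h(1)] rhom_zero[OF h(1)])
qed

lemma wop_minus_left:
  assumes "prime p"
  shows "wop p 1 (wop p (- 1) (\<lambda>_. 0) x) x = (\<lambda>_. 0)"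
proof -
  note p0 = prime_gt_0_nat[OF assms]
  obtain h and X Y Z :: "nat \<Rightarrow> ipoly" where h: "rhom h" "x = (\<lambda>i. h (X i))" "x = (\<lambda>i. h (Y i))" "x = (\<lambda>i. h (Z i))"
    by (rule generic_witt_vectors[of x x x])
  have "wop p 1 (wop p (- 1) (\<lambda>_. 0) X) X = (\<lambda>_. 0)"
    using p0 by (rule ghost_inject) (auto simp: ghost_wop[OF assms] ghost_zero[OF p0])
  then have "h (wop p 1 (wop p (- 1) (\<lambda>_. 0) X) X i) = 0" for i by (simp add: rhom_zero[OF h(1)])
  then show ?thesis
    unfolding h(2) by (simp add: fun_eq_iff rhom_wop[OF h(1)] rhom_zero[OF h(1)])
qed

lemma wop_minus_eq:
  assumes "prime p"
  shows "wop p (- 1) x y = wop p 1 x (wop p (- 1) (\<lambda>_. 0) y)"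
proof -
  note p0 = prime_gt_0_nat[OF assms]
  obtain h and X Y Z :: "nat \<Rightarrow> ipoly" where h: "rhom h" "x = (\<lambda>i. h (X i))" "y = (\<lambda>i. h (Y i))" "x = (\<lambda>i. h (Z i))"
    by (rule generic_witt_vectors[of x y x])
  have "wop p (- 1) X Y = wop p 1 X (wop p (- 1) (\<lambda>_. 0) Y)"
    using p0 by (rule ghost_inject) (auto simp: ghost_wop[OF assms] ghost_zero[OF p0])
  then have "h (wop p (- 1) X Y i) = h (wop p 1 X (wop p (- 1) (\<lambda>_. 0) Y) i)" for i by simp
  then show ?thesis
    unfolding h(2,3) by (simp add: fun_eq_iff rhom_wop[OF h(1)] rhom_zero[OF h(1)])
qed

text \<open>Witt vectors are plain functions here, not a type of their own, so the laws are
  delivered as a predicate on the operations. Interpreting it gives access to the cancellation and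
  rearrangement rules of abelian groups.\<close>

lemma witt_ab_group_add:
  assumes "prime p"
  shows "class.ab_group_add (wop p 1) (\<lambda>_. 0) (wop p (- 1)) (wop p (- 1) (\<lambda>_. 0 :: 'b::comm_ring_1))"
  by unfold_locales
    (use assms in \<open>auto simp: wop_assoc wop_zero_left wop_minus_left intro: wop_commute wop_minus_eq\<close>)

text \<open>Cutting both vectors off below \<open>m\<close> keeps the ghost components below
  \<open>m\<close> and removes \<open>p ^ m * x m\<close> and \<open>p ^ m * y m\<close> from
  component \<open>m\<close>. Comparing the two results over integer polynomials and dividing by
  \<open>p ^ m\<close> isolates the linear part.\<close>

lemma wop_top_component:
  assumes "prime p"
  shows "wop p s x y m = x m + of_int s * y m +
    wop p s (\<lambda>i. if i < m then x i else 0) (\<lambda>i. if i < m then y i else 0) m"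
proof -
  note p0 = prime_gt_0_nat[OF assms]
  obtain h and X Y Z :: "nat \<Rightarrow> ipoly" where h: "rhom h" "x = (\<lambda>i. h (X i))" "y = (\<lambda>i. h (Y i))" "x = (\<lambda>i. h (Z i))"
    by (rule generic_witt_vectors[of x y x])
  let ?t = "\<lambda>X::nat \<Rightarrow> ipoly. (\<lambda>i. if i < m then X i else 0)"
  let ?A = "wop p s X Y" and ?B = "wop p s (?t X) (?t Y)"
  have gt: "ghost p (?t V) i = ghost p V i" if "i < m" for V i
    unfolding ghost_def using that by (intro sum.cong) auto
  have gm: "ghost p V m = ghost p (?t V) m + of_nat (p ^ m) * V m" for V :: "nat \<Rightarrow> ipoly"
    unfolding ghost_Suc by (auto intro: sum.cong)
  have eq: "?A i = ?B i" if "i < m" for i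
    using p0 _ that by (rule ghost_eq_imp_eq) (simp add: ghost_wop[OF assms] gt)
  have "of_nat (p ^ m) * (?A m - ?B m) = ghost p ?A m - ghost p ?B m"
    unfolding ghost_Suc using eq by (auto simp: algebra_simps intro!: sum.cong)
  also have "\<dots> = of_nat (p ^ m) * (X m + of_int s * Y m)"
    unfolding ghost_wop[OF assms] gm[of X] gm[of Y] by (simp add: algebra_simps)
  finally have "?A m - ?B m = X m + of_int s * Y m"
    using p0 by simp
  then have "?A m = X m + of_int s * Y m + ?B m" by (simp add: algebra_simps)
  then have "h (?A m) = h (X m) + of_int s * h (Y m) + h (?B m)"
    by (simp add: rhom_simps[OF h(1)])
  then show ?thesis
    unfolding h(2,3) by (simp add: rhom_wop[OF h(1)] rhom_zero[OF h(1)] if_distrib cong: if_cong)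
qed

lemma wop_top_diff:
  assumes "prime p" "\<And>i. i < m \<Longrightarrow> x i = x' i" "\<And>i. i < m \<Longrightarrow> y i = y' i"
  shows "wop p s x y m - wop p s x' y' m = (x m - x' m) + of_int s * (y m - y' m)"
proof -
  have "(\<lambda>i. if i < m then x i else 0) = (\<lambda>i. if i < m then x' i else 0)"
    "(\<lambda>i. if i < m then y i else 0) = (\<lambda>i. if i < m then y' i else 0)"
    using assms by auto
  then show ?thesis
    unfolding wop_top_component[OF assms(1), of s x y m] wop_top_component[OF assms(1), of s x' y' m]
    by (simp add: algebra_simps)
qed

lemma wop_cong_below:
  assumes "prime p" "\<And>i. i < m \<Longrightarrow> x i = x' i" "\<And>i. i < m \<Longrightarrow> y i = y' i" "i < m"
  shows "wop p s x y i = wop p s x' y' i"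
  using wop_top_diff[OF assms(1), of i x x' y y' s] assms by simp

definition subring_set :: "'b::comm_ring_1 set \<Rightarrow> bool" where
  "subring_set A \<longleftrightarrow> 1 \<in> A \<and> (\<forall>x\<in>A. \<forall>y\<in>A. x - y \<in> A \<and> x * y \<in> A)"

lemma subring_setD:
  assumes "subring_set A"
  shows "1 \<in> A" "0 \<in> A" "x \<in> A \<Longrightarrow> y \<in> A \<Longrightarrow> x - y \<in> A" "x \<in> A \<Longrightarrow> y \<in> A \<Longrightarrow> x * y \<in> A"
    "x \<in> A \<Longrightarrow> - x \<in> A" "x \<in> A \<Longrightarrow> y \<in> A \<Longrightarrow> x + y \<in> A"
proof -
  show 1: "1 \<in> A" "\<And>x y. x \<in> A \<Longrightarrow> y \<in> A \<Longrightarrow> x - y \<in> A" "x \<in> A \<Longrightarrow> y \<in> A \<Longrightarrow> x * y \<in> A"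
    using assms by (auto simp: subring_set_def)
  show 0: "0 \<in> A" using 1(2)[OF 1(1) 1(1)] by simp
  show m: "- x \<in> A" if "x \<in> A" for x using 1(2)[OF 0 that] by simp
  show "x + y \<in> A" if "x \<in> A" "y \<in> A" using 1(2)[OF that(1) m[OF that(2)]] by simp
qed

lemma subring_set_power: "subring_set A \<Longrightarrow> x \<in> A \<Longrightarrow> x ^ n \<in> A"
  by (induction n) (auto intro: subring_setD)

lemma subring_set_sum: "subring_set A \<Longrightarrow> (\<And>i. i \<in> S \<Longrightarrow> f i \<in> A) \<Longrightarrow> sum f S \<in> A"
  by (induction S rule: infinite_finite_induct) (auto intro: subring_setD)

lemma subring_set_eval_ipoly:
  assumes "subring_set A" "\<And>v. a v \<in> A"
  shows "eval_ipoly a P \<in> A"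
proof (induction P rule: ipoly_induct)
  case (const c)
  have "(of_nat k :: 'a) \<in> A" for k
    by (induction k) (auto intro: subring_setD[OF assms(1)])
  then have "of_int c \<in> A"
    by (cases c rule: int_cases2) (auto intro: subring_setD[OF assms(1)])
  then show ?case by (simp add: rhom_of_int[OF rhom_eval_ipoly])
qed (auto simp: eval_ipoly_ivar eval_ipoly_add eval_ipoly_mult assms intro: subring_setD[OF assms(1)])

text \<open>Reduces integrality questions to one position: if the lower entries lie in
  \<open>A\<close>, the Witt operation agrees in position \<open>m\<close> with the ordinary one up
  to an element of \<open>A\<close>.\<close>

lemma subring_set_wop_diff:
  assumes "prime p" "subring_set A" "\<And>i. i < m \<Longrightarrow> x i \<in> A" "\<And>i. i < m \<Longrightarrow> y i \<in> A"
  shows "wop p s x y m - (x m + of_int s * y m) \<in> A"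
proof -
  have "wop p s (\<lambda>i. if i < m then x i else 0) (\<lambda>i. if i < m then y i else 0) m \<in> A"
    unfolding wop_def using assms by (intro subring_set_eval_ipoly) (auto intro: subring_setD)
  then show ?thesis
    using wop_top_component[OF assms(1), of s x y m] by simp
qed

lemma subring_set_wop:
  assumes "subring_set A" "\<And>i. x i \<in> A" "\<And>i. y i \<in> A"
  shows "wop p s x y m \<in> A"
  unfolding wop_def using assms by (intro subring_set_eval_ipoly) auto

text \<open>The unit element of the ring of Witt vectors; only its additive multiples are
  used.\<close>

definition wone :: "nat \<Rightarrow> 'b::comm_ring_1" where
  "wone i = (if i = 0 then 1 else 0)"

definition wmult :: "nat \<Rightarrow> nat \<Rightarrow> (nat \<Rightarrow> 'b::comm_ring_1) \<Rightarrow> nat \<Rightarrow> 'b" where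
  "wmult p k x = ((wop p 1 x) ^^ k) (\<lambda>_. 0)"

lemma wmult_0 [simp]: "wmult p 0 x = (\<lambda>_. 0)"
  and wmult_Suc: "wmult p (Suc k) x = wop p 1 x (wmult p k x)"
  by (simp_all add: wmult_def)

lemma wmult_add:
  assumes "prime p"
  shows "wmult p (a + b) x = wop p 1 (wmult p a x) (wmult p b x)"
  by (induction a) (simp_all add: wmult_Suc wop_assoc[OF assms] wop_zero_left[OF assms])

lemma wmult_mult:
  assumes "prime p"
  shows "wmult p (a * b) x = wmult p a (wmult p b x)"
  by (induction a) (simp_all add: wmult_Suc wmult_add[OF assms])

lemma rhom_wmult: "rhom h \<Longrightarrow> h (wmult p k x i) = wmult p k (\<lambda>i. h (x i)) i"
  by (induction k arbitrary: i) (simp_all add: wmult_Suc rhom_wop rhom_zero)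

text \<open>If the entries of \<open>?z\<close> below \<open>j\<close> vanish, then entry
  \<open>j\<close> is additive on multiples of \<open>?z\<close>, so \<open>p\<close> copies kill it
  in characteristic \<open>p\<close>. Each factor \<open>p\<close> thus clears one more
  entry.\<close>

lemma wmult_prime_power_below:
  assumes "prime p" "of_nat p = (0::'b::comm_ring_1)"
  shows "i < j \<Longrightarrow> wmult p (p ^ j) x i = (0::'b)"
proof (induction j arbitrary: i)
  case (Suc j)
  let ?z = "wmult p (p ^ j) x"
  have 1: "wmult p k ?z i' = 0" if "i' < j" for i' k
  proof (induction k)
    case (Suc k)
    have "wop p 1 ?z (wmult p k ?z) i' = wop p 1 (\<lambda>_. 0) (wmult p k ?z) i'"
      using that Suc.IH by (intro wop_cong_below[OF assms(1), of "Suc i'"])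
        (use that \<open>\<And>i. i < j \<Longrightarrow> ?z i = 0\<close> in auto)
    then show ?case using Suc by (simp add: wmult_Suc wop_zero_left[OF assms(1)])
  qed simp
  have 2: "wmult p k ?z j = of_nat k * ?z j" for k
  proof (induction k)
    case (Suc k)
    have "wop p 1 ?z (wmult p k ?z) j - wop p 1 (\<lambda>_. 0) (wmult p k ?z) j = ?z j"
      by (subst wop_top_diff[OF assms(1)]) (use \<open>\<And>i. i < j \<Longrightarrow> ?z i = 0\<close> in auto)
    then show ?case using Suc by (simp add: wmult_Suc wop_zero_left[OF assms(1)] algebra_simps)
  qed simp
  have "wmult p (p ^ Suc j) x i = wmult p p ?z i"
    by (simp add: wmult_mult[OF assms(1)])
  also have "\<dots> = 0"
    using Suc.prems 1[of i p] 2[of p] assms(2) by (cases "i = j") auto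
  finally show ?case .
qed simp

lemma ghost_wmult_wone:
  assumes "prime p"
  shows "ghost p (wmult p k wone) m = of_nat k"
proof (induction k)
  case 0
  then show ?case by (simp add: ghost_zero prime_gt_0_nat[OF assms])
next
  case (Suc k)
  have "ghost p wone m = (\<Sum>i\<le>m. if i = 0 then 1 else (0::'a))"
    unfolding ghost_def using prime_gt_0_nat[OF assms]
    by (intro sum.cong) (auto simp: wone_def power_0_left)
  then show ?case by (simp add: wmult_Suc ghost_wop[OF assms] Suc)
qed

text \<open>Over the integers all ghost components of \<open>p ^ j\<close> times the unit vector equal \<open>p ^ j\<close>;
  the lower entries are divisible by \<open>p\<close>, so modulo \<open>p ^ (j + 1)\<close> only the entry \<open>j\<close> survives.\<close>

lemma wmult_prime_power_wone_top:
  assumes "prime p" "of_nat p = (0::'b::comm_ring_1)"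
  shows "wmult p (p ^ j) wone j = (1::'b)"
proof -
  define a :: "nat \<Rightarrow> int" where "a = wmult p (p ^ j) wone"
  note p0 = prime_gt_0_nat[OF assms(1)]
  have low: "int (p ^ Suc i) dvd int (p ^ l) * a l ^ (p ^ (i - l))"
    if "l < i" "int p dvd a l" for l i
  proof -
    \<comment> \<open>Since \<open>p\<close> divides \<open>a l\<close>, this estimate yields
      \<open>i - l + 1\<close> factors \<open>p\<close> from the power, and the coefficient
      \<open>p ^ l\<close> completes them to \<open>p ^ (i + 1)\<close>.\<close>
    have "i - l < p ^ (i - l)"
      using prime_gt_1_nat[OF assms(1)] by (intro power_gt_expt) simp
    then have "int p ^ (Suc (i - l)) dvd int p ^ (p ^ (i - l))"
      by (intro le_imp_power_dvd) simp
    also have "\<dots> dvd a l ^ (p ^ (i - l))" using that by (intro dvd_power_same)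
    finally have "int (p ^ l) * int p ^ (Suc (i - l)) dvd int (p ^ l) * a l ^ (p ^ (i - l))"
      by (rule mult_dvd_mono[OF dvd_refl])
    moreover have "int (p ^ l) * int p ^ (Suc (i - l)) = int (p ^ Suc i)"
      using that by (simp only: of_nat_power flip: power_add) simp
    ultimately show ?thesis by (simp only:)
  qed
  have key: "int (p ^ Suc i) dvd int (p ^ j) - int (p ^ i) * a i" if "\<And>l. l < i \<Longrightarrow> int p dvd a l" for i
  proof -
    have "int (p ^ Suc i) dvd (\<Sum>l<i. of_nat (p ^ l) * a l ^ (p ^ (i - l)))"
      using low that by (intro dvd_sum) auto
    moreover have "(\<Sum>l<i. of_nat (p ^ l) * a l ^ (p ^ (i - l))) = int (p ^ j) - int (p ^ i) * a i"
      using ghost_wmult_wone[OF assms(1), of "p ^ j" i, where 'a = int] ghost_Suc[of p a i]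
      by (simp add: a_def)
    ultimately show ?thesis by simp
  qed
  have div: "int p dvd a i" if "i < j" for i
    using that
  proof (induction i rule: less_induct)
    case (less i)
    then have "int (p ^ Suc i) dvd int (p ^ j) - int (p ^ i) * a i" by (intro key) auto
    moreover have "int (p ^ Suc i) dvd int (p ^ j)" using less by (intro of_nat_dvd_iff[THEN iffD2] le_imp_power_dvd) auto
    ultimately have "int (p ^ Suc i) dvd int (p ^ i) * a i"
      by (metis dvd_diff_right_iff)
    then have "int (p ^ i) * int p dvd int (p ^ i) * a i" by (simp add: mult.commute)
    then show ?case using p0 by simp
  qed
  have "int (p ^ Suc j) dvd int (p ^ j) - int (p ^ j) * a j" using div by (rule key)
  then have "int (p ^ j) * int p dvd int (p ^ j) * (1 - a j)" by (simp add: algebra_simps)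
  then have "int p dvd 1 - a j" using p0 by simp
  then obtain c where c: "1 - a j = int p * c" by blast
  then have "a j = 1 - int p * c" by simp
  then have "(of_int (a j) :: 'b) = of_int (1 - int p * c)" by simp
  then have 1: "(of_int (a j) :: 'b) = 1" using assms(2) by simp
  have "(of_int (a j) :: 'b) = wmult p (p ^ j) (\<lambda>i. of_int (wone i)) j"
    unfolding a_def by (rule rhom_wmult[OF rhom_of_int_fun])
  also have "(\<lambda>i. of_int (wone i)) = (wone :: nat \<Rightarrow> 'b)" by (auto simp: wone_def)
  finally show ?thesis using 1 by simp
qed

section \<open>Artin--Schreier reduction in the rational function field\<close>

lemma prime_CHAR_finite: "prime CHAR('a::{finite,field})"
  by (intro prime_CHAR_semidom finite_imp_CHAR_pos finite)

lemma of_nat_CHAR_poly: "of_nat CHAR('a) = (0 :: 'a::comm_ring_1 poly)"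
  by (simp add: of_nat_poly)

lemma of_nat_CHAR_poly_fract: "of_nat CHAR('a) = (0 :: 'a::field_gcd poly fract)"
  by (simp add: of_nat_fract of_nat_CHAR_poly Zero_fract_def)

lemma rhom_to_fract: "rhom to_fract"
  by (simp add: rhom_def)

lemma to_fract_power: "to_fract (x ^ n) = to_fract x ^ n"
  by (rule rhom_power[OF rhom_to_fract])

lemma frobenius_surj_finite: "\<exists>d. d ^ CHAR('a) = (c :: 'a::{finite,field})"
proof -
  note F = rhom_frobenius[OF prime_CHAR_finite[where 'a = 'a] of_nat_CHAR]
  have "inj (\<lambda>x::'a. x ^ CHAR('a))"
  proof (rule injI)
    fix x y :: 'a assume "x ^ CHAR('a) = y ^ CHAR('a)"
    then have "(x - y) ^ CHAR('a) = 0" by (simp add: rhom_diff[OF F])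
    then show "x = y" by simp
  qed
  then have "surj (\<lambda>x::'a. x ^ CHAR('a))" by (rule finite_UNIV_inj_surj[OF finite])
  then show ?thesis by (metis surjD)
qed

lemma finite_degree_less: "finite {B :: 'a::{finite,zero} poly. degree B < n}"
proof (rule finite_imageD)
  have "coeffs ` {B :: 'a poly. degree B < n} \<subseteq> {xs. set xs \<subseteq> UNIV \<and> length xs \<le> n}"
    by (auto simp: length_coeffs_degree intro: Suc_leI)
      (metis Suc_leI coeffs_0_eq_Nil length_coeffs_degree list.size(3) zero_le)
  then show "finite (coeffs ` {B :: 'a poly. degree B < n})"
    by (rule finite_subset) (rule finite_lists_length_le[OF finite])
  show "inj_on coeffs {B :: 'a poly. degree B < n}"
    by (simp add: inj_on_def coeffs_eq_iff)
qed

text \<open>Perfectness of the residue field, without constructing that field: on the finite set of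
  remainders modulo \<open>P\<close> the map is injective because \<open>P\<close> is prime, hence
  surjective.\<close>

lemma frobenius_surj_mod_irreducible:
  fixes P A :: "'a::{finite,field_gcd} poly"
  assumes "irreducible P"
  shows "\<exists>B. P dvd B ^ CHAR('a) - A"
proof -
  let ?p = "CHAR('a)" and ?D = "{B :: 'a poly. degree B < degree P}"
  note F = rhom_frobenius[OF prime_CHAR_finite[where 'a = 'a] of_nat_CHAR_poly]
  have P0: "P \<noteq> 0" using assms by auto
  have dP: "degree P > 0"
    using assms P0 by (metis irreducible_not_unit is_unit_iff_degree neq0_conv)
  have mod_in: "A mod P \<in> ?D" for A
    using degree_mod_less[OF P0, of A] dP by auto
  have "inj_on (\<lambda>B. B ^ ?p mod P) ?D"
  proof (rule inj_onI)
    fix x y assume xy: "x \<in> ?D" "y \<in> ?D" "x ^ ?p mod P = y ^ ?p mod P"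
    then have "P dvd x ^ ?p - y ^ ?p" by (simp add: mod_eq_dvd_iff)
    then have "P dvd (x - y) ^ ?p" by (simp add: rhom_diff[OF F])
    then have "P dvd x - y"
      using assms by (metis irreducible_imp_prime_elem_gcd prime_elem_dvd_power)
    moreover have "degree (x - y) < degree P" using xy by (auto intro: degree_diff_less)
    ultimately show "x = y" using dvd_imp_degree_le by (metis not_less right_minus_eq)
  qed
  then have "(\<lambda>B. B ^ ?p mod P) ` ?D = ?D"
    using mod_in by (intro endo_inj_surj[OF finite_degree_less]) auto
  then obtain B where "A mod P = B ^ ?p mod P" using mod_in[of A] by blast
  then show ?thesis by (metis mod_eq_dvd_iff)
qed

text \<open>Forcing \<open>Q = 0\<close> for \<open>e = 0\<close> makes a trivial pole contribute
  nothing, so every polynomial part ends up in the separate polynomial term.\<close>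

definition normal_pole :: "'a::field_gcd poly \<Rightarrow> 'a poly \<Rightarrow> nat \<Rightarrow> bool" where
  "normal_pole P Q e \<longleftrightarrow> (e = 0 \<longrightarrow> Q = 0) \<and>
    (e > 0 \<longrightarrow> \<not> CHAR('a) dvd e \<and> coprime Q P \<and> degree Q < degree (P ^ e))"

text \<open>A pole of order \<open>p * s\<close> is lowered by adding \<open>a ^ p - a\<close> with \<open>a = B / P ^ s\<close>, where
  \<open>B ^ p\<close> cancels the leading coefficient modulo \<open>P\<close>.\<close>

lemma reduce_pole:
  fixes P A :: "'a::{finite,field_gcd} poly"
  assumes "irreducible P"
  shows "\<exists>a Q e g. Fract A (P ^ m) + (a ^ CHAR('a) - a) = Fract Q (P ^ e) + Fract g 1 \<and> normal_pole P Q e"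
proof (induction m arbitrary: A)
  case 0
  have "Fract A (P ^ 0) + (0 ^ CHAR('a) - 0) = Fract 0 (P ^ 0) + Fract A 1"
    using prime_gt_0_nat[OF prime_CHAR_finite[where 'a = 'a]] by (simp add: power_0_left)
  moreover have "normal_pole P 0 0" by (simp add: normal_pole_def)
  ultimately show ?case by blast
next
  case (Suc m)
  let ?p = "CHAR('a)" and ?t = to_fract
  note F = rhom_frobenius[OF prime_CHAR_finite[where 'a = 'a] of_nat_CHAR_poly_fract]
  have P0: "P \<noteq> 0" using assms by auto
  note pg = prime_gt_1_nat[OF prime_CHAR_finite[where 'a = 'a]]
  have lower: ?case if "P dvd A'" "Fract A (P ^ Suc m) + (b ^ ?p - b) = Fract A' (P ^ Suc m)" for A' b
  proof -
    obtain C where C: "A' = P * C" using \<open>P dvd A'\<close> by blast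
    have "Fract A' (P ^ Suc m) = Fract C (P ^ m)"
      using P0 by (simp add: C eq_fract)
    moreover obtain a Q e g where "Fract C (P ^ m) + (a ^ ?p - a) = Fract Q (P ^ e) + Fract g 1"
      "normal_pole P Q e"
      using Suc.IH by blast
    moreover have "(b + a) ^ ?p - (b + a) = (b ^ ?p - b) + (a ^ ?p - a)"
      by (simp add: rhom_add[OF F])
    ultimately show ?case using that(2) by (metis (no_types, lifting) add.assoc)
  qed
  consider "P dvd A" | "\<not> P dvd A" "?p dvd Suc m" | "\<not> P dvd A" "\<not> ?p dvd Suc m" by blast
  then show ?case
  proof cases
    case 1
    show ?thesis
      by (rule lower[OF 1, of 0]) (use pg in \<open>simp add: power_0_left\<close>)
  next
    case 2
    then obtain s where s: "Suc m = ?p * s" by blast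
    then have "s > 0" by (cases s) auto
    then have s0: "s > 0" "s < Suc m" using pg unfolding s by simp_all
    obtain B where "P dvd B ^ ?p - (- A)" using frobenius_surj_mod_irreducible[OF assms] by blast
    then have "P dvd A + B ^ ?p - B * P ^ (Suc m - s)"
      using s0 by (intro dvd_diff dvd_mult) (auto simp: add.commute)
    then show ?thesis
    proof (rule lower)
      have "?t P ^ Suc m = ?t P ^ (Suc m - s) * ?t P ^ s"
        using s0 by (simp only: power_add[symmetric]) simp
      then show "Fract A (P ^ Suc m) + (Fract B (P ^ s) ^ ?p - Fract B (P ^ s)) =
          Fract (A + B ^ ?p - B * P ^ (Suc m - s)) (P ^ Suc m)"
        using P0 by (simp add: Fract_conv_to_fract to_fract_power power_divide power_mult[symmetric]
            mult.commute[of s] s[symmetric] del: power_Suc) (simp add: field_simps del: power_Suc)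
    qed
  next
    case 3
    \<comment> \<open>The order of the pole is already admissible. Division with remainder makes the
      fraction proper, and the quotient joins the polynomial part.\<close>
    let ?Q = "A mod P ^ Suc m" and ?g = "A div P ^ Suc m"
    have "A = ?g * P ^ Suc m + ?Q" by (metis div_mult_mod_eq)
    then have "?t A = ?t ?g * ?t (P ^ Suc m) + ?t ?Q" by (metis to_fract_add to_fract_mult)
    then have "Fract A (P ^ Suc m) = Fract ?Q (P ^ Suc m) + Fract ?g 1"
      using P0 unfolding Fract_conv_to_fract by (simp add: divide_simps del: power_Suc)
    moreover have "\<not> P dvd ?Q" using 3 by (metis dvd_mod_iff dvd_power zero_less_Suc)
    then have "coprime ?Q P"
      using assms by (metis coprime_commute irreducible_imp_prime_elem_gcd prime_elem_imp_coprime)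
    moreover have "degree ?Q < degree (P ^ Suc m)"
      using \<open>\<not> P dvd ?Q\<close> P0 by (intro degree_mod_less') auto
    ultimately have "Fract A (P ^ Suc m) + (0 ^ ?p - 0) = Fract ?Q (P ^ Suc m) + Fract ?g 1"
      "normal_pole P ?Q (Suc m)"
      using 3 pg by (auto simp: normal_pole_def power_0_left)
    then show ?thesis by blast
  qed
qed

text \<open>The analogue at infinity of lowering a pole: in degree \<open>p * s\<close> the monomial
  \<open>d T^s\<close> with \<open>d ^ p = - lead_coeff f\<close> cancels the leading term, and the
  term \<open>- d T^s\<close> has smaller degree.\<close>

lemma reduce_polynomial:
  fixes f :: "'a::{finite,field_gcd} poly"
  shows "\<exists>a. degree (f + (a ^ CHAR('a) - a)) > 0 \<longrightarrow> \<not> CHAR('a) dvd degree (f + (a ^ CHAR('a) - a))"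
proof (induction "degree f" arbitrary: f rule: less_induct)
  case less
  let ?p = "CHAR('a)"
  note F = rhom_frobenius[OF prime_CHAR_finite[where 'a = 'a] of_nat_CHAR_poly]
  note pg = prime_gt_1_nat[OF prime_CHAR_finite[where 'a = 'a]]
  show ?case
  proof (cases "degree f > 0 \<and> ?p dvd degree f")
    case False
    then show ?thesis using pg by (intro exI[of _ 0]) (auto simp: power_0_left)
  next
    case True
    then obtain s where s: "degree f = ?p * s" by blast
    then have "s > 0" using True by (cases s) auto
    then have s0: "s > 0" "s < degree f" using pg unfolding s by simp_all
    obtain d where d: "d ^ ?p = - lead_coeff f" using frobenius_surj_finite by blast
    let ?b = "monom d s"
    have bp: "?b ^ ?p = monom (- lead_coeff f) (degree f)"
      by (simp add: monom_power d s mult.commute)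
    have "degree (f + (?b ^ ?p - ?b)) < degree f"
    proof -
      have "degree ?b \<le> degree f" using s0 degree_monom_le[of d s] by simp
      then have "degree (f + (?b ^ ?p - ?b)) \<le> degree f"
        unfolding bp by (intro degree_add_le degree_diff_le degree_monom_le) auto
      moreover have "coeff (f + (?b ^ ?p - ?b)) (degree f) = 0"
        unfolding bp using s0 by simp
      ultimately show ?thesis
        using True by (metis degree_0 le_neq_implies_less leading_coeff_0_iff)
    qed
    from less[OF this] obtain a where
      ag: "degree (f + (?b ^ ?p - ?b) + (a ^ ?p - a)) > 0 \<longrightarrow>
        \<not> ?p dvd degree (f + (?b ^ ?p - ?b) + (a ^ ?p - a))"
      by (rule exE)
    have "f + ((?b + a) ^ ?p - (?b + a)) = f + (?b ^ ?p - ?b) + (a ^ ?p - a)"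
      by (simp add: rhom_add[OF F] algebra_simps)
    then show ?thesis using ag by (intro exI[of _ "?b + a"]) (simp only:)
  qed
qed

section \<open>Partial fractions and the reduction of a rational function\<close>

lemma partial_fractions_prime_powers:
  fixes m :: "'a::field_gcd poly \<Rightarrow> nat"
  assumes "finite S" "\<And>P. P \<in> S \<Longrightarrow> prime P"
  shows "\<exists>A f. Fract a (\<Prod>P\<in>S. P ^ m P) = (\<Sum>P\<in>S. Fract (A P) (P ^ m P)) + Fract f 1"
  using assms
proof (induction S arbitrary: a rule: finite_induct)
  case empty
  then show ?case by auto
next
  case (insert P S)
  let ?b = "\<Prod>P\<in>S. P ^ m P" and ?t = to_fract
  have pr: "prime P" "\<And>R. R \<in> S \<Longrightarrow> prime R" using insert.prems by auto
  then have "0 \<notin> S" using not_prime_0 by blast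
  then have nz: "P \<noteq> 0" "?b \<noteq> 0" using insert.hyps pr(1) by auto
  have "coprime (P ^ m P) ?b"
    using insert.hyps pr by (intro prod_coprime_right)
      (metis coprime_power_left_iff coprime_power_right_iff primes_coprime)
  then obtain u v where uv: "u * P ^ m P + v * ?b = 1"
    using that[of "fst (bezout_coefficients (P ^ m P) ?b)" "snd (bezout_coefficients (P ^ m P) ?b)"]
    by (simp only: bezout_coefficients_fst_snd coprime_iff_gcd_eq_1)
  have "\<exists>A f. Fract (a * u) ?b = (\<Sum>P\<in>S. Fract (A P) (P ^ m P)) + Fract f 1"
    by (rule insert.IH) (rule pr(2))
  then obtain A f where A: "Fract (a * u) ?b = (\<Sum>P\<in>S. Fract (A P) (P ^ m P)) + Fract f 1"
    by (elim exE)
  have "?t a * (?t u * ?t (P ^ m P) + ?t v * ?t ?b) = ?t a"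
    by (simp only: uv mult_1_right to_fract_1 flip: to_fract_add to_fract_mult)
  then have "Fract a (P ^ m P * ?b) = Fract (a * v) (P ^ m P) + Fract (a * u) ?b"
    using nz unfolding Fract_conv_to_fract
    by (simp add: divide_simps to_fract_power algebra_simps)
  also have "\<dots> = (\<Sum>Q\<in>insert P S. Fract ((A(P := a * v)) Q) (Q ^ m Q)) + Fract f 1"
  proof -
    have "(\<Sum>Q\<in>S. Fract ((A(P := a * v)) Q) (Q ^ m Q)) = (\<Sum>Q\<in>S. Fract (A Q) (Q ^ m Q))"
      using insert.hyps by (intro sum.cong) auto
    then show ?thesis using insert.hyps A by (simp add: add.assoc)
  qed
  finally have "Fract a (\<Prod>P\<in>insert P S. P ^ m P) =
      (\<Sum>Q\<in>insert P S. Fract ((A(P := a * v)) Q) (Q ^ m Q)) + Fract f 1"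
    unfolding prod.insert[OF insert.hyps(1,2)] .
  then show ?case by (intro exI)
qed

text \<open>Bridges two conventions: \<open>prime\<close> includes being normalized, which for
  polynomials over a field means being monic.\<close>

lemma monic_irred_if_prime:
  fixes P :: "'a::field_gcd poly"
  assumes "prime P"
  shows "monic_irred P"
proof -
  have nP: "normalize P = P" "P \<noteq> 0" using assms by auto
  have "lead_coeff P dvd 1" using nP(2) by (intro dvdI[of _ _ "inverse (lead_coeff P)"]) simp
  then have "unit_factor (lead_coeff P) = lead_coeff P" by (rule is_unit_unit_factor)
  then have "lead_coeff P = 1"
    using coeff_normalize[of P "degree P"] nP by simp
  then show ?thesis
    using assms by (simp add: monic_irred_def prime_elem_imp_irreducible)
qed

lemma partial_fractions:
  fixes c :: "'a::field_gcd poly fract"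
  shows "\<exists>S A m f. finite S \<and> (\<forall>P\<in>S. monic_irred P) \<and>
    c = (\<Sum>P\<in>S. Fract (A P) (P ^ m P)) + Fract f 1"
proof (cases c rule: Fract_cases)
  case (Fract a b)
  let ?S = "prime_factors b" and ?m = "\<lambda>P. multiplicity P b" and ?u = "unit_factor b"
  have "is_unit ?u" using Fract by simp
  then obtain u' where u': "1 = ?u * u'" by (rule dvdE)
  have b: "b = ?u * (\<Prod>P\<in>?S. P ^ ?m P)"
    using Fract by (simp add: prod_prime_factors unit_factor_mult_normalize)
  have nz: "(\<Prod>P\<in>?S. P ^ ?m P) \<noteq> 0" using Fract b by auto
  have "b * u' = (?u * u') * (\<Prod>P\<in>?S. P ^ ?m P)" by (subst b) (simp only: mult_ac)
  then have bu: "b * u' = (\<Prod>P\<in>?S. P ^ ?m P)" unfolding u'[symmetric] by simp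
  have "c = Fract (a * u') (\<Prod>P\<in>?S. P ^ ?m P)"
    unfolding Fract(1) using Fract(2) nz by (simp add: eq_fract flip: bu)
  moreover have "\<exists>A f. Fract (a * u') (\<Prod>P\<in>?S. P ^ ?m P) =
      (\<Sum>P\<in>?S. Fract (A P) (P ^ ?m P)) + Fract f 1"
    by (intro partial_fractions_prime_powers) auto
  ultimately have "\<exists>A f. c = (\<Sum>P\<in>?S. Fract (A P) (P ^ ?m P)) + Fract f 1"
    by simp
  then obtain A f where "c = (\<Sum>P\<in>?S. Fract (A P) (P ^ ?m P)) + Fract f 1" by (elim exE)
  moreover have "finite ?S" "\<forall>P\<in>?S. monic_irred P"
    by (auto intro: monic_irred_if_prime)
  ultimately show ?thesis by (intro exI conjI)
qed

lemma artin_schreier_reduction: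
  fixes c :: "'a::{finite,field_gcd} poly fract"
  shows "\<exists>a S Q e f. finite S \<and> (\<forall>P\<in>S. monic_irred P \<and> normal_pole P (Q P) (e P)) \<and>
    c + (a ^ CHAR('a) - a) = (\<Sum>P\<in>S. Fract (Q P) (P ^ e P)) + Fract f 1 \<and>
    (degree f > 0 \<longrightarrow> \<not> CHAR('a) dvd degree f)"
proof -
  let ?p = "CHAR('a)"
  note F = rhom_frobenius[OF prime_CHAR_finite[where 'a = 'a] of_nat_CHAR_poly_fract]
  obtain S A m f where S: "finite S" "\<forall>P\<in>S. monic_irred P"
    and c: "c = (\<Sum>P\<in>S. Fract (A P) (P ^ m P)) + Fract f 1"
    using partial_fractions[of c] by (elim exE conjE)
  have "\<forall>P\<in>S. \<exists>a Q e g. Fract (A P) (P ^ m P) + (a ^ ?p - a) = Fract Q (P ^ e) + Fract g 1 \<and> normal_pole P Q e"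
    using S by (intro ballI reduce_pole) (simp add: monic_irred_def)
  then obtain a Q e g where P: "\<And>P. P \<in> S \<Longrightarrow>
      Fract (A P) (P ^ m P) + (a P ^ ?p - a P) = Fract (Q P) (P ^ e P) + Fract (g P) 1 \<and> normal_pole P (Q P) (e P)"
    by metis
  \<comment> \<open>The polynomial parts \<open>g P\<close> split off at the individual poles can
    have any degree, so they are collected before the polynomial is reduced.\<close>
  obtain b h where b: "f + (\<Sum>P\<in>S. g P) + (b ^ ?p - b) = h" "degree h > 0 \<longrightarrow> \<not> ?p dvd degree h"
    using reduce_polynomial[of "f + (\<Sum>P\<in>S. g P)"] that[OF refl] by (elim exE)
  let ?a = "(\<Sum>P\<in>S. a P) + to_fract b"
  have "?a ^ ?p - ?a = (\<Sum>P\<in>S. a P ^ ?p - a P) + (to_fract b ^ ?p - to_fract b)"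
    by (simp add: rhom_add[OF F] rhom_sum[OF F] sum_subtractf)
  then have "c + (?a ^ ?p - ?a) =
      (\<Sum>P\<in>S. Fract (A P) (P ^ m P) + (a P ^ ?p - a P)) + (to_fract f + (to_fract b ^ ?p - to_fract b))"
    by (simp add: c sum.distrib to_fract_def)
  also have "(\<Sum>P\<in>S. Fract (A P) (P ^ m P) + (a P ^ ?p - a P)) =
      (\<Sum>P\<in>S. Fract (Q P) (P ^ e P) + to_fract (g P))"
    using P by (intro sum.cong) (auto simp: to_fract_def)
  also have "\<dots> + (to_fract f + (to_fract b ^ ?p - to_fract b)) =
      (\<Sum>P\<in>S. Fract (Q P) (P ^ e P)) + to_fract (f + (\<Sum>P\<in>S. g P) + (b ^ ?p - b))"
    by (simp add: sum.distrib to_fract_power)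
  finally have "c + (?a ^ ?p - ?a) = (\<Sum>P\<in>S. Fract (Q P) (P ^ e P)) + Fract h 1"
    unfolding b by (simp add: to_fract_def)
  then show ?thesis
    using S P b(2) by (intro exI[of _ ?a] exI[of _ S] exI[of _ Q] exI[of _ e] exI[of _ h]) auto
qed

section \<open>Extension of discrete valuations\<close>

text \<open>The part of Chevalley's argument that concerns a subring maximal without
  \<open>inverse t\<close>. The principal ideal of \<open>t\<close> takes the place of the maximal
  ideal: all elements \<open>1 - t * b\<close> are units.\<close>

locale local_subring =
  fixes M :: "'k::field set" and t :: 'k
  assumes subring: "subring_set M" and t_in: "t \<in> M" and t_not_unit: "inverse t \<notin> M"
    and one_minus_unit: "\<And>b. b \<in> M \<Longrightarrow> inverse (1 - t * b) \<in> M"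
begin

lemmas M_closed = subring_setD[OF subring] subring_set_power[OF subring] subring_set_sum[OF subring]

lemma t_nonzero: "t \<noteq> 0"
  using t_not_unit M_closed(2) by auto

lemma not_t_inverse: "a \<in> M \<Longrightarrow> t * a \<noteq> 1"
  using t_not_unit inverse_unique by blast

text \<open>States that adjoining \<open>x\<close> to \<open>M\<close> makes \<open>t\<close>
  invertible, with a bound \<open>m\<close> on the degree of the witnessing polynomial.\<close>

definition unit_rep :: "'k \<Rightarrow> nat \<Rightarrow> bool" where
  "unit_rep x m \<longleftrightarrow> (\<exists>a. (\<forall>i. a i \<in> M) \<and> t * (\<Sum>i\<le>m. a i * x ^ i) = 1)"

lemma unit_rep_mono:
  assumes "unit_rep x n" "n \<le> m"
  shows "unit_rep x m"
proof -
  obtain a where a: "\<forall>i. a i \<in> M" "t * (\<Sum>i\<le>n. a i * x ^ i) = 1"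
    using assms(1) by (auto simp: unit_rep_def)
  let ?b = "\<lambda>i. if i \<le> n then a i else 0"
  have "(\<Sum>i\<le>n. a i * x ^ i) = (\<Sum>i\<le>m. ?b i * x ^ i)"
    using assms(2) by (intro sum.mono_neutral_cong_left) auto
  then show ?thesis
    using a M_closed(2) unfolding unit_rep_def by (intro exI[of _ ?b]) auto
qed

text \<open>In the relation for \<open>y\<close> the constant term can be moved to the other side,
  where \<open>1 - t * b 0\<close> is a unit. Multiplying by \<open>x ^ Suc m\<close> expresses this
  power through lower powers of \<open>x\<close>, and substitution lowers the degree of the relation
  for \<open>x\<close>.\<close>

lemma unit_rep_reduce:
  assumes "unit_rep x (Suc m)" "unit_rep y (Suc m)" "x * y = 1"
  shows "unit_rep x m"
proof -
  obtain a where a: "\<forall>i. a i \<in> M" "t * (\<Sum>i\<le>Suc m. a i * x ^ i) = 1"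
    using assms(1) by (auto simp: unit_rep_def)
  obtain b where b: "\<forall>i. b i \<in> M" "t * (\<Sum>i\<le>Suc m. b i * y ^ i) = 1"
    using assms(2) by (auto simp: unit_rep_def)
  define w where "w = inverse (1 - t * b 0)"
  have wM: "w \<in> M" using one_minus_unit b by (simp add: w_def)
  have w1: "w * (1 - t * b 0) = 1"
    using not_t_inverse[of "b 0"] b by (simp add: w_def)
  have b0: "1 - t * b 0 = t * (\<Sum>j<Suc m. b (Suc j) * y ^ Suc j)"
    using b(2) by (simp only: sum.atMost_Suc_shift lessThan_Suc_atMost) (simp add: algebra_simps)
  have xy: "x ^ Suc m * y ^ Suc j = x ^ (Suc m - Suc j)" if "j < Suc m" for j
  proof -
    have "x ^ Suc m = x ^ (Suc m - Suc j) * x ^ Suc j"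
      using that by (simp only: power_add[symmetric]) simp
    then have "x ^ Suc m * y ^ Suc j = x ^ (Suc m - Suc j) * (x * y) ^ Suc j"
      by (simp only: power_mult_distrib mult.assoc)
    then show ?thesis using assms(3) by simp
  qed
  have "x ^ Suc m = x ^ Suc m * (w * (1 - t * b 0))" using w1 by simp
  also have "\<dots> = t * w * (\<Sum>j<Suc m. b (Suc j) * (x ^ Suc m * y ^ Suc j))"
    unfolding b0 sum_distrib_left by (intro sum.cong) (simp_all only: mult_ac)
  also have "(\<Sum>j<Suc m. b (Suc j) * (x ^ Suc m * y ^ Suc j)) =
      (\<Sum>j<Suc m. b (Suc m - (Suc m - Suc j)) * x ^ (Suc m - Suc j))"
  proof (rule sum.cong[OF refl])
    fix j assume "j \<in> {..<Suc m}"
    then have j: "j < Suc m" by simp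
    then have "Suc m - (Suc m - Suc j) = Suc j" by simp
    then show "b (Suc j) * (x ^ Suc m * y ^ Suc j) = b (Suc m - (Suc m - Suc j)) * x ^ (Suc m - Suc j)"
      using xy[OF j] by (simp only:)
  qed
  also have "\<dots> = (\<Sum>i<Suc m. b (Suc m - i) * x ^ i)"
    by (rule sum.nat_diff_reindex)
  finally have xm: "x ^ Suc m = t * w * (\<Sum>i\<le>m. b (Suc m - i) * x ^ i)"
    by (simp only: lessThan_Suc_atMost)
  let ?c = "\<lambda>i. a i + a (Suc m) * (t * w * b (Suc m - i))"
  have "(\<Sum>i\<le>Suc m. a i * x ^ i) = (\<Sum>i\<le>m. ?c i * x ^ i)"
    by (simp only: sum.atMost_Suc xm) (simp add: sum_distrib_left sum.distrib algebra_simps)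
  then have "t * (\<Sum>i\<le>m. ?c i * x ^ i) = 1" using a(2) by simp
  moreover have "\<forall>i. ?c i \<in> M"
    using a(1) b(1) wM t_in by (auto intro!: M_closed)
  ultimately show ?thesis unfolding unit_rep_def by (intro exI[of _ ?c]) auto
qed

text \<open>Infinite descent on the two degrees: the relation of smaller degree is padded with
  zeros, then the larger degree drops by one. In degree 0 the ring \<open>M\<close> itself would
  contain \<open>inverse t\<close>.\<close>

lemma not_both_unit_rep: "unit_rep x m \<Longrightarrow> unit_rep y n \<Longrightarrow> x * y = 1 \<Longrightarrow> False"
proof (induction "m + n" arbitrary: m n x y rule: less_induct)
  case less
  have wlog: False if "unit_rep x m" "unit_rep y n" "x * y = 1" "n \<le> m"
    "\<And>m'. m' < m \<Longrightarrow> unit_rep x m' \<Longrightarrow> False" for x y m n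
  proof (cases m)
    case 0
    then obtain a where "\<forall>i. a i \<in> M" "t * a (0::nat) = 1"
      using \<open>unit_rep x m\<close> by (auto simp: unit_rep_def)
    then show False using not_t_inverse by blast
  next
    case (Suc m')
    then have "unit_rep x m'"
      using that(1,3) unit_rep_mono[OF that(2,4)] by (intro unit_rep_reduce[of x m' y]) simp_all
    then show False using that(5) Suc by blast
  qed
  show False
  proof (cases "n \<le> m")
    case True
    show False
    proof (rule wlog[OF less.prems True])
      fix m' assume "m' < m" "unit_rep x m'"
      then show False using less.hyps[of m' n x y] less.prems by simp
    qed
  next
    case False
    show False
    proof (rule wlog[OF less.prems(2,1)])
      show "y * x = 1" using less.prems(3) by (simp add: mult.commute)
      show "m \<le> n" using False by simp
      fix n' assume "n' < n" "unit_rep y n'"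
      then show False using less.hyps[of m n' x y] less.prems by simp
    qed
  qed
qed

end

lemma subring_set_adjoin:
  assumes "subring_set A"
  shows "subring_set {poly f x | f. \<forall>i. coeff f i \<in> A}"
proof -
  note C = subring_setD[OF assms] subring_set_sum[OF assms]
  have "1 = poly 1 x" "\<forall>i. coeff (1 :: 'a poly) i \<in> A"
    using C(1,2) by (auto simp: coeff_1)
  moreover have "poly f x - poly g x = poly (f - g) x" "poly f x * poly g x = poly (f * g) x" for f g
    by simp_all
  moreover have "\<forall>i. coeff (f - g) i \<in> A" "\<forall>i. coeff (f * g) i \<in> A"
    if "\<forall>i. coeff f i \<in> A" "\<forall>i. coeff g i \<in> A" for f g
    using that by (auto simp: coeff_mult intro!: C)
  ultimately show ?thesis
    unfolding subring_set_def by safe blast+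
qed

lemma exists_valuation_ring:
  fixes A0 :: "'k::field set"
  assumes A0: "subring_set A0" and t: "t \<in> A0" "inverse t \<notin> A0"
  obtains A where "subring_set A" "A0 \<subseteq> A" "inverse t \<notin> A" "\<forall>x. x \<in> A \<or> inverse x \<in> A"
proof -
  define \<A> where "\<A> = {A. subring_set A \<and> A0 \<subseteq> A \<and> inverse t \<notin> A}"
  have "A0 \<in> \<A>" using assms by (auto simp: \<A>_def)
  then have "\<A> \<noteq> {}" by auto
  moreover have "\<Union>C \<in> \<A>" if C: "C \<noteq> {}" "subset.chain \<A> C" for C
  proof -
    have sub: "\<And>B. B \<in> C \<Longrightarrow> subring_set B \<and> A0 \<subseteq> B \<and> inverse t \<notin> B"
      using C(2) by (auto simp: subset.chain_def \<A>_def)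
    have "x - y \<in> \<Union>C \<and> x * y \<in> \<Union>C" if xy: "x \<in> \<Union>C" "y \<in> \<Union>C" for x y
    proof -
      obtain B1 B2 where B: "B1 \<in> C" "x \<in> B1" "B2 \<in> C" "y \<in> B2" using xy by blast
      then have "B1 \<subseteq> B2 \<or> B2 \<subseteq> B1" using C(2) by (auto simp: subset.chain_def)
      then obtain B where "B \<in> C" "x \<in> B" "y \<in> B" using B by blast
      then show ?thesis using sub subring_setD(3,4) by blast
    qed
    moreover have "1 \<in> \<Union>C" "A0 \<subseteq> \<Union>C" using C(1) sub subring_setD(1) by blast+
    moreover have "inverse t \<notin> \<Union>C" using sub by blast
    ultimately show ?thesis unfolding \<A>_def subring_set_def by blast
  qed
  ultimately obtain M where M: "M \<in> \<A>" and max: "\<And>X. X \<in> \<A> \<Longrightarrow> M \<subseteq> X \<Longrightarrow> X = M"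
    using subset_Zorn_nonempty[of \<A>] by blast
  then have sM: "subring_set M" "A0 \<subseteq> M" "inverse t \<notin> M" by (auto simp: \<A>_def)
  note C = subring_setD[OF sM(1)] subring_set_power[OF sM(1)] subring_set_sum[OF sM(1)]
  have tM: "t \<in> M" "t \<noteq> 0" using t sM C(2) by auto
  have adjoin: "\<exists>a m. (\<forall>i. a i \<in> M) \<and> t * (\<Sum>i\<le>m. a i * x ^ i) = 1" if "x \<notin> M" for x
  proof -
    let ?X = "{poly f x | f. \<forall>i. coeff f i \<in> M}"
    have "M \<subseteq> ?X"
    proof
      fix c assume "c \<in> M"
      then have "c = poly [:c:] x" "\<forall>i. coeff [:c:] i \<in> M"
        using C(2) by (auto simp: coeff_pCons split: nat.split)
      then show "c \<in> ?X" by blast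
    qed
    moreover have "x = poly [:0, 1:] x" "\<forall>i. coeff [:0, 1:] i \<in> M"
      using C(1,2) by (auto simp: coeff_pCons split: nat.split)
    then have "x \<in> ?X" by blast
    ultimately have "?X \<notin> \<A>" using max[of ?X] that by blast
    then have "inverse t \<in> ?X"
      using subring_set_adjoin[OF sM(1), of x] sM \<open>M \<subseteq> ?X\<close> by (auto simp: \<A>_def)
    then obtain f where f: "inverse t = poly f x" "\<forall>i. coeff f i \<in> M" by blast
    then have "t * (\<Sum>i\<le>degree f. coeff f i * x ^ i) = 1"
      using tM by (simp add: poly_altdef[symmetric] f(1)[symmetric])
    then show ?thesis using f(2) by blast
  qed
  \<comment> \<open>If \<open>?u\<close> had no inverse in \<open>M\<close>, adjoining it would make
    \<open>t\<close> invertible. Clearing denominators puts \<open>?u ^ m\<close> into the ideal of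
    \<open>t\<close>, but it is also congruent to 1 modulo this ideal, so \<open>t\<close> would be
    a unit of \<open>M\<close>.\<close>
  have unit: "inverse (1 - t * b) \<in> M" if "b \<in> M" for b
  proof (rule ccontr)
    let ?u = "1 - t * b"
    assume "inverse ?u \<notin> M"
    then obtain a m where a: "\<forall>i. a i \<in> M" "t * (\<Sum>i\<le>m. a i * inverse ?u ^ i) = 1"
      using adjoin by blast
    have u0: "?u \<noteq> 0" using sM(3) that inverse_unique[of t b] by auto
    have pw: "\<exists>c\<in>M. ?u ^ m = 1 - t * c" for m
    proof (induction m)
      case 0
      then show ?case using C(2) by (intro bexI[of _ 0]) auto
    next
      case (Suc m)
      then obtain c where c: "c \<in> M" "?u ^ m = 1 - t * c" by blast
      have "?u ^ Suc m = ?u * (1 - t * c)" using c(2) by simp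
      then have "?u ^ Suc m = 1 - t * (b + c - t * b * c)" by (simp only:) (simp add: algebra_simps)
      moreover have "b + c - t * b * c \<in> M" using c that tM by (intro C) auto
      ultimately show ?case by blast
    qed
    obtain c where c: "c \<in> M" "?u ^ m = 1 - t * c" using pw by blast
    let ?s = "\<Sum>i\<le>m. a i * ?u ^ (m - i)"
    have "?u ^ m = ?u ^ m * (t * (\<Sum>i\<le>m. a i * inverse ?u ^ i))" using a(2) by simp
    also have "\<dots> = t * (\<Sum>i\<le>m. a i * (?u ^ m * inverse ?u ^ i))"
      unfolding sum_distrib_left by (intro sum.cong) (simp_all only: mult_ac)
    also have "(\<Sum>i\<le>m. a i * (?u ^ m * inverse ?u ^ i)) = ?s"
    proof (rule sum.cong[OF refl])
      fix i assume "i \<in> {..m}"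
      then have "?u ^ m * inverse ?u ^ i = ?u ^ (m - i)"
        using u0 by (subst power_diff) (auto simp: divide_inverse power_inverse)
      then show "a i * (?u ^ m * inverse ?u ^ i) = a i * ?u ^ (m - i)" by (simp only:)
    qed
    finally have "t * (?s + c) = 1" using c(2) by (simp add: algebra_simps)
    moreover have "?s + c \<in> M" using a c that tM by (auto intro!: C)
    ultimately show False using sM(3) inverse_unique by metis
  qed
  interpret local_subring M t
    by unfold_locales (use sM tM unit in auto)
  have "x \<in> M \<or> inverse x \<in> M" for x
  proof (rule ccontr)
    assume "\<not> (x \<in> M \<or> inverse x \<in> M)"
    then obtain m n where "unit_rep x m" "unit_rep (inverse x) n"
      using adjoin[of x] adjoin[of "inverse x"] by (auto simp: unit_rep_def)
    moreover have "x * inverse x = 1"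
      using \<open>\<not> (x \<in> M \<or> inverse x \<in> M)\<close> C(2) by (cases "x = 0") auto
    ultimately show False by (rule not_both_unit_rep)
  qed
  then show ?thesis using sM by (intro that[of M]) auto
qed

locale valuation_ring =
  fixes A :: "'k::field set" and t :: 'k
  assumes subring: "subring_set A" and total: "x \<in> A \<or> inverse x \<in> A"
    and t_in: "t \<in> A" and t_not_unit: "inverse t \<notin> A"
begin

lemmas A_closed = subring_setD[OF subring] subring_set_power[OF subring] subring_set_sum[OF subring]

lemma t_nonzero: "t \<noteq> 0"
  using t_not_unit A_closed(2) by auto

definition vunit :: "'k \<Rightarrow> bool" where
  "vunit u \<longleftrightarrow> u \<noteq> 0 \<and> u \<in> A \<and> inverse u \<in> A"

lemma vunit_1: "vunit 1"
  using A_closed by (simp add: vunit_def)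

lemma vunit_mult: "vunit u \<Longrightarrow> vunit v \<Longrightarrow> vunit (u * v)"
  using A_closed by (simp add: vunit_def inverse_mult_distrib)

lemma vunit_inverse: "vunit u \<Longrightarrow> vunit (inverse u)"
  by (simp add: vunit_def)

lemma vunit_power: "vunit u \<Longrightarrow> vunit (u ^ n)"
  by (induction n) (simp_all add: vunit_1 vunit_mult)

lemma t_power_in: "l \<ge> 0 \<Longrightarrow> t powi l \<in> A"
  using A_closed(7)[OF t_in] by (simp add: power_int_def)

lemma t_powi_in_iff: "t powi l \<in> A \<longleftrightarrow> l \<ge> 0"
proof (rule iffI, rule ccontr)
  assume l: "t powi l \<in> A" "\<not> l \<ge> 0"
  then have "t powi (- l - 1) * t powi l \<in> A" by (intro A_closed(4)[OF t_power_in]) auto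
  moreover have "t powi (- l - 1) * t powi l = inverse t"
    using t_nonzero by (simp add: power_int_add[symmetric] power_int_minus)
  ultimately show False using t_not_unit by simp
qed (rule t_power_in)

lemma vunit_t_powi_iff: "vunit (t powi l) \<longleftrightarrow> l = 0"
proof
  assume "vunit (t powi l)"
  then have "t powi l \<in> A" "t powi (- l) \<in> A" by (auto simp: vunit_def power_int_minus)
  then show "l = 0" unfolding t_powi_in_iff by simp
qed (simp add: vunit_1)

lemma exists_minimal_term:
  assumes "finite I" "I \<noteq> {}" "\<And>i. i \<in> I \<Longrightarrow> T i \<noteq> 0"
  shows "\<exists>j\<in>I. \<forall>i\<in>I. T i / T j \<in> A"
  using assms
proof (induction I rule: finite_ne_induct)
  case (singleton i)
  then show ?case using A_closed(1) by simp
next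
  case (insert k I)
  then obtain j where j: "j \<in> I" "\<forall>i\<in>I. T i / T j \<in> A" by blast
  have nz: "T k \<noteq> 0" "T j \<noteq> 0" using insert j by auto
  show ?case
  proof (cases "T k / T j \<in> A")
    case True
    then show ?thesis using j by blast
  next
    case False
    then have kj: "T j / T k \<in> A" using total[of "T k / T j"] by simp
    have "T i / T k \<in> A" if "i \<in> I" for i
    proof -
      have "T i / T k = (T i / T j) * (T j / T k)" using nz by simp
      also have "\<dots> \<in> A" using kj j that by (intro A_closed(4)) auto
      finally show ?thesis .
    qed
    then show ?thesis using A_closed(1) nz by auto
  qed
qed

definition max_ideal :: "'k set" where
  "max_ideal = {r \<in> A. r = 0 \<or> inverse r \<notin> A}"

lemma max_ideal_add:
  assumes "r \<in> max_ideal" "s \<in> max_ideal"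
  shows "r + s \<in> max_ideal"
proof -
  have *: "r + s \<in> max_ideal" if "r \<in> max_ideal" "s \<in> max_ideal" "r / s \<in> A" "s \<noteq> 0" for r s
  proof -
    have "inverse s \<in> A" if "inverse (r + s) \<in> A" "r + s \<noteq> 0"
    proof -
      have "1 + r / s = (r + s) / s" using \<open>s \<noteq> 0\<close> by (simp add: field_simps)
      then have "inverse s = (1 + r / s) * inverse (r + s)"
        using that(2) \<open>s \<noteq> 0\<close> by (simp add: divide_inverse mult_ac)
      moreover have "(1 + r / s) * inverse (r + s) \<in> A"
        using that \<open>r / s \<in> A\<close> by (intro A_closed) auto
      ultimately show ?thesis by simp
    qed
    then show ?thesis using that A_closed(6) by (auto simp: max_ideal_def)
  qed
  show ?thesis
  proof (cases "r = 0 \<or> s = 0")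
    case True
    then show ?thesis using assms by auto
  next
    case False
    then show ?thesis
      using *[of r s] *[of s r] assms total[of "r / s"] by (auto simp: add.commute)
  qed
qed

lemma max_ideal_sum:
  assumes "finite I" "\<And>i. i \<in> I \<Longrightarrow> f i \<in> max_ideal"
  shows "sum f I \<in> max_ideal"
  using assms
proof (induction I rule: finite_induct)
  case empty
  then show ?case using A_closed(2) by (simp add: max_ideal_def)
next
  case (insert i I)
  then show ?case by (simp add: max_ideal_add)
qed

text \<open>In a vanishing sum the least value must occur twice: otherwise division by the unique
  least term writes \<open>- 1\<close> as a sum of non-units.\<close>

lemma zero_sum_unit_quotient:
  assumes I: "finite I" "I \<noteq> {}" "\<And>i. i \<in> I \<Longrightarrow> T i \<noteq> 0" and s: "(\<Sum>i\<in>I. T i) = 0"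
  shows "\<exists>i\<in>I. \<exists>j\<in>I. i \<noteq> j \<and> vunit (T i / T j)"
proof (rule ccontr)
  assume no: "\<not> ?thesis"
  have "\<exists>j\<in>I. \<forall>i\<in>I. T i / T j \<in> A" using I by (intro exists_minimal_term) auto
  then obtain j where j: "j \<in> I" "\<forall>i\<in>I. T i / T j \<in> A" by blast
  have "T i / T j \<in> max_ideal" if "i \<in> I - {j}" for i
  proof -
    have "\<not> vunit (T i / T j)" "T i / T j \<in> A" using no j that by auto
    then show ?thesis by (auto simp: max_ideal_def vunit_def)
  qed
  then have "(\<Sum>i\<in>I - {j}. T i / T j) \<in> max_ideal" using I by (intro max_ideal_sum) auto
  moreover have "(\<Sum>i\<in>I. T i / T j) = 0" using s by (simp flip: sum_divide_distrib)
  then have "(\<Sum>i\<in>I - {j}. T i / T j) = - 1"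
    using I j by (simp add: sum.remove[of I j] eq_neg_iff_add_eq_0 add.commute)
  ultimately show False using A_closed by (auto simp: max_ideal_def)
qed

end

text \<open>With one exponent \<open>d\<close> for all \<open>x\<close>, and the value of
  \<open>t\<close> taken as 1, every value lies in \<open>(1/d)\<close> times the integers. The
  function \<open>w\<close> below is \<open>d\<close> times this value.\<close>

locale valuation_ring_torsion = valuation_ring A t for A :: "'k::field set" and t +
  fixes d :: nat
  assumes d_pos: "d > 0" and torsion: "x \<noteq> 0 \<Longrightarrow> \<exists>l. vunit (x ^ d * t powi (- l))"
begin

definition w :: "'k \<Rightarrow> int" where
  "w x = (THE l. vunit (x ^ d * t powi (- l)))"

lemma w_eqI:
  assumes "vunit (x ^ d * t powi (- l))"
  shows "w x = l"
  unfolding w_def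
proof (rule the_equality)
  fix l' assume "vunit (x ^ d * t powi (- l'))"
  then have "vunit (x ^ d * t powi (- l) * inverse (x ^ d * t powi (- l')))"
    by (intro vunit_mult[OF assms vunit_inverse])
  moreover have "x ^ d \<noteq> 0" using assms by (auto simp: vunit_def)
  then have "x ^ d * t powi (- l) * inverse (x ^ d * t powi (- l')) = t powi (l' - l)"
    using t_nonzero by (simp add: power_int_minus power_int_diff divide_simps)
  ultimately show "l' = l" by (simp add: vunit_t_powi_iff)
qed fact

lemma w_unit: "x \<noteq> 0 \<Longrightarrow> vunit (x ^ d * t powi (- w x))"
  using torsion w_eqI by blast

lemma w_mult:
  assumes "x \<noteq> 0" "y \<noteq> 0"
  shows "w (x * y) = w x + w y"
proof (rule w_eqI)
  have "vunit (x ^ d * t powi (- w x) * (y ^ d * t powi (- w y)))"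
    using assms by (intro vunit_mult[OF w_unit w_unit])
  moreover have "t powi (- (w x + w y)) = t powi (- w x) * t powi (- w y)"
    using t_nonzero power_int_add[of t "- w x" "- w y"] by simp
  then have "(x * y) ^ d * t powi (- (w x + w y)) = x ^ d * t powi (- w x) * (y ^ d * t powi (- w y))"
    by (simp only: power_mult_distrib mult_ac)
  ultimately show "vunit ((x * y) ^ d * t powi (- (w x + w y)))" by (simp only:)
qed

lemma w_nonneg:
  assumes "x \<noteq> 0" "x \<in> A"
  shows "w x \<ge> 0"
proof -
  have "x ^ d * inverse (x ^ d * t powi (- w x)) \<in> A"
    using w_unit[OF assms(1)] A_closed(7)[OF assms(2), of d] by (intro A_closed(4)) (auto simp: vunit_def)
  moreover have "x ^ d * inverse (x ^ d * t powi (- w x)) = t powi (w x)"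
    using assms by (simp add: power_int_minus)
  ultimately show ?thesis by (simp add: t_powi_in_iff)
qed

lemma w_add:
  assumes "x \<noteq> 0" "y \<noteq> 0" "x + y \<noteq> 0"
  shows "w (x + y) \<ge> min (w x) (w y)"
proof -
  have *: "w (x + y) \<ge> w y" if "x / y \<in> A" "y \<noteq> 0" "x + y \<noteq> 0" for x y
  proof -
    have eq: "x + y = y * (1 + x / y)" using that by (simp add: field_simps)
    then have nz: "1 + x / y \<noteq> 0" using that by auto
    then have "w (x + y) = w y + w (1 + x / y)" unfolding eq using that by (intro w_mult)
    moreover have "w (1 + x / y) \<ge> 0" using nz that A_closed(1,6) by (intro w_nonneg) auto
    ultimately show ?thesis by simp
  qed
  show ?thesis
    using *[of x y] *[of y x] assms total[of "x / y"] by (auto simp: add.commute)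
qed

lemma w_one: "w 1 = 0"
  using w_mult[of 1 1] by simp

lemma w_inverse: "x \<noteq> 0 \<Longrightarrow> w (inverse x) = - w x"
  using w_mult[of x "inverse x"] w_one by simp

lemma w_power: "x \<noteq> 0 \<Longrightarrow> w (x ^ n) = int n * w x"
  by (induction n) (simp_all add: w_one w_mult algebra_simps)

lemma w_t: "w t = int d"
  by (rule w_eqI) (use t_nonzero in \<open>simp add: vunit_1 power_int_minus\<close>)

text \<open>The value group of \<open>w\<close> is a nonzero subgroup of the integers; dividing by its positive
  generator yields a normalized valuation.\<close>

lemma exists_discrete_valuation:
  "\<exists>v e. discrete_valuation v \<and> e \<ge> 1 \<and> (\<forall>u l. vunit u \<longrightarrow> v (u * t powi l) = int e * l)"
proof -
  let ?V = "\<lambda>n. n > 0 \<and> (\<exists>x. x \<noteq> 0 \<and> w x = int n)"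
  have "?V d" using d_pos t_nonzero w_t by blast
  define g where "g = (LEAST n. ?V n)"
  have g: "?V g" unfolding g_def using \<open>?V d\<close> by (rule LeastI)
  then obtain x0 where x0: "g > 0" "x0 \<noteq> 0" "w x0 = int g" by blast
  have dvd: "int g dvd w x" if "x \<noteq> 0" for x
  proof (rule ccontr)
    assume nd: "\<not> int g dvd w x"
    define q where "q = w x div int g"
    have m: "w x = q * int g + w x mod int g" by (simp add: q_def)
    have "\<exists>y. y \<noteq> 0 \<and> w y = q * int g"
    proof (cases "q \<ge> 0")
      case True
      then show ?thesis using x0 by (intro exI[of _ "x0 ^ nat q"]) (simp add: w_power)
    next
      case False
      then show ?thesis using x0
        by (intro exI[of _ "inverse (x0 ^ nat (- q))"]) (simp add: w_power w_inverse)
    qed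
    then obtain y where y: "y \<noteq> 0" "w y = q * int g" by blast
    let ?z = "x * inverse y"
    have wz: "w ?z = w x mod int g" using y that m by (simp add: w_mult w_inverse)
    moreover have "w x mod int g \<noteq> 0" using nd by (simp add: dvd_eq_mod_eq_0)
    moreover have "w x mod int g \<ge> 0" "w x mod int g < int g" using x0 by simp_all
    ultimately have "?V (nat (w x mod int g))" "nat (w x mod int g) < g"
      using y that by (auto intro!: exI[of _ ?z])
    then show False unfolding g_def using not_less_Least by blast
  qed
  define v where "v x = w x div int g" for x
  have vw: "w x = int g * v x" if "x \<noteq> 0" for x using dvd[OF that] by (simp add: v_def)
  have "discrete_valuation v"
    unfolding discrete_valuation_def
  proof (intro conjI allI impI)
    fix x y :: 'k assume xy: "x \<noteq> 0" "y \<noteq> 0"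
    have "int g * v (x * y) = int g * (v x + v y)"
      using xy by (simp add: vw[symmetric] w_mult distrib_left)
    then show "v (x * y) = v x + v y" using x0(1) by simp
    assume s: "x + y \<noteq> 0"
    have "min (int g * v x) (int g * v y) \<le> int g * v (x + y)"
      using w_add[OF xy s] xy s by (simp add: vw)
    then show "v (x + y) \<ge> min (v x) (v y)"
      using x0(1) by (auto simp: min_def split: if_splits)
  next
    show "\<exists>x. x \<noteq> 0 \<and> v x = 1" using x0 by (intro exI[of _ x0]) (simp add: v_def)
  qed
  moreover have "v t > 0" using vw[OF t_nonzero] w_t d_pos x0(1)
    by (metis of_nat_0_less_iff zero_less_mult_pos)
  moreover have "v (u * t powi l) = v t * l" if "vunit u" for u l
  proof -
    have nz: "u \<noteq> 0" "u * t powi l \<noteq> 0" using that t_nonzero by (auto simp: vunit_def)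
    have "w (u * t powi l) = int d * l"
    proof (rule w_eqI)
      have "(u * t powi l) ^ d * t powi (- (int d * l)) = u ^ d"
        using t_nonzero
        by (simp add: power_mult_distrib power_int_minus mult.assoc power_int_power' mult.commute[of _ l]
            flip: power_int_mult)
      then show "vunit ((u * t powi l) ^ d * t powi (- (int d * l)))"
        using that vunit_power by simp
    qed
    then have "int g * v (u * t powi l) = int g * (v t * l)"
      using vw[OF nz(2)] vw[OF t_nonzero] w_t by simp
    then show ?thesis using x0(1) by simp
  qed
  ultimately show ?thesis
    by (intro exI[of _ v] exI[of _ "nat (v t)"]) auto
qed

end

section \<open>Localizations of the polynomial ring and valuations above them\<close>

lemma rhom_field_nonzero:
  fixes h :: "'a::field \<Rightarrow> 'b::field"
  assumes "rhom h" "x \<noteq> 0"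
  shows "h x \<noteq> 0"
  using rhom_mult[OF assms(1), of x "inverse x"] assms by (auto simp: rhom_one)

lemma rhom_field_inj:
  fixes h :: "'a::field \<Rightarrow> 'b::field"
  assumes "rhom h"
  shows "h x = h y \<longleftrightarrow> x = y"
  using rhom_field_nonzero[OF assms, of "x - y"] by (auto simp: rhom_diff[OF assms])

lemma rhom_inverse:
  fixes h :: "'a::field \<Rightarrow> 'b::field"
  assumes "rhom h"
  shows "h (inverse x) = inverse (h x)"
proof (cases "x = 0")
  case False
  then have "h x * h (inverse x) = 1" by (simp add: rhom_one[OF assms] flip: rhom_mult[OF assms])
  then show ?thesis by (metis inverse_unique)
qed (simp add: rhom_zero[OF assms])

lemma rhom_powi:
  fixes h :: "'a::field \<Rightarrow> 'b::field"
  assumes "rhom h"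
  shows "h (x powi l) = h x powi l"
  by (simp add: power_int_def rhom_power[OF assms] rhom_inverse[OF assms])

definition local_ring_at :: "'a::field_gcd poly \<Rightarrow> 'a poly fract set" where
  "local_ring_at P = {Fract a b | a b. \<not> P dvd b}"

lemma subring_set_local_ring_at:
  assumes "irreducible P"
  shows "subring_set (local_ring_at P)"
  unfolding subring_set_def
proof (intro conjI ballI)
  have pe: "prime_elem P" using assms by (rule irreducible_imp_prime_elem_gcd)
  then have "\<not> P dvd 1" using prime_elem_not_unit by blast
  then show "1 \<in> local_ring_at P"
    unfolding local_ring_at_def One_fract_def by blast
  fix x y assume "x \<in> local_ring_at P" "y \<in> local_ring_at P"
  then obtain a b c d where *: "x = Fract a b" "\<not> P dvd b" "y = Fract c d" "\<not> P dvd d"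
    unfolding local_ring_at_def by blast
  then have "b \<noteq> 0" "d \<noteq> 0" by auto
  then have "x - y = Fract (a * d - c * b) (b * d)" "x * y = Fract (a * c) (b * d)"
    using * by simp_all
  moreover have "\<not> P dvd b * d" using * pe by (simp add: prime_elem_dvd_mult_iff)
  ultimately show "x - y \<in> local_ring_at P" "x * y \<in> local_ring_at P"
    unfolding local_ring_at_def by blast+
qed

lemma to_fract_in_local_ring_at:
  assumes "irreducible P"
  shows "to_fract a \<in> local_ring_at P"
proof -
  have "\<not> P dvd 1" using assms by (rule irreducible_not_unit)
  then show ?thesis unfolding local_ring_at_def to_fract_def by blast
qed

lemma inverse_not_in_local_ring_at:
  assumes "irreducible P"
  shows "inverse (to_fract P) \<notin> local_ring_at P"
proof
  assume "inverse (to_fract P) \<in> local_ring_at P"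
  then obtain a b where *: "Fract 1 P = Fract a b" "\<not> P dvd b"
    by (auto simp: local_ring_at_def to_fract_def)
  moreover have "P \<noteq> 0" "b \<noteq> 0" using assms * by auto
  ultimately have "b = a * P" by (simp add: eq_fract)
  then show False using * by simp
qed

lemma fract_unit_times_power:
  fixes P :: "'a::field_gcd poly"
  assumes "irreducible P" "a \<noteq> 0" "b \<noteq> 0"
  obtains u where "u \<noteq> 0" "u \<in> local_ring_at P" "inverse u \<in> local_ring_at P"
    "Fract a b = u * to_fract P powi (int (multiplicity P a) - int (multiplicity P b))"
proof -
  have nu: "\<not> is_unit P" using assms(1) by (rule irreducible_not_unit)
  have P0: "P \<noteq> 0" using assms(1) by auto
  let ?m = "multiplicity P a" and ?n = "multiplicity P b"
  obtain a' where a': "a = P ^ ?m * a'" "\<not> P dvd a'"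
    using multiplicity_decompose'[OF assms(2) nu] by metis
  obtain b' where b': "b = P ^ ?n * b'" "\<not> P dvd b'"
    using multiplicity_decompose'[OF assms(3) nu] by metis
  have nz: "a' \<noteq> 0" "b' \<noteq> 0" using a' b' by auto
  have "to_fract a = to_fract P ^ ?m * to_fract a'" "to_fract b = to_fract P ^ ?n * to_fract b'"
    using arg_cong[OF a'(1), of to_fract] arg_cong[OF b'(1), of to_fract]
    unfolding to_fract_mult to_fract_power by blast+
  then have "Fract a b = Fract a' b' * to_fract P powi (int ?m - int ?n)"
    using P0 nz unfolding Fract_conv_to_fract by (simp add: power_int_diff mult.commute)
  moreover have "Fract a' b' \<in> local_ring_at P" "inverse (Fract a' b') \<in> local_ring_at P"
    using a'(2) b'(2) unfolding local_ring_at_def by auto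
  moreover have "Fract a' b' \<noteq> 0" using nz by (simp add: Fract_conv_to_fract)
  ultimately show ?thesis using that by blast
qed

text \<open>In an algebraic equation for \<open>x\<close> two terms with \<open>j < i\<close> have
  equal value, so \<open>x ^ (i - j)\<close> has the value of a power of \<open>P\<close>. As
  \<open>i - j\<close> is at most \<open>N\<close>, the exponent \<open>fact N\<close> serves all
  \<open>x\<close> at once; this uniformity makes the value group discrete.\<close>

lemma exists_valuation_over:
  fixes emb :: "'a::field_gcd poly fract \<Rightarrow> 'K::field"
  assumes emb: "rhom emb" and irr: "irreducible P"
    and alg: "\<And>x. \<exists>c. (\<exists>i\<le>N. c i \<noteq> 0) \<and> (\<Sum>i\<le>N. emb (c i) * x ^ i) = 0"
  shows "\<exists>v e. discrete_valuation v \<and> lies_over emb v P e \<and> e \<ge> 1"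
proof -
  let ?t = "emb (to_fract P)" and ?A0 = "emb ` local_ring_at P"
  note O = subring_set_local_ring_at[OF irr]
  have "subring_set ?A0"
    unfolding subring_set_def
  proof (intro conjI ballI)
    show "1 \<in> ?A0" using subring_setD(1)[OF O] rhom_one[OF emb] by (metis imageI)
    fix x y assume "x \<in> ?A0" "y \<in> ?A0"
    then show "x - y \<in> ?A0" "x * y \<in> ?A0"
      using subring_setD(3,4)[OF O] by (auto simp flip: rhom_diff[OF emb] rhom_mult[OF emb])
  qed
  moreover have "?t \<in> ?A0" using to_fract_in_local_ring_at[OF irr] by blast
  moreover have "inverse ?t \<notin> ?A0"
    using inverse_not_in_local_ring_at[OF irr] rhom_field_inj[OF emb]
    by (auto simp flip: rhom_inverse[OF emb])
  ultimately obtain A where A: "subring_set A" "?A0 \<subseteq> A" "inverse ?t \<notin> A" "\<forall>x. x \<in> A \<or> inverse x \<in> A"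
    by (rule exists_valuation_ring)
  interpret valuation_ring A ?t
    by unfold_locales (use A \<open>?t \<in> ?A0\<close> in auto)
  have unit_power: "\<exists>u. vunit u \<and> emb (Fract a b) = u * ?t powi (int (multiplicity P a) - int (multiplicity P b))"
    if ab: "a \<noteq> 0" "b \<noteq> 0" for a b
  proof -
    obtain u where u: "u \<noteq> 0" "u \<in> local_ring_at P" "inverse u \<in> local_ring_at P"
      "Fract a b = u * to_fract P powi (int (multiplicity P a) - int (multiplicity P b))"
      using fract_unit_times_power[OF irr ab] by blast
    have "emb u \<in> A" "emb (inverse u) \<in> A" using u A(2) by auto
    then have "vunit (emb u)"
      using rhom_field_nonzero[OF emb u(1)] by (simp add: vunit_def rhom_inverse[OF emb])
    then show ?thesis using u(4) by (auto simp: rhom_mult[OF emb] rhom_powi[OF emb])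
  qed
  have unit_power': "\<exists>u l. vunit u \<and> emb c = u * ?t powi l" if "c \<noteq> 0" for c
  proof (cases c rule: Fract_cases)
    case (Fract a b)
    then have "a \<noteq> 0" using that by (auto simp: Fract_conv_to_fract)
    then show ?thesis using unit_power[of a b] Fract by blast
  qed
  have torsion: "\<exists>l. vunit (x ^ fact N * ?t powi (- l))" if x: "x \<noteq> 0" for x
  proof -
    obtain c i0 where c: "i0 \<le> N" "c i0 \<noteq> 0" "(\<Sum>i\<le>N. emb (c i) * x ^ i) = 0"
      using alg by blast
    let ?I = "{i. i \<le> N \<and> c i \<noteq> 0}" and ?T = "\<lambda>i. emb (c i) * x ^ i"
    have T0: "?T i \<noteq> 0" if "i \<in> ?I" for i
      using that x rhom_field_nonzero[OF emb] by simp
    have "(\<Sum>i\<in>?I. ?T i) = (\<Sum>i\<le>N. ?T i)"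
      by (intro sum.mono_neutral_left) (auto simp: rhom_zero[OF emb])
    then have "(\<Sum>i\<in>?I. ?T i) = 0" using c(3) by simp
    then have "\<exists>i\<in>?I. \<exists>j\<in>?I. i \<noteq> j \<and> vunit (?T i / ?T j)"
      using c(1,2) T0 by (intro zero_sum_unit_quotient) auto
    then obtain i j where ij: "i \<in> ?I" "j \<in> ?I" "i \<noteq> j" "vunit (?T i / ?T j)" by blast
    have "\<exists>i\<in>?I. \<exists>j\<in>?I. j < i \<and> vunit (?T i / ?T j)"
    proof (cases "j < i")
      case True
      then show ?thesis using ij by blast
    next
      case False
      then show ?thesis using ij vunit_inverse[OF ij(4)] by (intro bexI[of _ j] bexI[of _ i]) auto
    qed
    then obtain i j where ij: "i \<in> ?I" "j \<in> ?I" "j < i" "vunit (?T i / ?T j)" by blast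
    obtain u l where u: "vunit u" "emb (c i) = u * ?t powi l" using unit_power' ij by blast
    obtain u' l' where u': "vunit u'" "emb (c j) = u' * ?t powi l'" using unit_power' ij by blast
    have "vunit (?T i / ?T j * (u' * inverse u))"
      using ij(4) u u' by (intro vunit_mult[OF _ vunit_mult[OF _ vunit_inverse]])
    moreover have "x ^ i = x ^ (i - j) * x ^ j" using ij by (simp flip: power_add)
    then have "?T i / ?T j * (u' * inverse u) = x ^ (i - j) * ?t powi (l - l')"
      using x u u' t_nonzero by (simp add: vunit_def power_int_diff field_simps)
    ultimately have 1: "vunit (x ^ (i - j) * ?t powi (l - l'))" by (simp only:)
    have "(i - j) dvd fact N" using ij by (intro dvd_fact) auto
    then obtain q where q: "fact N = (i - j) * q" by blast
    have "(x ^ (i - j) * ?t powi (l - l')) ^ q = x ^ fact N * ?t powi (- ((l' - l) * int q))"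
    proof -
      have "- ((l' - l) * int q) = (l - l') * int q" by (simp add: algebra_simps)
      then show ?thesis unfolding q power_mult power_mult_distrib by (simp only: power_int_mult power_int_of_nat)
    qed
    then show ?thesis using vunit_power[OF 1, of q] by metis
  qed
  interpret valuation_ring_torsion A ?t "fact N"
    by unfold_locales (use torsion in auto)
  obtain v e where v: "discrete_valuation v" "e \<ge> 1" "\<And>u l. vunit u \<Longrightarrow> v (u * ?t powi l) = int e * l"
    using exists_discrete_valuation by blast
  have "lies_over emb v P e"
    unfolding lies_over_def using unit_power v(3) by metis
  then show ?thesis using v by blast
qed

section \<open>Cyclic extensions of prime power degree\<close>

lemma dedekind_independence:
  fixes c :: "('a::field \<Rightarrow> 'b::field) \<Rightarrow> 'b"
  assumes "finite S" "\<And>f. f \<in> S \<Longrightarrow> rhom f" "\<And>x. (\<Sum>f\<in>S. c f * f x) = 0"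
  shows "\<forall>f\<in>S. c f = 0"
  using assms
proof (induction S arbitrary: c rule: finite_induct)
  case (insert g S)
  have rel: "c g * g x + (\<Sum>f\<in>S. c f * f x) = 0" for x
    using insert.prems(2)[of x] insert.hyps by simp
  have S: "c f = 0" if f: "f \<in> S" for f
  proof -
    have "f \<noteq> g" using f insert.hyps by auto
    then obtain a where a: "f a \<noteq> g a" by auto
    have "\<forall>f\<in>S. c f * (f a - g a) = 0"
    proof (rule insert.IH)
      fix x
      \<comment> \<open>The relation at \<open>a * x\<close> minus \<open>g a\<close> times the
        relation at \<open>x\<close> eliminates \<open>g\<close>.\<close>
      have "c g * g (a * x) + (\<Sum>f\<in>S. c f * f (a * x)) - g a * (c g * g x + (\<Sum>f\<in>S. c f * f x)) = 0"
        unfolding rel by simp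
      moreover have "g (a * x) = g a * g x" using insert.prems(1) rhom_mult by blast
      moreover have "(\<Sum>f\<in>S. c f * f (a * x)) = (\<Sum>f\<in>S. c f * (f a * f x))"
        using insert.prems(1) by (intro sum.cong) (auto simp: rhom_mult)
      ultimately show "(\<Sum>f\<in>S. c f * (f a - g a) * f x) = 0"
        by (simp add: algebra_simps sum_distrib_left sum_subtractf)
    qed (use insert.prems in auto)
    then show ?thesis using f a by auto
  qed
  have "g 1 = 1" using insert.prems(1) rhom_one by blast
  then have "c g = 0" using rel[of 1] S by simp
  then show ?case using S by simp
qed simp

lemma coeff_map_poly_rhom: "rhom h \<Longrightarrow> coeff (map_poly h f) i = h (coeff f i)"
  by (intro coeff_map_poly rhom_zero)

lemma rhom_map_poly: "rhom h \<Longrightarrow> rhom (map_poly h)"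
  unfolding rhom_def[of "map_poly h"]
  by (auto intro!: poly_eqI simp: coeff_map_poly_rhom coeff_mult rhom_simps)

locale cyclic_ext =
  fixes emb :: "'k::field \<Rightarrow> 'K::field" and p n :: nat and sg :: "'K \<Rightarrow> 'K"
  assumes emb: "rhom emb" and prime: "prime p" and char: "of_nat p = (0 :: 'K)" and n_pos: "n \<ge> 1"
    and sg: "rhom sg" and sg_emb: "sg (emb c) = emb c"
    and fixed: "sg x = x \<Longrightarrow> x \<in> range emb"
    and sg_order: "sg ^^ (p ^ n) = id"
    and sg_order_min: "0 < i \<Longrightarrow> i < p ^ n \<Longrightarrow> sg ^^ i \<noteq> id"
begin

abbreviation "N \<equiv> p ^ n"

lemma N_pos: "N > 0"
  using prime prime_gt_0_nat by simp

lemma rhom_funpow: "rhom (sg ^^ i)"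
proof (induction i)
  case 0
  then show ?case by (simp add: rhom_def)
next
  case (Suc i)
  then show ?case using rhom_compose[OF sg Suc] by (simp add: o_def)
qed

lemma inj_sg: "inj sg"
  by (rule injI) (simp add: rhom_field_inj[OF sg])

lemma inj_on_funpow: "inj_on (\<lambda>i. sg ^^ i) {..<N}"
proof (rule linorder_inj_onI')
  fix i j assume ij: "i \<in> {..<N}" "j \<in> {..<N}" "i < j"
  show "sg ^^ i \<noteq> sg ^^ j"
  proof
    assume "sg ^^ i = sg ^^ j"
    moreover have "sg ^^ j = sg ^^ i \<circ> sg ^^ (j - i)"
      using ij by (simp flip: funpow_add)
    ultimately have "(sg ^^ i) x = (sg ^^ i) ((sg ^^ (j - i)) x)" for x
      by (metis comp_apply)
    then have "sg ^^ (j - i) = id"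
      using inj_fn[OF inj_sg, of i] by (auto simp: inj_eq fun_eq_iff)
    then show False using sg_order_min[of "j - i"] ij by (simp add: less_imp_diff_less)
  qed
qed

definition "G = (\<lambda>i. sg ^^ i) ` {..<N}"

lemma finite_G: "finite G"
  and card_G: "card G = N"
  using inj_on_funpow by (simp_all add: G_def card_image)

lemma id_in_G: "id \<in> G"
  unfolding G_def using N_pos by (intro image_eqI[of _ _ 0]) auto

lemma rhom_in_G: "g \<in> G \<Longrightarrow> rhom g"
  using rhom_funpow by (auto simp: G_def)

lemma bij_betw_G: "bij_betw (\<lambda>g. sg \<circ> g) G G"
proof -
  have "sg \<circ> (sg ^^ i) \<in> G" if "i < N" for i
  proof (cases "Suc i = N")
    case True
    then have "sg \<circ> (sg ^^ i) = id" using sg_order by (metis funpow.simps(2))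
    then show ?thesis using id_in_G by simp
  next
    case False
    then show ?thesis
      unfolding G_def using that by (intro image_eqI[of _ _ "Suc i"]) auto
  qed
  then have "(\<lambda>g. sg \<circ> g) ` G \<subseteq> G" by (auto simp: G_def)
  moreover have "inj_on (\<lambda>g. sg \<circ> g) G"
    using inj_sg by (auto intro!: inj_onI simp: fun_eq_iff inj_eq)
  ultimately show ?thesis using finite_G by (simp add: bij_betw_def endo_inj_surj)
qed

lemma sum_G: "(\<Sum>g\<in>G. g x) = (\<Sum>i<N. (sg ^^ i) x)"
  unfolding G_def by (subst sum.reindex[OF inj_on_funpow]) simp

lemma fixed_coeffs: "map_poly sg f = f \<Longrightarrow> coeff f i \<in> range emb"
  by (metis coeff_map_poly_rhom[OF sg] fixed)

text \<open>The product of \<open>X - g x\<close> over the group is monic with coefficients fixed by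
  \<open>sg\<close>. Its degree does not depend on \<open>x\<close>, as the extension of valuations
  demands.\<close>

lemma algebraic: "\<exists>c. (\<exists>i\<le>N. c i \<noteq> 0) \<and> (\<Sum>i\<le>N. emb (c i) * x ^ i) = 0"
proof -
  define f where "f = (\<Prod>g\<in>G. [:- g x, 1:])"
  have "map_poly sg f = (\<Prod>g\<in>G. [:- (sg \<circ> g) x, 1:])"
    unfolding f_def
    by (simp add: rhom_prod[OF rhom_map_poly[OF sg]] map_poly_pCons rhom_simps[OF sg])
  also have "\<dots> = f" unfolding f_def by (rule prod.reindex_bij_betw[OF bij_betw_G])
  finally have "\<forall>i. coeff f i \<in> range emb" using fixed_coeffs by blast
  then have "\<forall>i. \<exists>c. coeff f i = emb c" by blast
  then obtain c where c: "\<And>i. coeff f i = emb (c i)" by metis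
  have deg: "degree f = N"
    unfolding f_def by (subst degree_prod_eq_sum_degree) (auto simp: card_G)
  have "lead_coeff f = 1" unfolding f_def by (simp add: lead_coeff_prod)
  then have "c N \<noteq> 0" using c[of N] deg rhom_zero[OF emb] by auto
  moreover have "poly f x = 0"
    unfolding f_def poly_prod using id_in_G finite_G by (intro prod_zero) (auto intro!: bexI[of _ id])
  then have "(\<Sum>i\<le>N. emb (c i) * x ^ i) = 0"
    by (simp add: poly_altdef deg c)
  ultimately show ?thesis by blast
qed

text \<open>The trace is not identically zero by independence of automorphisms; an element of
  nonzero trace is divided by its trace, which is fixed.\<close>

lemma exists_trace_one: "\<exists>\<theta>. (\<Sum>i<N. (sg ^^ i) \<theta>) = 1"
proof -
  have "\<exists>x. (\<Sum>g\<in>G. g x) \<noteq> 0"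
  proof (rule ccontr)
    assume "\<nexists>x. (\<Sum>g\<in>G. g x) \<noteq> 0"
    then have "\<forall>f\<in>G. (1::'K) = 0"
      by (intro dedekind_independence[of G "\<lambda>_. 1"]) (auto simp: finite_G rhom_in_G)
    then show False using id_in_G by auto
  qed
  then obtain x where x: "(\<Sum>g\<in>G. g x) \<noteq> 0" by blast
  let ?T = "\<Sum>g\<in>G. g x"
  have "sg ?T = (\<Sum>g\<in>G. (sg \<circ> g) x)" by (simp add: rhom_sum[OF sg])
  also have "\<dots> = ?T" by (rule sum.reindex_bij_betw[OF bij_betw_G])
  finally have "sg ?T = ?T" .
  then have fixT: "(sg ^^ i) ?T = ?T" for i by (induction i) auto
  have "(sg ^^ i) (x / ?T) = (sg ^^ i) x / ?T" for i
    unfolding divide_inverse by (simp add: rhom_mult[OF rhom_funpow] rhom_inverse[OF rhom_funpow] fixT)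
  then have "(\<Sum>i<N. (sg ^^ i) (x / ?T)) = (\<Sum>i<N. (sg ^^ i) x) / ?T"
    by (simp add: sum_divide_distrib)
  then show ?thesis using x by (intro exI[of _ "x / ?T"]) (simp add: sum_G)
qed

section \<open>Additive Hilbert 90 for Witt vectors\<close>

sublocale W: ab_group_add "wop p 1" "\<lambda>_. 0 :: 'K" "wop p (- 1)" "wop p (- 1) (\<lambda>_. 0)"
  using witt_ab_group_add[OF prime] .

primrec psum :: "(nat \<Rightarrow> 'K) \<Rightarrow> nat \<Rightarrow> nat \<Rightarrow> 'K" where
  "psum t 0 = (\<lambda>_. 0)"
| "psum t (Suc i) = wop p 1 t (\<lambda>m. sg (psum t i m))"

lemma sg_wop: "(\<lambda>m. sg (wop p s x y m)) = wop p s (\<lambda>m. sg (x m)) (\<lambda>m. sg (y m))"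
  by (simp add: fun_eq_iff rhom_wop[OF sg])

lemma psum_Suc': "psum t (Suc i) = wop p 1 (psum t i) (\<lambda>m. (sg ^^ i) (t m))"
proof (induction i)
  case 0
  show ?case by (simp add: rhom_zero[OF sg])
next
  case (Suc i)
  have "psum t (Suc (Suc i)) = wop p 1 t (\<lambda>m. sg (wop p 1 (psum t i) (\<lambda>m. (sg ^^ i) (t m)) m))"
    unfolding psum.simps(2)[of t "Suc i"] Suc.IH ..
  also have "\<dots> = wop p 1 (wop p 1 t (\<lambda>m. sg (psum t i m))) (\<lambda>m. sg ((sg ^^ i) (t m)))"
    unfolding sg_wop by (simp only: W.add.assoc)
  finally show ?case by simp
qed

text \<open>The partial trace of length \<open>Suc N\<close> can be built from the front or from the
  back; as \<open>sg ^^ N\<close> is the identity, the last summand is \<open>t\<close> again and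
  can be cancelled.\<close>

lemma sg_psum_N: "(\<lambda>m. sg (psum t N m)) = psum t N"
proof -
  have "wop p 1 t (\<lambda>m. sg (psum t N m)) = wop p 1 (psum t N) t"
    using psum_Suc'[of t N] sg_order by simp
  then have "wop p 1 t (\<lambda>m. sg (psum t N m)) = wop p 1 t (psum t N)"
    by (simp only: W.add.commute)
  then show ?thesis by (simp only: W.add_left_cancel)
qed

lemma psum_top_diff:
  assumes "\<And>i. i < m \<Longrightarrow> t i = t' i"
  shows "(\<forall>j<m. psum t i j = psum t' i j) \<and>
    psum t i m - psum t' i m = (\<Sum>j<i. (sg ^^ j) (t m - t' m))"
proof (induction i)
  case (Suc i)
  have "psum t (Suc i) j = psum t' (Suc i) j" if "j < m" for j
    unfolding psum.simps using that assms Suc by (intro wop_cong_below[OF prime, of m]) auto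
  moreover have "psum t (Suc i) m - psum t' (Suc i) m = (t m - t' m) + of_int 1 * (sg (psum t i m) - sg (psum t' i m))"
    unfolding psum.simps using assms Suc by (intro wop_top_diff[OF prime]) auto
  then have "psum t (Suc i) m - psum t' (Suc i) m = (t m - t' m) + sg (psum t i m - psum t' i m)"
    by (simp add: rhom_diff[OF sg])
  then have "psum t (Suc i) m - psum t' (Suc i) m = (\<Sum>j<Suc i. (sg ^^ j) (t m - t' m))"
    using Suc by (simp add: rhom_sum[OF sg] sum.lessThan_Suc_shift del: sum.lessThan_Suc)
  ultimately show ?case by blast
qed simp

text \<open>The trace is corrected one entry at a time. The error \<open>c\<close> in entry
  \<open>m\<close> is fixed by \<open>sg\<close>, so adding \<open>c * \<theta>\<close> to
  \<open>t m\<close>, with \<theta> of trace one, changes that entry of the trace by exactly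
  \<open>c\<close>.\<close>

lemma exists_witt_trace_one: "\<exists>t. \<forall>i<m. psum t N i = wone i"
proof (induction m)
  case (Suc m)
  then obtain t where t: "\<And>i. i < m \<Longrightarrow> psum t N i = wone i" by blast
  obtain \<theta> where \<theta>: "(\<Sum>i<N. (sg ^^ i) \<theta>) = 1" using exists_trace_one by blast
  define c where "c = wone m - psum t N m"
  have "sg (psum t N m) = psum t N m" using fun_cong[OF sg_psum_N, of t m] .
  moreover have "sg (wone m) = wone m" by (simp add: wone_def rhom_one[OF sg] rhom_zero[OF sg])
  ultimately have "sg c = c" by (simp add: c_def rhom_diff[OF sg])
  then have fc: "(sg ^^ i) c = c" for i by (induction i) auto
  let ?t = "t(m := t m + c * \<theta>)"
  have d: "(\<forall>j<m. psum ?t N j = psum t N j) \<and>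
    psum ?t N m - psum t N m = (\<Sum>j<N. (sg ^^ j) (?t m - t m))"
    by (rule psum_top_diff) auto
  moreover have "(\<Sum>j<N. (sg ^^ j) (?t m - t m)) = c"
    using \<theta> by (simp add: rhom_mult[OF rhom_funpow] fc flip: sum_distrib_left)
  ultimately have "\<forall>i<Suc m. psum ?t N i = wone i"
    using t by (auto simp: less_Suc_eq c_def)
  then show ?case by blast
qed simp

text \<open>Additive Hilbert 90 for the constant cocycle: with \<open>s i = t + sg t + ... + sg ^ (i - 1) t\<close> and
  \<open>t\<close> of trace one, the sum of \<open>s 1, ..., s N\<close> is moved by the generator by exactly the unit vector.\<close>

primrec ysum :: "(nat \<Rightarrow> 'K) \<Rightarrow> nat \<Rightarrow> nat \<Rightarrow> 'K" where
  "ysum t 0 = (\<lambda>_. 0)"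
| "ysum t (Suc i) = wop p 1 (ysum t i) (psum t (Suc i))"

text \<open>Since \<open>sg\<close> sends \<open>psum t k\<close> to \<open>psum t (Suc k)\<close>
  minus \<open>t\<close>, the sum telescopes; the extra \<open>t\<close> on the left stands for
  \<open>psum t 1\<close>. For \<open>i = N\<close> the multiple of \<open>t\<close> vanishes below
  \<open>n\<close>.\<close>

lemma sg_ysum:
  "wop p 1 (wop p 1 (\<lambda>m. sg (ysum t i m)) (wmult p i t)) t = wop p 1 (ysum t i) (psum t (Suc i))"
proof (induction i)
  case 0
  show ?case by (simp add: rhom_zero[OF sg])
next
  case (Suc i)
  have "wop p 1 (wop p 1 (\<lambda>m. sg (ysum t (Suc i) m)) (wmult p (Suc i) t)) t =
    wop p 1 (wop p 1 (wop p 1 (\<lambda>m. sg (ysum t i m)) (wmult p i t)) t)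
      (wop p 1 t (\<lambda>m. sg (psum t (Suc i) m)))"
    unfolding ysum.simps(2) sg_wop wmult_Suc
    by (simp only: W.add.assoc W.add.commute W.add.left_commute)
  also have "\<dots> = wop p 1 (ysum t (Suc i)) (psum t (Suc (Suc i)))"
    unfolding Suc.IH ysum.simps(2) psum.simps(2)[of t "Suc i"] ..
  finally show ?case .
qed

lemma wop_cancel_below:
  fixes x y t :: "nat \<Rightarrow> 'K"
  assumes "\<And>i. i < m \<Longrightarrow> wop p 1 x t i = wop p 1 y t i" "i < m"
  shows "x i = y i"
proof -
  have "wop p (- 1) (wop p 1 x t) t i = wop p (- 1) (wop p 1 y t) t i"
    by (rule wop_cong_below[OF prime, of m]) (use assms in auto)
  then show ?thesis unfolding W.add_diff_cancel .
qed

lemma exists_witt_generator: "\<exists>y. \<forall>i<n. sg (y i) = wop p 1 y wone i"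
proof -
  obtain t where t: "\<And>i. i < n \<Longrightarrow> psum t N i = wone i" using exists_witt_trace_one by blast
  let ?y = "ysum t N"
  have "sg (?y i) = wop p 1 ?y wone i" if i: "i < n" for i
  proof (rule wop_cancel_below[of n "\<lambda>i. sg (?y i)" t, OF _ i])
    fix i assume i: "i < n"
    have "wop p 1 (\<lambda>i. sg (?y i)) t i = wop p 1 (wop p 1 (\<lambda>_. 0) (\<lambda>i. sg (?y i))) t i" by simp
    also have "\<dots> = wop p 1 (wop p 1 (wmult p N t) (\<lambda>i. sg (?y i))) t i"
      using i wmult_prime_power_below[OF prime char]
      by (intro wop_cong_below[OF prime, of n]) auto
    also have "\<dots> = wop p 1 ?y (psum t (Suc N)) i"
      using sg_ysum[of t N] by (simp only: W.add.commute)
    \<comment> \<open>The full trace \<open>psum t N\<close> agrees with \<open>wone\<close> below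
      \<open>n\<close>, and \<open>wone\<close> is fixed by \<open>sg\<close>.\<close>
    also have "\<dots> = wop p 1 ?y (wop p 1 t wone) i"
      unfolding psum.simps(2) using i t
      by (intro wop_cong_below[OF prime, of n]) (auto simp: wone_def rhom_simps[OF sg])
    also have "\<dots> = wop p 1 (wop p 1 ?y wone) t i"
      by (simp only: W.add.assoc W.add.commute W.add.left_commute)
    finally show "wop p 1 (\<lambda>i. sg (?y i)) t i = wop p 1 (wop p 1 ?y wone) t i" .
  qed
  then show ?thesis by blast
qed

lemma funpow_witt_generator:
  assumes y: "\<And>i. i < n \<Longrightarrow> sg (y i) = wop p 1 y wone i" and "i < n"
  shows "(sg ^^ k) (y i) = wop p 1 y (wmult p k wone) i"
  using \<open>i < n\<close>
proof (induction k arbitrary: i)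
  case (Suc k)
  have one: "(\<lambda>i. sg (wone i)) = wone" by (auto simp: wone_def rhom_simps[OF sg])
  have "(sg ^^ Suc k) (y i) = sg (wop p 1 y (wmult p k wone) i)" using Suc by simp
  also have "\<dots> = wop p 1 (\<lambda>i. sg (y i)) (wmult p k wone) i"
    by (simp add: rhom_wop[OF sg] rhom_wmult[OF sg] one)
  also have "\<dots> = wop p 1 (wop p 1 y wone) (wmult p k wone) i"
    using y Suc.prems by (intro wop_cong_below[OF prime, of n]) auto
  also have "\<dots> = wop p 1 y (wmult p (Suc k) wone) i"
    unfolding wmult_Suc by (simp only: W.add.assoc)
  finally show ?case .
qed simp

lemma exists_moved_component:
  assumes y: "\<And>i. i < n \<Longrightarrow> sg (y i) = wop p 1 y wone i"
  shows "\<exists>i<n. (sg ^^ (p ^ (n - 1))) (y i) \<noteq> y i"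
proof (rule ccontr)
  assume no: "\<not> ?thesis"
  let ?e = "wmult p (p ^ (n - 1)) wone :: nat \<Rightarrow> 'K"
  have "?e (n - 1) = (\<lambda>_. 0) (n - 1)"
  proof (rule wop_cancel_below[of n ?e y "\<lambda>_. 0"])
    fix i assume i: "i < n"
    then have "wop p 1 y ?e i = y i" using no funpow_witt_generator[OF y] by simp
    then show "wop p 1 ?e y i = wop p 1 (\<lambda>_. 0) y i" by (simp only: W.add.commute W.add.right_neutral)
  qed (use n_pos in auto)
  moreover have "?e (n - 1) = 1" by (rule wmult_prime_power_wone_top[OF prime char])
  ultimately show False by simp
qed

section \<open>Generation of the extension by the entries\<close>

lemma funpow_fixed_mult: "(sg ^^ c) x = x \<Longrightarrow> (sg ^^ (k * c)) x = x"
  by (induction k) (simp_all add: funpow_add)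

text \<open>A nontrivial subgroup of a cyclic group of order \<open>p ^ n\<close> contains the
  subgroup of order \<open>p\<close>. Concretely, Bezout replaces \<open>c\<close> by
  \<open>gcd c N = p ^ i\<close> with \<open>i < n\<close>, and this divides
  \<open>p ^ (n - 1)\<close>.\<close>

lemma conjugates_distinct:
  assumes moved: "(sg ^^ (p ^ (n - 1))) x \<noteq> x" and c: "0 < c" "c < N"
  shows "(sg ^^ c) x \<noteq> x"
proof
  assume fx: "(sg ^^ c) x = x"
  define g where "g = gcd c N"
  obtain a b where ab: "c * a = N * b + g"
    unfolding g_def using bezout_nat[of c N] c by auto
  have "(sg ^^ N) x = x" using sg_order by simp
  then have "(sg ^^ (b * N)) x = x" by (rule funpow_fixed_mult)
  moreover have "(sg ^^ (a * c)) x = x" using fx by (rule funpow_fixed_mult)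
  moreover have "a * c = g + b * N" using ab by (simp add: mult.commute add.commute)
  ultimately have gx: "(sg ^^ g) x = x" by (simp add: funpow_add)
  have "g dvd p ^ n" by (simp add: g_def)
  then obtain i where i: "g = p ^ i" "i \<le> n" using divides_primepow_nat[OF prime] by blast
  have "g \<le> c" using c by (simp add: g_def)
  then have "i \<noteq> n" using c i by auto
  then have "p ^ (n - 1) = p ^ (n - 1 - i) * g" using i by (simp flip: power_add)
  then show False using moved funpow_fixed_mult[OF gx, of "p ^ (n - 1 - i)"] by simp
qed

lemma is_subfield_gen_field: "is_subfield (gen_field B)"
  by (auto simp: gen_field_def is_subfield_def)

text \<open>Lagrange interpolation over the conjugates of a primitive element \<open>\<theta>\<close> expresses any \<open>z\<close> as a
  quotient of values at \<open>\<theta>\<close> of two polynomials with coefficients in the base field.\<close>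

lemma generates:
  assumes F: "is_subfield F" "range emb \<subseteq> F" "\<theta> \<in> F"
    and moved: "(sg ^^ (p ^ (n - 1))) \<theta> \<noteq> \<theta>"
  shows "F = UNIV"
proof -
  define L where "L z = (\<Sum>g\<in>G. [:g z:] * (\<Prod>h\<in>G - {g}. [:- h \<theta>, 1:]))" for z
  \<comment> \<open>The derivative at \<theta> of the product of all \<open>X - h \<theta>\<close>.
    It is the common factor in the values \<open>z * D\<close> of the interpolation polynomials, and
    the value for \<open>z = 1\<close> divides it out.\<close>
  define D where "D = (\<Prod>h\<in>G - {id}. \<theta> - h \<theta>)"
  note mp = rhom_simps[OF rhom_map_poly[OF sg]]
  have bij': "bij_betw (\<lambda>g. sg \<circ> g) (G - {g}) (G - {sg \<circ> g})" if "g \<in> G" for g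
    using bij_betw_DiffI[OF bij_betw_G, of "{g}" "{sg \<circ> g}"] that bij_betw_G
    by (auto simp: bij_betw_def)
  have coeffs: "coeff (L z) i \<in> F" for z i
  proof -
    have "map_poly sg (L z) = (\<Sum>g\<in>G. [:(sg \<circ> g) z:] * (\<Prod>h\<in>G - {g}. [:- (sg \<circ> h) \<theta>, 1:]))"
      unfolding L_def mp by (simp add: map_poly_pCons rhom_simps[OF sg])
    also have "\<dots> = (\<Sum>g\<in>G. [:(sg \<circ> g) z:] * (\<Prod>h\<in>G - {sg \<circ> g}. [:- h \<theta>, 1:]))"
      by (intro sum.cong refl arg_cong2[of _ _ _ _ "(*)"] prod.reindex_bij_betw[OF bij'])
    also have "\<dots> = L z"
      unfolding L_def by (rule sum.reindex_bij_betw[OF bij_betw_G])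
    finally show ?thesis using fixed_coeffs F(2) by blast
  qed
  have powF: "\<theta> ^ i \<in> F" for i
    by (induction i) (use F in \<open>auto simp: is_subfield_def\<close>)
  have sumF: "sum f I \<in> F" if "\<And>i. i \<in> I \<Longrightarrow> f i \<in> F" for f :: "nat \<Rightarrow> 'K" and I
    using that F(1) by (induction I rule: infinite_finite_induct) (auto simp: is_subfield_def)
  have inF: "poly (L z) \<theta> \<in> F" for z
    unfolding poly_altdef using coeffs powF F(1) by (intro sumF) (auto simp: is_subfield_def)
  have val: "poly (L z) \<theta> = z * D" for z
  proof -
    have "poly (L z) \<theta> = (\<Sum>g\<in>G. g z * (\<Prod>h\<in>G - {g}. \<theta> - h \<theta>))"
      unfolding L_def by (simp add: poly_sum poly_prod)
    also have "\<dots> = (\<Sum>g\<in>{id}. g z * (\<Prod>h\<in>G - {g}. \<theta> - h \<theta>))"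
    proof (rule sum.mono_neutral_right)
      show "\<forall>g\<in>G - {id}. g z * (\<Prod>h\<in>G - {g}. \<theta> - h \<theta>) = 0"
      proof
        fix g assume "g \<in> G - {id}"
        then have "(\<Prod>h\<in>G - {g}. \<theta> - h \<theta>) = 0"
          using id_in_G finite_G by (intro prod_zero) (auto intro!: bexI[of _ id])
        then show "g z * (\<Prod>h\<in>G - {g}. \<theta> - h \<theta>) = 0" by simp
      qed
    qed (use finite_G id_in_G in auto)
    finally show ?thesis by (simp add: D_def)
  qed
  have "D \<noteq> 0"
  proof
    assume "D = 0"
    then have "\<exists>h\<in>G - {id}. \<theta> - h \<theta> = 0"
      unfolding D_def by (simp only: prod_zero_iff[OF finite_Diff[OF finite_G]])
    then obtain h where h: "h \<in> G" "h \<noteq> id" "h \<theta> = \<theta>"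
      unfolding right_minus_eq by (metis DiffE singletonI)
    then obtain i where i: "i < N" "h = sg ^^ i" by (auto simp: G_def)
    then have "i > 0" using h(2) by (cases i) auto
    then show False using conjugates_distinct[OF moved, of i] h(3) i by simp
  qed
  have "z \<in> F" for z
  proof -
    have "z = poly (L z) \<theta> * inverse (poly (L 1) \<theta>)" using val[of z] val[of 1] \<open>D \<noteq> 0\<close> by simp
    also have "\<dots> \<in> F" using inF F(1) unfolding is_subfield_def by blast
    finally show ?thesis .
  qed
  then show ?thesis by blast
qed

lemma gen_field_witt_generator:
  assumes y: "\<And>i. i < n \<Longrightarrow> sg (y i) = wop p 1 y wone i"
  shows "gen_field (range emb \<union> y ` {..<n}) = UNIV"
proof -
  obtain i where i: "i < n" "(sg ^^ (p ^ (n - 1))) (y i) \<noteq> y i"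
    using exists_moved_component[OF y] by blast
  have sub: "range emb \<union> y ` {..<n} \<subseteq> gen_field (range emb \<union> y ` {..<n})"
    by (auto simp: gen_field_def)
  show ?thesis
    by (rule generates[OF is_subfield_gen_field _ _ i(2)]) (use sub i(1) in auto)
qed

end

text \<open>The order of the chosen generator is not part of the definition. Finiteness forces a
  repetition among its powers, the least period lists the group without repetition, and so it equals
  the cardinality.\<close>

lemma cyclic_galois_imp_cyclic_ext:
  fixes emb :: "'k::field \<Rightarrow> 'K::field"
  assumes "cyclic_galois_of_degree emb (p ^ n)" "rhom emb" "prime p" "of_nat p = (0::'K)" "n \<ge> 1"
  shows "\<exists>sg. cyclic_ext emb p n sg"
proof -
  let ?G = "galois_group emb"
  have fin: "finite ?G" and card: "card ?G = p ^ n"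
    and fix_range: "{x. \<forall>\<sigma>\<in>?G. \<sigma> x = x} = range emb"
    using assms(1) by (auto simp: cyclic_galois_of_degree_def)
  obtain sg where sg: "sg \<in> ?G" and gen: "\<And>\<tau>. \<tau> \<in> ?G \<Longrightarrow> \<exists>m. \<tau> = sg ^^ m"
    using assms(1) by (auto simp: cyclic_galois_of_degree_def)
  have bij: "bij sg" and hom: "rhom sg" and femb: "\<And>x. sg (emb x) = emb x"
    using sg by (auto simp: galois_group_def field_hom_def rhom_def)
  have pow: "sg ^^ m \<in> ?G" for m
  proof (induction m)
    case 0
    then show ?case by (auto simp: galois_group_def field_hom_def bij_def)
  next
    case (Suc m)
    then have "bij (sg \<circ> sg ^^ m)" using bij by (auto simp: galois_group_def intro: bij_comp)
    then show ?case using Suc sg by (auto simp: galois_group_def field_hom_def o_def)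
  qed
  have "\<not> inj (\<lambda>m. sg ^^ m)"
  proof
    assume "inj (\<lambda>m. sg ^^ m)"
    moreover have "range (\<lambda>m. sg ^^ m) \<subseteq> ?G" using pow by auto
    then have "finite (range (\<lambda>m. sg ^^ m))" using fin by (rule finite_subset)
    ultimately show False using finite_imageD[of "\<lambda>m. sg ^^ m" UNIV] by simp
  qed
  have cancel: "sg ^^ (j - i) = id" if "sg ^^ i = sg ^^ j" "i < j" for i j
  proof -
    have "sg ^^ j = sg ^^ i \<circ> sg ^^ (j - i)" using that(2) by (simp flip: funpow_add)
    then have "(sg ^^ i) x = (sg ^^ i) ((sg ^^ (j - i)) x)" for x
      using that by (metis comp_apply)
    then show ?thesis
      using inj_fn[OF bij_is_inj[OF bij], of i] by (auto simp: inj_eq fun_eq_iff)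
  qed
  obtain i j where "i < j" "sg ^^ i = sg ^^ j"
    using \<open>\<not> inj (\<lambda>m. sg ^^ m)\<close> by (metis linorder_injI)
  then have "\<exists>m>0. sg ^^ m = id" using cancel[of i j] by (intro exI[of _ "j - i"]) auto
  define d where "d = (LEAST m. m > 0 \<and> sg ^^ m = id)"
  have d: "d > 0" "sg ^^ d = id"
    using LeastI_ex[OF \<open>\<exists>m>0. sg ^^ m = id\<close>] by (auto simp: d_def)
  have dmin: "sg ^^ m \<noteq> id" if "0 < m" "m < d" for m
    using that not_less_Least[of m "\<lambda>m. m > 0 \<and> sg ^^ m = id"] by (auto simp: d_def)
  have "inj_on (\<lambda>i. sg ^^ i) {..<d}"
  proof (rule linorder_inj_onI')
    fix i j assume "i \<in> {..<d}" "j \<in> {..<d}" "i < j"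
    then show "sg ^^ i \<noteq> sg ^^ j" using cancel[of i j] dmin[of "j - i"] by auto
  qed
  moreover have "?G = (\<lambda>i. sg ^^ i) ` {..<d}"
  proof
    show "(\<lambda>i. sg ^^ i) ` {..<d} \<subseteq> ?G" using pow by auto
    show "?G \<subseteq> (\<lambda>i. sg ^^ i) ` {..<d}"
    proof
      fix \<tau> assume "\<tau> \<in> ?G"
      then obtain m where m: "\<tau> = sg ^^ m" using gen by blast
      have "(sg ^^ m) x = (sg ^^ (m mod d)) x" for x
        using d(2) by (intro funpow_mod_eq[symmetric]) simp
      then have "\<tau> = sg ^^ (m mod d)" using m by auto
      then show "\<tau> \<in> (\<lambda>i. sg ^^ i) ` {..<d}" using d(1) by (intro image_eqI[of _ _ "m mod d"]) auto
    qed
  qed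
  ultimately have "d = p ^ n" using card by (simp add: card_image)
  have fixed: "x \<in> range emb" if "sg x = x" for x
  proof -
    have "(sg ^^ m) x = x" for m using that by (induction m) auto
    then have "\<forall>\<sigma>\<in>?G. \<sigma> x = x" using gen by metis
    then show ?thesis using fix_range by blast
  qed
  have "cyclic_ext emb p n sg"
    by unfold_locales (use assms hom femb fixed d dmin \<open>d = p ^ n\<close> in auto)
  then show ?thesis by blast
qed

section \<open>Poles at unramified primes\<close>

context
  fixes v :: "'K::field \<Rightarrow> int"
  assumes v: "discrete_valuation v"
begin

lemma val_mult: "x \<noteq> 0 \<Longrightarrow> y \<noteq> 0 \<Longrightarrow> v (x * y) = v x + v y"
  and val_add: "x \<noteq> 0 \<Longrightarrow> y \<noteq> 0 \<Longrightarrow> x + y \<noteq> 0 \<Longrightarrow> v (x + y) \<ge> min (v x) (v y)"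
  using v by (auto simp: discrete_valuation_def)

lemma val_one: "v 1 = 0"
  using val_mult[of 1 1] by simp

lemma val_uminus: "v (- x) = v x"
proof (cases "x = 0")
  case False
  have "v (- 1) = 0" using val_mult[of "- 1" "- 1"] val_one by simp
  then show ?thesis using val_mult[of "- 1" x] False by simp
qed simp

lemma val_power: "x \<noteq> 0 \<Longrightarrow> v (x ^ n) = int n * v x"
  by (induction n) (simp_all add: val_one val_mult algebra_simps)

text \<open>\<open>discrete_valuation\<close> leaves the value at 0 unspecified, which explains the
  disjunction here and the explicit 0 in \<open>val_ring\<close>.\<close>

lemma val_diff_eq:
  assumes "x \<noteq> 0" "y = 0 \<or> v x < v y"
  shows "x - y \<noteq> 0 \<and> v (x - y) = v x"
proof (cases "y = 0")
  case False
  then have lt: "v x < v y" using assms by simp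
  then have nz: "x - y \<noteq> 0" by auto
  have "min (v x) (v (- y)) \<le> v (x + - y)" using assms nz False by (intro val_add) auto
  moreover have "min (v (x - y)) (v y) \<le> v (x - y + y)" using assms nz False by (intro val_add) auto
  ultimately show ?thesis using lt nz by (simp add: val_uminus min_def split: if_splits)
qed (use assms in simp)

definition val_ring :: "'K set" where
  "val_ring = {x. x = 0 \<or> v x \<ge> 0}"

lemma subring_set_val_ring: "subring_set val_ring"
  unfolding subring_set_def
proof (intro conjI ballI)
  show "1 \<in> val_ring" by (simp add: val_ring_def val_one)
  fix x y assume xy: "x \<in> val_ring" "y \<in> val_ring"
  show "x * y \<in> val_ring"
    using xy val_mult[of x y] by (cases "x = 0 \<or> y = 0") (auto simp: val_ring_def)
  show "x - y \<in> val_ring"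
    using xy val_add[of x "- y"]
    by (cases "x = 0 \<or> y = 0 \<or> x - y = 0") (auto simp: val_ring_def val_uminus)
qed

lemma val_artin_schreier:
  assumes "x \<notin> val_ring" "p > 1"
  shows "x ^ p - x \<noteq> 0 \<and> v (x ^ p - x) = int p * v x"
proof -
  have x: "x \<noteq> 0" "v x < 0" using assms by (auto simp: val_ring_def)
  have "int p * v x < v x"
    using mult_strict_right_mono_neg[of 1 "int p" "v x"] x assms(2) by simp
  then show ?thesis using val_diff_eq[of "x ^ p" x] x by (simp add: val_power)
qed

text \<open>Index one ensures that the pole of \<open>Q / P ^ m\<close> keeps order \<open>m\<close>
  in \<open>K\<close>; an index divisible by \<open>p\<close> would destroy the contradiction.
  Integrality of the lower \<open>z i\<close> comes first, since only then is entry \<open>j\<close>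
  of the Witt difference equal to \<open>z j ^ p - z j\<close> up to an integral element.\<close>

lemma unramified_no_pole:
  fixes emb :: "'a::field_gcd poly fract \<Rightarrow> 'K" and z :: "nat \<Rightarrow> 'K"
  assumes p: "prime p" and emb: "rhom emb" and over: "lies_over emb v P 1" and irr: "irreducible P"
    and z: "\<And>i. i \<le> j \<Longrightarrow> wop p (- 1) (\<lambda>i. z i ^ p) z i = emb (b i)"
    and low: "\<And>i. i < j \<Longrightarrow> b i \<in> local_ring_at P"
    and bj: "b j = c + Fract Q (P ^ m)" "c \<in> local_ring_at P" "coprime Q P" "m > 0" "\<not> p dvd m"
  shows False
proof -
  note C = subring_setD[OF subring_set_val_ring] subring_set_power[OF subring_set_val_ring]
  have p1: "p > 1" using p prime_gt_1_nat by blast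
  have P: "P \<noteq> 0" "\<not> is_unit P" using irr irreducible_not_unit by auto
  have embO: "emb c \<in> val_ring" if "c \<in> local_ring_at P" for c
  proof -
    obtain a d where c: "c = Fract a d" "\<not> P dvd d" using \<open>c \<in> local_ring_at P\<close> by (auto simp: local_ring_at_def)
    have "d \<noteq> 0" using c by auto
    show ?thesis
    proof (cases "a = 0")
      case True
      then have "c = 0" using c by (simp add: Fract_conv_to_fract)
      then show ?thesis using C(2) by (simp add: rhom_zero[OF emb])
    next
      case False
      then have "v (emb c) = int (multiplicity P a) - int (multiplicity P d)"
        using over \<open>d \<noteq> 0\<close> c by (simp add: lies_over_def)
      then show ?thesis using c by (simp add: val_ring_def not_dvd_imp_multiplicity_0)
    qed
  qed
  have AS: "(z i ^ p - z i) - emb (b i) \<in> val_ring" if "i \<le> j" "\<And>k. k < i \<Longrightarrow> z k \<in> val_ring" for i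
  proof -
    have "wop p (- 1) (\<lambda>i. z i ^ p) z i - (z i ^ p + of_int (- 1) * z i) \<in> val_ring"
      using that C(7) by (intro subring_set_wop_diff[OF p subring_set_val_ring]) auto
    then have "- (emb (b i) - (z i ^ p - z i)) \<in> val_ring" using z that by (intro C(5)) simp
    then show ?thesis by simp
  qed
  \<comment> \<open>A pole of \<open>z i\<close> would give \<open>z i ^ p - z i\<close> a pole
    \<open>p\<close> times as large, yet this element is integral because \<open>b i\<close>
    is.\<close>
  have zO: "z i \<in> val_ring" if "i < j" for i
    using that
  proof (induction i rule: less_induct)
    case (less i)
    then have "(z i ^ p - z i) - emb (b i) + emb (b i) \<in> val_ring"
      using AS[of i] embO[OF low] by (intro C(6)) auto
    then have in_ring: "z i ^ p - z i \<in> val_ring" by simp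
    show ?case
    proof (rule ccontr)
      assume "z i \<notin> val_ring"
      then have "z i ^ p - z i \<noteq> 0" "v (z i ^ p - z i) = int p * v (z i)" "v (z i) < 0"
        using val_artin_schreier[OF _ p1, of "z i"] by (auto simp: val_ring_def)
      then show False using in_ring p1 by (simp add: val_ring_def zero_le_mult_iff)
    qed
  qed
  let ?q = "emb (Fract Q (P ^ m))" and ?y = "z j ^ p - z j"
  have "Q \<noteq> 0" using bj P by auto
  have "\<not> P dvd Q" using bj(3) P(2) by (metis coprime_absorb_right coprime_commute)
  then have vq: "v ?q = - int m"
    using over \<open>Q \<noteq> 0\<close> P by (simp add: lies_over_def not_dvd_imp_multiplicity_0 multiplicity_same_power)
  have q0: "?q \<noteq> 0"
    using \<open>Q \<noteq> 0\<close> P by (intro rhom_field_nonzero[OF emb]) (simp add: Fract_conv_to_fract)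
  have "- (?y - emb (b j) + emb c) \<in> val_ring" using AS[of j] zO embO bj by (intro C(5) C(6)) auto
  moreover have "- (?y - emb (b j) + emb c) = ?q - ?y" using bj(1) by (simp add: rhom_add[OF emb])
  ultimately have "?q - ?y \<in> val_ring" by (simp only:)
  then have "?q - ?y = 0 \<or> v ?q < v (?q - ?y)" using vq bj(4) by (auto simp: val_ring_def)
  then have vy: "?y \<noteq> 0" "v ?y = - int m" using val_diff_eq[OF q0, of "?q - ?y"] vq by auto
  have "z j \<notin> val_ring"
  proof
    assume "z j \<in> val_ring"
    then have "?y \<in> val_ring" by (intro C(3) C(7))
    then show False using vy bj(4) by (simp add: val_ring_def)
  qed
  then have "int p * v (z j) = - int m" using val_artin_schreier[OF _ p1] vy by simp
  then have "int p dvd int m" by (metis dvd_minus_iff dvd_triv_left)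
  then show False using bj(5) by simp
qed

end

section \<open>The normal form\<close>

lemma foldr_wop_top_diff:
  assumes p: "prime p" and "\<And>i k. i \<in> set xs \<Longrightarrow> k < m \<Longrightarrow> \<delta> i k = \<delta>' i k" "\<And>k. k < m \<Longrightarrow> \<mu> k = \<mu>' k"
  shows "(\<forall>k<m. foldr (wop p 1) (map \<delta> xs) \<mu> k = foldr (wop p 1) (map \<delta>' xs) \<mu>' k) \<and>
    foldr (wop p 1) (map \<delta> xs) \<mu> m - foldr (wop p 1) (map \<delta>' xs) \<mu>' m =
      (\<Sum>i\<leftarrow>xs. \<delta> i m - \<delta>' i m) + (\<mu> m - \<mu>' m)"
  using assms(2)
proof (induction xs)
  case Nil
  then show ?case using assms(3) by simp
next
  case (Cons a xs)
  let ?A = "foldr (wop p 1) (map \<delta> xs) \<mu>" and ?B = "foldr (wop p 1) (map \<delta>' xs) \<mu>'"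
  have IH: "\<forall>k<m. ?A k = ?B k" "?A m - ?B m = (\<Sum>i\<leftarrow>xs. \<delta> i m - \<delta>' i m) + (\<mu> m - \<mu>' m)"
    using Cons by auto
  have "wop p 1 (\<delta> a) ?A k = wop p 1 (\<delta>' a) ?B k" if "k < m" for k
    using IH that Cons.prems by (intro wop_cong_below[OF p, of m]) auto
  moreover have "wop p 1 (\<delta> a) ?A m - wop p 1 (\<delta>' a) ?B m = (\<delta> a m - \<delta>' a m) + of_int 1 * (?A m - ?B m)"
    using IH Cons.prems by (intro wop_top_diff[OF p]) auto
  ultimately show ?case using IH(2) by (simp add: algebra_simps)
qed

text \<open>Truncating after every addition is harmless, as entries below \<open>n\<close> depend
  only on entries below \<open>n\<close>. The condition on \<mu> covers the empty list.\<close>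

lemma foldr_witt_add_eq_wop:
  assumes "prime p" "\<And>k. k \<ge> n \<Longrightarrow> \<mu> k = 0"
  shows "foldr (witt_add p n) xs \<mu> = (\<lambda>k. if k < n then foldr (wop p 1) xs \<mu> k else 0)"
proof (induction xs)
  case Nil
  then show ?case using assms(2) by (auto simp: fun_eq_iff)
next
  case (Cons x xs)
  have "wop p 1 x (\<lambda>k. if k < n then foldr (wop p 1) xs \<mu> k else 0) k = wop p 1 x (foldr (wop p 1) xs \<mu>) k"
    if "k < n" for k
    using that by (intro wop_cong_below[OF assms(1), of n]) auto
  then have *: "(\<lambda>k. if k < n then wop p 1 x (\<lambda>k. if k < n then foldr (wop p 1) xs \<mu> k else 0) k else 0) =
      (\<lambda>k. if k < n then wop p 1 x (foldr (wop p 1) xs \<mu>) k else 0)"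
    by (auto simp: fun_eq_iff)
  have "foldr (witt_add p n) (x # xs) \<mu> =
      witt_add p n x (\<lambda>k. if k < n then foldr (wop p 1) xs \<mu> k else 0)"
    using Cons by simp
  also have "\<dots> = (\<lambda>k. if k < n then foldr (wop p 1) (x # xs) \<mu> k else 0)"
    unfolding witt_add_eq_wop * foldr.simps o_apply ..
  finally show ?case .
qed

lemma subring_set_foldr_wop:
  assumes "subring_set A" "\<And>x k. x \<in> set xs \<Longrightarrow> x k \<in> A" "\<And>k. \<mu> k \<in> A"
  shows "foldr (wop p 1) xs \<mu> k \<in> A"
  using assms(2)
proof (induction xs arbitrary: k)
  case (Cons x xs)
  then show ?case using assms(1) by (auto intro!: subring_set_wop)
qed (use assms(3) in simp)

text \<open>The polynomial \<open>X ^ p - X\<close> has at most \<open>p\<close> roots, and the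
  \<open>p\<close> elements of the prime field already exhaust them.\<close>

lemma frobenius_fixed_imp_of_nat:
  fixes x :: "'b::field"
  assumes p: "prime p" "of_nat p = (0::'b)" and x: "x ^ p = x"
  shows "\<exists>i. x = of_nat i"
proof -
  have p1: "p > 1" using p prime_gt_1_nat by blast
  let ?f = "monom 1 p - monom 1 1 :: 'b poly"
  let ?R = "of_nat ` {..<p} :: 'b set"
  have "CHAR('b) dvd p" using p(2) by (simp add: of_nat_eq_0_iff_char_dvd)
  moreover have "CHAR('b) \<noteq> 1" using of_nat_CHAR[where 'a = 'b] by auto
  ultimately have ch: "CHAR('b) = p" using p(1) by (auto simp: prime_nat_iff)
  have "inj_on (of_nat :: nat \<Rightarrow> 'b) {..<p}"
  proof (rule linorder_inj_onI')
    fix i j assume "i \<in> {..<p}" "j \<in> {..<p}" "i < j"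
    then show "(of_nat i :: 'b) \<noteq> of_nat j"
      by (auto simp: of_nat_eq_iff_char_dvd ch dest!: dvd_imp_le)
  qed
  then have cR: "card ?R = p" by (simp add: card_image)
  have df: "degree ?f \<le> p" using p1 by (intro degree_diff_le degree_monom_le[THEN order_trans]) auto
  have "coeff ?f p = 1" using p1 by simp
  then have f0: "?f \<noteq> 0" by (metis coeff_0 zero_neq_one)
  have fx: "poly ?f y = y ^ p - y" for y by (simp add: poly_monom)
  have "of_nat i ^ p = (of_nat i :: 'b)" for i
  proof -
    have "rhom (\<lambda>x::'b. x ^ p)" by (rule rhom_frobenius[OF p])
    then show ?thesis by (rule rhom_of_nat)
  qed
  then have "poly ?f (of_nat i) = 0" for i unfolding fx by simp
  then have sub: "?R \<subseteq> {y. poly ?f y = 0}" by blast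
  have "card {y. poly ?f y = 0} \<le> p" using card_poly_roots_bound[OF f0] df by simp
  then have "?R = {y. poly ?f y = 0}"
    using sub cR poly_roots_finite[OF f0] by (metis card_seteq)
  moreover have "poly ?f x = 0" unfolding fx using x by simp
  ultimately show ?thesis by blast
qed

lemma fract_power_in_local_ring_at:
  fixes P P' :: "'a::field_gcd poly"
  assumes "monic_irred P" "monic_irred P'" "P \<noteq> P'"
  shows "Fract Q (P' ^ e) \<in> local_ring_at P"
proof -
  have irr: "irreducible P" "irreducible P'" "lead_coeff P = 1" "lead_coeff P' = 1"
    using assms by (auto simp: monic_irred_def)
  have pe: "prime_elem P" using irr irreducible_imp_prime_elem_gcd by blast
  have "\<not> P dvd P'"
  proof
    assume "P dvd P'"
    then obtain c where c: "P' = P * c" by blast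
    then have "is_unit c" using irr irreducibleD irreducible_not_unit by blast
    then obtain d where d: "c = [:d:]" by (auto simp: is_unit_poly_iff)
    then have "lead_coeff P' = lead_coeff P * d" using c by (simp add: lead_coeff_mult)
    then have "d = 1" using irr by simp
    then show False using c d assms(3) by simp
  qed
  then have "\<not> P dvd P' ^ e" using pe prime_elem_dvd_power by blast
  then show ?thesis unfolding local_ring_at_def by blast
qed

section \<open>Witt vector analogues of Artin--Schreier generators\<close>

context cyclic_ext
begin

definition witt_generator :: "(nat \<Rightarrow> 'K) \<Rightarrow> bool" where
  "witt_generator y \<longleftrightarrow> (\<forall>i<n. sg (y i) = wop p 1 y wone i)"

lemma artin_schreier_component_in_base:
  assumes y: "witt_generator y" and j: "j < n"
  shows "wop p (- 1) (\<lambda>i. y i ^ p) y j \<in> range emb"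
proof (rule fixed)
  note F = rhom_frobenius[OF prime char]
  have one: "(\<lambda>i. wone i ^ p) = (wone :: nat \<Rightarrow> 'K)"
    using prime_gt_0_nat[OF prime] by (auto simp: wone_def power_0_left)
  have "sg (wop p (- 1) (\<lambda>i. y i ^ p) y j) = wop p (- 1) (\<lambda>i. sg (y i) ^ p) (\<lambda>i. sg (y i)) j"
    by (simp add: rhom_wop[OF sg] rhom_power[OF sg])
  also have "\<dots> = wop p (- 1) (\<lambda>i. wop p 1 y wone i ^ p) (wop p 1 y wone) j"
    using y j by (intro wop_cong_below[OF prime, of n]) (auto simp: witt_generator_def)
  \<comment> \<open>In characteristic \<open>p\<close> Frobenius is a ring homomorphism and so
    commutes with Witt addition; it fixes \<open>wone\<close>, which then cancels in the
    difference.\<close>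
  also have "(\<lambda>i. wop p 1 y wone i ^ p) = wop p 1 (\<lambda>i. y i ^ p) wone"
    by (simp add: fun_eq_iff rhom_wop[OF F] one)
  also have "wop p (- 1) (wop p 1 (\<lambda>i. y i ^ p) wone) (wop p 1 y wone) = wop p (- 1) (\<lambda>i. y i ^ p) y"
    by (rule W.add_diff_cancel_right)
  finally show "sg (wop p (- 1) (\<lambda>i. y i ^ p) y j) = wop p (- 1) (\<lambda>i. y i ^ p) y j" .
qed

lemma witt_generator_shift:
  assumes y: "witt_generator y" and x: "\<And>i. sg (x i) = x i"
  shows "witt_generator (wop p 1 y x)"
  unfolding witt_generator_def
proof (intro allI impI)
  fix i assume i: "i < n"
  have "sg (wop p 1 y x i) = wop p 1 (\<lambda>i. sg (y i)) x i"
    by (simp add: rhom_wop[OF sg] x)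
  also have "\<dots> = wop p 1 (wop p 1 y wone) x i"
    using y i by (intro wop_cong_below[OF prime, of n]) (auto simp: witt_generator_def)
  also have "\<dots> = wop p 1 (wop p 1 y x) wone i"
    by (simp only: W.add.assoc W.add.commute W.add.left_commute)
  finally show "sg (wop p 1 y x i) = wop p 1 (wop p 1 y x) wone i" .
qed

text \<open>If \<open>b = a ^ p - a\<close>, then \<open>y 0 - emb a\<close> is fixed by Frobenius,
  lies in the prime field and is fixed by \<open>sg\<close>, although \<open>sg\<close> moves
  \<open>y 0\<close> by 1.\<close>

lemma witt_generator_0_not_artin_schreier:
  assumes y: "witt_generator y" and b: "wop p (- 1) (\<lambda>i. y i ^ p) y 0 = emb b"
  shows "b \<notin> artin_schreier_image p"
proof
  assume "b \<in> artin_schreier_image p"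
  then obtain a where a: "b = a ^ p - a" by (auto simp: artin_schreier_image_def)
  note F = rhom_frobenius[OF prime char]
  have w0: "wop p s x x' 0 = x 0 + of_int s * x' 0" if "s = 1 \<or> s = - 1" for s x and x' :: "nat \<Rightarrow> 'K"
  proof -
    have "wop p s (\<lambda>_. 0) (\<lambda>_. 0) = (\<lambda>_. 0 :: 'K)" using that by (auto simp: W.diff_self)
    then show ?thesis using wop_top_diff[OF prime, of 0 x "\<lambda>_. 0" x' "\<lambda>_. 0" s] by simp
  qed
  let ?w = "y 0 - emb a"
  have "y 0 ^ p - y 0 = emb a ^ p - emb a"
    using b w0[of "- 1" "\<lambda>i. y i ^ p" y] by (simp add: a rhom_simps[OF emb])
  then have "?w ^ p = ?w" by (simp add: rhom_diff[OF F] algebra_simps)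
  then obtain i where "?w = of_nat i" using frobenius_fixed_imp_of_nat[OF prime char] by blast
  then have "sg ?w = ?w" by (simp add: rhom_of_nat[OF sg])
  moreover have "sg (y 0) = y 0 + 1"
    using y n_pos w0[of 1 y wone] by (simp add: witt_generator_def wone_def)
  ultimately show False by (simp add: rhom_diff[OF sg] sg_emb)
qed

end

text \<open>Adding an entry \<open>emb a\<close> in position \<open>j\<close> changes the \<open>j\<close>-th component of the right-hand side by
  \<open>a ^ p - a\<close> without touching the lower ones; so the components are normalized one after another.
  A surviving pole at a prime outside \<open>Ps\<close> would have order prime to \<open>p\<close> and hence force ramification.\<close>

lemma normal_form_stage:
  fixes emb :: "'a::{finite,field_gcd} poly fract \<Rightarrow> 'K::field"
  assumes ext: "cyclic_ext emb CHAR('a) n sg"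
    and Ps: "distinct Ps" "\<forall>P\<in>set Ps. monic_irred P"
    and unram: "\<forall>P. monic_irred P \<longrightarrow> P \<notin> set Ps \<longrightarrow> \<not> ramified_at emb P"
  shows "j \<le> n \<Longrightarrow> \<exists>z Q e f. cyclic_ext.witt_generator CHAR('a) n sg z \<and>
    (\<forall>i<length Ps. \<forall>k. normal_pole (Ps ! i) (Q i k) (e i k)) \<and>
    (\<forall>k. degree (f k) > 0 \<longrightarrow> \<not> CHAR('a) dvd degree (f k)) \<and>
    (\<forall>k<j. wop CHAR('a) (- 1) (\<lambda>i. z i ^ CHAR('a)) z k =
      emb (foldr (wop CHAR('a) 1) (map (\<lambda>i k. Fract (Q i k) (Ps ! i ^ e i k)) [0..<length Ps])
        (\<lambda>k. Fract (f k) 1) k))"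
proof (induction j)
  case 0
  interpret cyclic_ext emb "CHAR('a)" n sg by (rule ext)
  obtain y where "witt_generator y" using exists_witt_generator by (auto simp: witt_generator_def)
  moreover have "\<forall>i<length Ps. \<forall>k. normal_pole (Ps ! i) ((\<lambda>_ _. 0) i k) ((\<lambda>_ _. 0) i k)"
    by (simp add: normal_pole_def)
  moreover have "\<forall>k. degree ((\<lambda>_. 0 :: 'a poly) k) > 0 \<longrightarrow> \<not> CHAR('a) dvd degree ((\<lambda>_. 0 :: 'a poly) k)"
    by simp
  ultimately show ?case
    by (intro exI[of _ y] exI[of _ "\<lambda>_ _. 0"] exI[of _ "\<lambda>_. 0"]) auto
next
  case (Suc j)
  interpret cyclic_ext emb "CHAR('a)" n sg by (rule ext)
  let ?p = "CHAR('a)" and ?r = "length Ps"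
  define B where "B Q e f = foldr (wop ?p 1) (map (\<lambda>i k. Fract (Q i k) (Ps ! i ^ e i k)) [0..<?r])
    (\<lambda>k. Fract (f k) 1)" for Q :: "nat \<Rightarrow> nat \<Rightarrow> 'a poly" and e :: "nat \<Rightarrow> nat \<Rightarrow> nat" and f :: "nat \<Rightarrow> 'a poly"
  have jn: "j < n" using Suc.prems by simp
  then obtain z Q e f where z: "witt_generator z"
    and Qe: "\<forall>i<?r. \<forall>k. normal_pole (Ps ! i) (Q i k) (e i k)"
    and f: "\<forall>k. degree (f k) > 0 \<longrightarrow> \<not> ?p dvd degree (f k)"
    and zB: "\<forall>k<j. wop ?p (- 1) (\<lambda>i. z i ^ ?p) z k = emb (B Q e f k)"
    using Suc.IH[OF less_imp_le[OF jn]] unfolding B_def by (elim exE conjE)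
  obtain b0 where b0: "wop ?p (- 1) (\<lambda>i. z i ^ ?p) z j = emb b0"
    using artin_schreier_component_in_base[OF z jn] by blast
  \<comment> \<open>With position \<open>j\<close> set to zero, \<open>?B0 j\<close> is the
    contribution of the lower entries alone; \<open>b0 - ?B0 j\<close> is what remains to be
    expressed by new entries in position \<open>j\<close>.\<close>
  define Q0 where "Q0 i = (Q i)(j := 0)" for i
  define e0 where "e0 i = (e i)(j := 0)" for i
  define f0 where "f0 = f(j := 0)"
  let ?B0 = "B Q0 e0 f0"
  have agree: "B Q' e' f' k = B Q'' e'' f'' k"
    if "\<And>i k. i < ?r \<Longrightarrow> k < j \<Longrightarrow> Q' i k = Q'' i k \<and> e' i k = e'' i k" "\<And>k. k < j \<Longrightarrow> f' k = f'' k" "k < j"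
    for Q' e' f' Q'' e'' f'' k
    unfolding B_def using that
    by (intro foldr_wop_top_diff[OF prime, THEN conjunct1, rule_format, of _ j]) auto
  obtain a S Qn en fn where S: "finite S" and SP: "\<forall>P\<in>S. monic_irred P \<and> normal_pole P (Qn P) (en P)"
    and red: "(b0 - ?B0 j) + (a ^ ?p - a) = (\<Sum>P\<in>S. Fract (Qn P) (P ^ en P)) + Fract fn 1"
    and fn: "degree fn > 0 \<longrightarrow> \<not> ?p dvd degree fn"
    using artin_schreier_reduction[of "b0 - ?B0 j"] by (elim exE conjE)
  define x where "x = (\<lambda>_. 0 :: 'K)(j := emb a)"
  define z' where "z' = wop ?p 1 z x"
  have z': "witt_generator z'"
    unfolding z'_def by (rule witt_generator_shift[OF z]) (auto simp: x_def sg_emb rhom_zero[OF sg])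
  have z0: "wop ?p 1 z (\<lambda>_. 0) = z" by (rule W.add.right_neutral)
  have z'_low: "z' k = z k" if "k < j" for k
  proof -
    have "wop ?p 1 z x k = wop ?p 1 z (\<lambda>_. 0) k"
      using that by (intro wop_cong_below[OF prime, of j]) (auto simp: x_def)
    then show ?thesis by (simp add: z'_def z0)
  qed
  have z'_j: "z' j = z j + emb a"
  proof -
    have "wop ?p 1 z x j - wop ?p 1 z (\<lambda>_. 0) j = (z j - z j) + of_int 1 * (x j - 0)"
      by (intro wop_top_diff[OF prime]) (auto simp: x_def)
    then show ?thesis by (simp add: z'_def z0 x_def algebra_simps)
  qed
  have low: "wop ?p (- 1) (\<lambda>i. z' i ^ ?p) z' k = emb (?B0 k)" if k: "k < j" for k
  proof -
    have "wop ?p (- 1) (\<lambda>i. z' i ^ ?p) z' k = wop ?p (- 1) (\<lambda>i. z i ^ ?p) z k"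
      using k z'_low by (intro wop_cong_below[OF prime, of j]) auto
    also have "\<dots> = emb (B Q e f k)" using zB k by blast
    also have "B Q e f k = ?B0 k"
      using k by (intro agree) (auto simp: Q0_def e0_def f0_def)
    finally show ?thesis .
  qed
  let ?top = "?B0 j + ((\<Sum>P\<in>S. Fract (Qn P) (P ^ en P)) + Fract fn 1)"
  have top: "wop ?p (- 1) (\<lambda>i. z' i ^ ?p) z' j = emb ?top"
  proof -
    have "wop ?p (- 1) (\<lambda>i. z' i ^ ?p) z' j - wop ?p (- 1) (\<lambda>i. z i ^ ?p) z j =
        (z' j ^ ?p - z j ^ ?p) + of_int (- 1) * (z' j - z j)"
      using z'_low by (intro wop_top_diff[OF prime]) auto
    then have "wop ?p (- 1) (\<lambda>i. z' i ^ ?p) z' j = emb b0 + (emb a ^ ?p - emb a)"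
      by (simp add: b0 z'_j power_add_prime_char[OF prime char] algebra_simps)
    also have "\<dots> = emb (b0 + (a ^ ?p - a))" by (simp add: rhom_simps[OF emb])
    also have "b0 + (a ^ ?p - a) = ?top" unfolding red[symmetric] by simp
    finally show ?thesis .
  qed
  \<comment> \<open>The partial fractions may involve primes outside \<open>Ps\<close>, for which
    the normal form has no place; their terms must vanish.\<close>
  have no_pole: "Fract (Qn P) (P ^ en P) = 0" if PS: "P \<in> S" "P \<notin> set Ps" for P
  proof (cases "en P = 0")
    case True
    then show ?thesis using SP PS(1) by (simp add: normal_pole_def Fract_conv_to_fract)
  next
    case False
    have mi: "monic_irred P" using SP PS by blast
    then have irr: "irreducible P" by (simp add: monic_irred_def)
    obtain v e where v: "discrete_valuation v" "lies_over emb v P e" "e \<ge> 1"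
      using exists_valuation_over[OF emb irr algebraic] by blast
    moreover have "\<not> e > 1" using unram mi PS(2) v unfolding ramified_at_def by blast
    ultimately have over: "lies_over emb v P 1" by (metis le_neq_implies_less)
    note R = subring_set_local_ring_at[OF irr]
    have B0_in: "?B0 k \<in> local_ring_at P" for k
      unfolding B_def
    proof (rule subring_set_foldr_wop[OF R])
      fix g k assume "g \<in> set (map (\<lambda>i k. Fract (Q0 i k) (Ps ! i ^ e0 i k)) [0..<?r])"
      then obtain i where i: "i < ?r" "g k = Fract (Q0 i k) (Ps ! i ^ e0 i k)" by auto
      have "Ps ! i \<in> set Ps" using i by simp
      then show "g k \<in> local_ring_at P"
        unfolding i(2) using mi Ps(2) PS(2) by (intro fract_power_in_local_ring_at) auto
    next
      show "Fract (f0 k) 1 \<in> local_ring_at P" for k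
        using to_fract_in_local_ring_at[OF irr, of "f0 k"] by (simp add: to_fract_def)
    qed
    \<comment> \<open>All of position \<open>j\<close> except the pole at \<open>P\<close>. It is
      integral at \<open>P\<close> because \<open>?B0\<close> involves only denominators from
      \<open>Ps\<close>, and the other terms have different primes.\<close>
    let ?c = "?B0 j + ((\<Sum>P\<in>S - {P}. Fract (Qn P) (P ^ en P)) + Fract fn 1)"
    have c: "?c \<in> local_ring_at P"
    proof (intro subring_setD(6)[OF R] B0_in subring_set_sum[OF R])
      show "Fract fn 1 \<in> local_ring_at P"
        using to_fract_in_local_ring_at[OF irr, of fn] by (simp add: to_fract_def)
      fix P' assume "P' \<in> S - {P}"
      then show "Fract (Qn P') (P' ^ en P') \<in> local_ring_at P"
        using SP mi by (intro fract_power_in_local_ring_at) auto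
    qed
    have split: "?top = ?c + Fract (Qn P) (P ^ en P)"
      using sum.remove[OF S PS(1), of "\<lambda>P. Fract (Qn P) (P ^ en P)"] by (simp only: add_ac)
    have np: "normal_pole P (Qn P) (en P)" using SP PS by blast
    let ?b = "?B0(j := ?top)"
    have False
    proof (rule unramified_no_pole[OF v(1) prime emb over irr, of j z' ?b ?c "Qn P" "en P"])
      show "wop ?p (- 1) (\<lambda>i. z' i ^ ?p) z' i = emb (?b i)" if "i \<le> j" for i
        using that low top by (cases "i = j") auto
      show "?b i \<in> local_ring_at P" if "i < j" for i using that B0_in by simp
      show "?b j = ?c + Fract (Qn P) (P ^ en P)" unfolding fun_upd_same by (rule split)
      show "coprime (Qn P) P" "en P > 0" "\<not> ?p dvd en P"
        using np False by (auto simp: normal_pole_def)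
    qed (rule c)
    then show ?thesis ..
  qed
  \<comment> \<open>A prime of \<open>Ps\<close> that does not occur in \<open>S\<close> gets
    numerator and exponent 0, which \<open>normal_pole\<close> admits.\<close>
  define Q' where "Q' i = (Q0 i)(j := if Ps ! i \<in> S then Qn (Ps ! i) else 0)" for i
  define e' where "e' i = (e0 i)(j := if Ps ! i \<in> S then en (Ps ! i) else 0)" for i
  define f' where "f' = f0(j := fn)"
  have norm: "normal_pole (Ps ! i) (Q' i k) (e' i k)" if "i < ?r" for i k
    using Qe that SP by (auto simp: Q'_def e'_def Q0_def e0_def normal_pole_def)
  have normf: "\<not> ?p dvd degree (f' k)" if "degree (f' k) > 0" for k
    using that f fn by (auto simp: f'_def f0_def split: if_splits)
  have B'_low: "B Q' e' f' k = ?B0 k" if "k < j" for k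
    using that by (intro agree) (auto simp: Q'_def e'_def f'_def)
  have B'_j: "B Q' e' f' j = ?top"
  proof -
    let ?g = "\<lambda>P. if P \<in> S then Fract (Qn P) (P ^ en P) else 0"
    let ?d = "\<lambda>i. Fract (Q' i j) (Ps ! i ^ e' i j) - Fract (Q0 i j) (Ps ! i ^ e0 i j)"
    have "B Q' e' f' j - ?B0 j = (\<Sum>i\<leftarrow>[0..<?r]. ?d i) + (Fract (f' j) 1 - Fract (f0 j) 1)"
      unfolding B_def
      by (rule foldr_wop_top_diff[OF prime, THEN conjunct2]) (auto simp: Q'_def e'_def f'_def)
    also have "map ?d [0..<?r] = map ?g (map (\<lambda>i. Ps ! i) [0..<?r])"
      by (auto simp: Q'_def e'_def Q0_def e0_def Fract_conv_to_fract)
    also have "sum_list \<dots> = (\<Sum>P\<in>set Ps. ?g P)"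
      unfolding map_nth using Ps(1) by (rule sum_list_distinct_conv_sum_set)
    also have "\<dots> = (\<Sum>P\<in>set Ps \<inter> S. Fract (Qn P) (P ^ en P))"
      by (simp add: sum.inter_restrict)
    also have "\<dots> = (\<Sum>P\<in>S. Fract (Qn P) (P ^ en P))"
      using S no_pole by (intro sum.mono_neutral_left) auto
    also have "Fract (f' j) 1 - Fract (f0 j) 1 = Fract fn 1"
      by (simp add: f'_def f0_def Fract_conv_to_fract)
    finally show ?thesis by (simp add: algebra_simps)
  qed
  have "\<forall>k<Suc j. wop ?p (- 1) (\<lambda>i. z' i ^ ?p) z' k = emb (B Q' e' f' k)"
    using low top B'_low B'_j by (auto simp: less_Suc_eq)
  then show ?case
    using z' norm normf unfolding B_def
    by (intro exI[of _ z'] exI[of _ Q'] exI[of _ e'] exI[of _ f']) auto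
qed

theorem theorem5p3p1:
  fixes emb :: "'a::{finite,field_gcd} poly fract \<Rightarrow> 'K::field"
    and n r :: nat
    and Ps :: "'a poly list"
  assumes "field_hom emb"
    and "n \<ge> 1"
    and "cyclic_galois_of_degree emb (CHAR('a) ^ n)"
    and "length Ps = r" and "distinct Ps" and "\<forall>P\<in>set Ps. monic_irred P"
    and "\<forall>P. monic_irred P \<longrightarrow> (ramified_at emb P \<longleftrightarrow> P \<in> set Ps)"
  shows "\<exists>(y :: nat \<Rightarrow> 'K) (Q :: nat \<Rightarrow> nat \<Rightarrow> 'a poly) (e :: nat \<Rightarrow> nat \<Rightarrow> nat) (f :: nat \<Rightarrow> 'a poly).
     UNIV = gen_field (range emb \<union> y ` {..<n}) \<and>
     (\<forall>i<r. \<forall>j<n. e i j > 0 \<longrightarrow>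
         \<not> CHAR('a) dvd e i j \<and> coprime (Q i j) (Ps ! i) \<and> degree (Q i j) < degree ((Ps ! i) ^ e i j)) \<and>
     (\<forall>j<n. degree (f j) > 0 \<longrightarrow> \<not> CHAR('a) dvd degree (f j)) \<and>
     (let \<delta> = (\<lambda>i j. if j < n then Fract (Q i j) ((Ps ! i) ^ e i j) else 0);
          \<mu> = (\<lambda>j. if j < n then Fract (f j) 1 else 0);
          \<beta> = foldr (witt_add CHAR('a) n) (map \<delta> [0..<r]) \<mu>
      in witt_sub CHAR('a) n (\<lambda>j. y j ^ CHAR('a)) y = (\<lambda>j. emb (\<beta> j)) \<and>
         \<beta> 0 \<notin> artin_schreier_image CHAR('a))"
proof -
  let ?p = "CHAR('a)"
  have emb: "rhom emb" using assms(1) by (simp add: field_hom_def rhom_def)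
  have "of_nat ?p = (0 :: 'K)"
    using arg_cong[OF of_nat_CHAR_poly_fract[where 'a = 'a], of emb]
    by (simp add: rhom_of_nat[OF emb] rhom_zero[OF emb])
  then obtain sg where ext: "cyclic_ext emb ?p n sg"
    using cyclic_galois_imp_cyclic_ext[OF assms(3) emb prime_CHAR_finite _ assms(2)] by blast
  interpret cyclic_ext emb ?p n sg by (rule ext)
  have unram: "\<forall>P. monic_irred P \<longrightarrow> P \<notin> set Ps \<longrightarrow> \<not> ramified_at emb P"
    using assms(7) by blast
  obtain z Q e f where z: "witt_generator z"
    and Qe: "\<forall>i<r. \<forall>k. normal_pole (Ps ! i) (Q i k) (e i k)"
    and f: "\<forall>k. degree (f k) > 0 \<longrightarrow> \<not> ?p dvd degree (f k)"
    and zB: "\<forall>k<n. wop ?p (- 1) (\<lambda>i. z i ^ ?p) z k =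
      emb (foldr (wop ?p 1) (map (\<lambda>i k. Fract (Q i k) (Ps ! i ^ e i k)) [0..<r]) (\<lambda>k. Fract (f k) 1) k)"
    using normal_form_stage[OF ext assms(5,6) unram order_refl] unfolding assms(4) by (elim exE conjE)
  define \<delta> where "\<delta> = (\<lambda>i j. if j < n then Fract (Q i j) (Ps ! i ^ e i j) else 0)"
  define \<mu> where "\<mu> = (\<lambda>j. if j < n then Fract (f j) 1 else 0)"
  define \<beta> where "\<beta> = foldr (witt_add ?p n) (map \<delta> [0..<r]) \<mu>"
  have \<beta>: "\<beta> k = (if k < n then foldr (wop ?p 1) (map \<delta> [0..<r]) \<mu> k else 0)" for k
    unfolding \<beta>_def by (subst foldr_witt_add_eq_wop[OF prime]) (auto simp: \<mu>_def)
  have emb\<beta>: "wop ?p (- 1) (\<lambda>i. z i ^ ?p) z k = emb (\<beta> k)" if k: "k < n" for k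
  proof -
    have "foldr (wop ?p 1) (map (\<lambda>i k. Fract (Q i k) (Ps ! i ^ e i k)) [0..<r]) (\<lambda>k. Fract (f k) 1) k =
        foldr (wop ?p 1) (map \<delta> [0..<r]) \<mu> k"
      using k by (intro foldr_wop_top_diff[OF prime, THEN conjunct1, rule_format, of _ n])
        (auto simp: \<delta>_def \<mu>_def)
    then show ?thesis using zB k by (simp add: \<beta>)
  qed
  have "witt_sub ?p n (\<lambda>j. z j ^ ?p) z = (\<lambda>j. emb (\<beta> j))"
    using emb\<beta> by (auto simp: witt_sub_eq_wop \<beta> rhom_zero[OF emb])
  moreover have "\<beta> 0 \<notin> artin_schreier_image ?p"
    using witt_generator_0_not_artin_schreier[OF z] emb\<beta>[of 0] assms(2) by simp
  moreover have "UNIV = gen_field (range emb \<union> z ` {..<n})"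
    using gen_field_witt_generator[of z] z by (simp add: witt_generator_def)
  ultimately show ?thesis
    using Qe f unfolding Let_def \<beta>_def \<delta>_def \<mu>_def normal_pole_def
    by (intro exI[of _ z] exI[of _ Q] exI[of _ e] exI[of _ f]) auto
qed


end
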